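(* Let $\Gamma$ be a group, let $E$ be a $\Gamma$-semilattice and let $\mathfrak R$ be a collection of finite covers for $E$ such that $(E,\mathfrak R)$ satisfies conditions (i), (ii) and (iii) of the context. Let $I$ be the ideal of $\mathbb Z[E^\times]$ generated by all $e-\bigvee\mathcal R$ with $e\in E^\times$, $\mathcal R\in\mathfrak R(e)$. Put $E_0:=E$, $\mathfrak R_0:=\mathfrak R$, $E_{k+1}:=E(E_k,\mathfrak R_k)$, $\mathfrak R_{k+1}:=\mathfrak R(E_k,\mathfrak R_k)$ for $k\ge0$. If $\sup_{e\in E^\times}|\mathfrak R(e)|<\infty$, then the sequence $$\cdots\to\mathbb Z[E_2^\times]\to\mathbb Z[E_1^\times]\to\mathbb Z[E^\times]\to\mathbb Z[E^\times]/I\to 0$$ (whose maps are the canonical projection $\mathbb Z[E^\times]\to\mathbb Z[E^\times]/I$ and the homomorphisms induced by the inclusions $E_{k+1}\hookrightarrow\mathrm{Idem}(\mathbb Z[E_k^\times])$) is an algebraic independent resolution of $\mathbb Z[E^\times]/I$ of length at most $\sup_{e\in E^\times}|\mathfrak R(e)|$.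
   Context: **Semilattices.** A semilattice is a commutative semigroup $E$ in which every element is idempotent; all semilattices have a zero element $0$ (so $0e=0$ for all $e$). Write $e\le f$ if $ef=e$, and $e\lneq f$ if $e\le f$ and $e\ne f$. Put $E^\times=E\setminus\{0\}$. $\mathbb Z[E^\times]$ is the free $\mathbb Z$-module on $E^\times$ with the bilinear multiplication for which the product of basis elements $e,f$ is $ef$ if $ef\neq0$ in $E$ and $0$ otherwise. $\mathbb Z$-algebras need not be unital. For a $\mathbb Z$-algebra $A$, $\mathrm{Idem}(A)=\{a\in A: a^2=a\}$; a semigroup homomorphism $E\to\mathrm{Idem}(A)$ mapping $0$ to $0$ extends uniquely to a $\mathbb Z$-algebra homomorphism $\mathbb Z[E^\times]\to A$. A $\Gamma$-semilattice is a semilattice with an action $(g,e)\mapsto\tau_g(e)$ of the group $\Gamma$ by semigroup automorphisms; it induces an action on $\mathbb Z[E^\times]$. For finitely many commuting idempotents, $\bigvee_{j\in J}e_j=\sum_{\varnothing\ne J'\subseteq J}(-1)^{|J'|-1}\prod_{j\in J'}e_j$ (zero if $J=\varnothing$); for a finite set $\mathcal R\subseteq E^\times$, $\bigvee\mathcal R:=\bigvee_{f\in\mathcal R}f\in\mathbb Z[E^\times]$. For $x=\sum_{\varepsilon\in E^\times}n_\varepsilon\varepsilon\in\mathbb Z[E^\times]$ let $E(x)=\{\varepsilon\in E^\times:n_\varepsilon\neq0\}$ be its support. **Algebraic independent resolution.** For a commutative $\mathbb Z$-algebra $D$ with $\Gamma$-action, an algebraic independent resolution of $D$ is a long exact sequence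 $\cdots\to\mathbb Z[E_2^\times]\to\mathbb Z[E_1^\times]\to\mathbb Z[E_0^\times]\to D\to0$ of $\Gamma$-equivariant homomorphisms, where the $E_k$ are $\Gamma$-semilattices. Its length is the smallest integer $n\ge0$ with $E_{n+1}=\{0\}$ (and $\infty$ if there is none). **Finite covers.** A finite cover for $e\in E^\times$ is a finite subset $\mathcal R\subseteq E^\times$ such that $f\le e$ for all $f\in\mathcal R$, and for every $f'\in E^\times$ with $f'\le e$ there is $f\in\mathcal R$ with $f'f\ne0$. A collection of finite covers $\mathfrak R$ for $E$ assigns to every $e\in E^\times$ a set $\mathfrak R(e)$ of finite covers for $e$. For $d\in E^\times$, $d\cdot\mathcal R=\{df:f\in\mathcal R\}$ and $(d\cdot\mathcal R)^\times=(d\cdot\mathcal R)\cap E^\times$. **Conditions on a pair $(E,\mathfrak R)$.** (i) For $d,e\in E^\times$ with $de\ne0$ and $\mathcal R\in\mathfrak R(e)$: either $de\in(d\cdot\mathcal R)^\times$ or $(d\cdot\mathcal R)^\times\in\mathfrak R(de)$. (ii) For $e\in E^\times$, pairwise distinct $\mathcal R_1,\dots,\mathcal R_r\in\mathfrak R(e)$ and $\varepsilon_i\in E(\bigvee\mathcal R_i)$ ($1\le i\le r$), put $\varepsilon=\prod_{i=1}^r\varepsilon_i$ and $\varepsilon(\check j)=\prod_{i\ne j}\varepsilon_i$ (for $r=1$, $\varepsilon(\check j)=e$). Then for every $1\le j\le r$: if $\varepsilon(\check j)\neq0$, then $\varepsilon\lneq\varepsilon(\check j)$. (iii) For all $g\in\Gamma$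 and $e\in E^\times$: $\tau_g(\mathfrak R(e))=\mathfrak R(\tau_g(e))$. **The construction $(E(E,\mathfrak R),\mathfrak R(E,\mathfrak R))$.** Let $(E,\mathfrak R)$ satisfy (i)–(iii). For $e\in E^\times$ and a non-empty finite subset $\mathfrak S_e\subseteq\mathfrak R(e)$ put $e(\mathfrak S_e)=\prod_{\mathcal R\in\mathfrak S_e}(e-\bigvee\mathcal R)\in\mathbb Z[E^\times]$. Let $E(E,\mathfrak R)=\{e(\mathfrak S_e): e\in E^\times,\ \varnothing\ne\mathfrak S_e\subseteq\mathfrak R(e)\text{ finite}\}\cup\{0\}\subseteq\mathrm{Idem}(\mathbb Z[E^\times])$, with the multiplication of $\mathbb Z[E^\times]$ and the restriction of the $\Gamma$-action on $\mathbb Z[E^\times]$. For $\tilde{\mathcal R}\in\mathfrak R(e)\setminus\mathfrak S_e$ put $\mathcal R(\mathfrak S_e,\tilde{\mathcal R})=\{e(\mathfrak S_e\cup\{\tilde{\mathcal R}\})\}\cup\{f\cdot e(\mathfrak S_e): f\in\tilde{\mathcal R},\ f\cdot e(\mathfrak S_e)\neq0\}$, and $\mathfrak R(E,\mathfrak R)(e(\mathfrak S_e))=\{\mathcal R(\mathfrak S_e,\tilde{\mathcal R}):\tilde{\mathcal R}\in\mathfrak R(e)\setminus\mathfrak S_e\}$. The pair $(E(E,\mathfrak R),\mathfrak R(E,\mathfrak R))$ is again a $\Gamma$-semilattice with a collection of finite covers satisfying (i)–(iii), so the construction can be iterated. *)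

theory Defs
  imports
    "HOL-Algebra.QuotRing"
    "HOL-Algebra.Group_Action"
    "HOL-Library.Poly_Mapping"
    "HOL-Library.FSet"
    "HOL-Library.Extended_Nat"
begin

section \<open>Semilattices with a group action\<close>

record ('g, 'a) gsl = "'a partial_object" +
  meet :: "'a \<Rightarrow> 'a \<Rightarrow> 'a"
  bot :: 'a
  act :: "'g \<Rightarrow> 'a \<Rightarrow> 'a"

text \<open>\<^const>\<open>group_action\<close> asks for extensional maps, hence the \<^const>\<open>restrict\<close>.\<close>

locale gamma_semilattice =
  fixes G :: "('g, 'm) monoid_scheme" and E :: "('g, 'a) gsl"
  assumes group_G: "group G"
    and meet_closed: "\<lbrakk>e \<in> carrier E; f \<in> carrier E\<rbrakk> \<Longrightarrow> meet E e f \<in> carrier E"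
    and meet_assoc: "\<lbrakk>e \<in> carrier E; f \<in> carrier E; h \<in> carrier E\<rbrakk>
          \<Longrightarrow> meet E (meet E e f) h = meet E e (meet E f h)"
    and meet_comm: "\<lbrakk>e \<in> carrier E; f \<in> carrier E\<rbrakk> \<Longrightarrow> meet E e f = meet E f e"
    and meet_idem: "e \<in> carrier E \<Longrightarrow> meet E e e = e"
    and bot_closed: "bot E \<in> carrier E"
    and bot_meet: "e \<in> carrier E \<Longrightarrow> meet E (bot E) e = bot E"
    and action: "group_action G (carrier E) (\<lambda>g. restrict (act E g) (carrier E))"
    and act_meet: "\<lbrakk>g \<in> carrier G; e \<in> carrier E; f \<in> carrier E\<rbrakk>
          \<Longrightarrow> act E g (meet E e f) = meet E (act E g e) (act E g f)"

definition nonzero :: "('g, 'a) gsl \<Rightarrow> 'a set" where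
  "nonzero E = carrier E - {bot E}"

definition sl_le :: "('g, 'a) gsl \<Rightarrow> 'a \<Rightarrow> 'a \<Rightarrow> bool" where
  "sl_le E e f \<longleftrightarrow> meet E e f = e"

definition sl_less :: "('g, 'a) gsl \<Rightarrow> 'a \<Rightarrow> 'a \<Rightarrow> bool" where
  "sl_less E e f \<longleftrightarrow> sl_le E e f \<and> e \<noteq> f"


section \<open>Products over non-empty finite sets\<close>

text \<open>The multiplications at hand need not have a unit, so \<open>finprod\<close> is not available. The
  product is taken along some enumeration of the index set; the lemmas below show that for a
  commutative associative multiplication the enumeration does not matter.\<close>

definition list_prod :: "('b \<Rightarrow> 'b \<Rightarrow> 'b) \<Rightarrow> ('i \<Rightarrow> 'b) \<Rightarrow> 'i list \<Rightarrow> 'b" where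
  "list_prod m f xs = foldr m (map f (butlast xs)) (f (last xs))"

definition set_prod :: "('b \<Rightarrow> 'b \<Rightarrow> 'b) \<Rightarrow> ('i \<Rightarrow> 'b) \<Rightarrow> 'i set \<Rightarrow> 'b" where
  "set_prod m f J = list_prod m f (SOME xs. set xs = J \<and> distinct xs)"

lemma list_prod_single: "list_prod m f [x] = f x"
  by (simp add: list_prod_def)

lemma list_prod_Cons: "xs \<noteq> [] \<Longrightarrow> list_prod m f (x # xs) = m (f x) (list_prod m f xs)"
  by (simp add: list_prod_def)

lemma set_prod_singleton: "set_prod m f {j} = f j"
proof -
  have "xs = [j]" if "set xs = {j} \<and> distinct xs" for xs
  proof -
    have "length xs = 1" using that distinct_card[of xs] by simp
    then obtain x where "xs = [x]" by (auto simp: length_Suc_conv)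
    then show ?thesis using that by simp
  qed
  then have "(SOME xs. set xs = {j} \<and> distinct xs) = [j]"
    by (intro some_equality) auto
  then show ?thesis
    by (simp add: set_prod_def list_prod_single)
qed

context
  fixes C :: "'b set" and m :: "'b \<Rightarrow> 'b \<Rightarrow> 'b" and f :: "'i \<Rightarrow> 'b"
  assumes closed: "\<And>x y. \<lbrakk>x \<in> C; y \<in> C\<rbrakk> \<Longrightarrow> m x y \<in> C"
    and assoc: "\<And>x y z. \<lbrakk>x \<in> C; y \<in> C; z \<in> C\<rbrakk> \<Longrightarrow> m (m x y) z = m x (m y z)"
    and comm: "\<And>x y. \<lbrakk>x \<in> C; y \<in> C\<rbrakk> \<Longrightarrow> m x y = m y x"
begin

lemma list_prod_closed: "\<lbrakk>xs \<noteq> []; f ` set xs \<subseteq> C\<rbrakk> \<Longrightarrow> list_prod m f xs \<in> C"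
  by (induction xs rule: list_nonempty_induct) (auto simp: list_prod_single list_prod_Cons closed)

lemma list_prod_remove1:
  "\<lbrakk>x \<in> set xs; remove1 x xs \<noteq> []; f ` set xs \<subseteq> C\<rbrakk>
    \<Longrightarrow> list_prod m f xs = m (f x) (list_prod m f (remove1 x xs))"
proof (induction xs)
  case (Cons y ys)
  show ?case
  proof (cases "x = y")
    case True
    then show ?thesis using Cons.prems by (simp add: list_prod_Cons)
  next
    case False
    then have x: "x \<in> set ys" and ys: "ys \<noteq> []" using Cons.prems by auto
    have C: "f x \<in> C" "f y \<in> C" using Cons.prems x by auto
    show ?thesis
    proof (cases "remove1 x ys = []")
      case True
      then have "ys = [x]" using x by (cases ys) (auto split: if_splits)
      then show ?thesis using False C by (simp add: list_prod_Cons list_prod_single comm)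
    next
      case rem: False
      have "list_prod m f (remove1 x ys) \<in> C"
        using Cons.prems(3) set_remove1_subset[of x ys] by (intro list_prod_closed rem) auto
      moreover have "list_prod m f ys = m (f x) (list_prod m f (remove1 x ys))"
        using Cons x rem by auto
      ultimately show ?thesis
        using False C ys rem by (simp add: list_prod_Cons) (simp add: assoc[symmetric] comm)
    qed
  qed
qed simp

lemma list_prod_cong_set:
  "\<lbrakk>distinct xs; distinct ys; set xs = set ys; xs \<noteq> []; f ` set xs \<subseteq> C\<rbrakk>
    \<Longrightarrow> list_prod m f xs = list_prod m f ys"
proof (induction xs arbitrary: ys)
  case (Cons x xs)
  have x: "x \<in> set ys" using Cons.prems by auto
  have s: "set (remove1 x ys) = set xs" using Cons.prems by auto
  show ?case
  proof (cases "xs = []")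
    case True
    then have "remove1 x ys = []" using s by simp
    then have "ys = [x]" using x by (cases ys) (auto split: if_splits)
    then show ?thesis using True by simp
  next
    case False
    then have "remove1 x ys \<noteq> []" using s by auto
    moreover have "list_prod m f xs = list_prod m f (remove1 x ys)"
      using Cons False s by (intro Cons.IH) auto
    ultimately show ?thesis
      using Cons.prems False x list_prod_remove1[of x ys] by (simp add: list_prod_Cons)
  qed
qed simp

lemma set_prod_insert:
  assumes "finite J" "J \<noteq> {}" "j \<notin> J" "f ` insert j J \<subseteq> C"
  shows "set_prod m f (insert j J) = m (f j) (set_prod m f J)"
proof -
  define en :: "'i set \<Rightarrow> 'i list" where "en = (\<lambda>J. SOME xs. set xs = J \<and> distinct xs)"
  have en: "set (en K) = K \<and> distinct (en K)" if "finite K" for K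
    unfolding en_def using someI_ex[OF finite_distinct_list[OF that]] .
  have 1: "set (en J) = J \<and> distinct (en J)"
    and 2: "set (en (insert j J)) = insert j J \<and> distinct (en (insert j J))"
    using en assms(1) by auto
  have ne: "en J \<noteq> []" using 1 assms(2) by auto
  have "list_prod m f (en (insert j J)) = list_prod m f (j # en J)"
    using 1 2 assms by (intro list_prod_cong_set) auto
  then show ?thesis
    using ne unfolding set_prod_def en_def by (simp only: list_prod_Cons not_False_eq_True)
qed

end


section \<open>The algebra \<open>\<int>[E\<^sup>\<times>]\<close>\<close>

text \<open>Elements are finitely supported integer functions, i.e. the type of \<^const>\<open>frag_extend\<close>,
  whose support \<^const>\<open>Poly_Mapping.keys\<close> lies in \<^term>\<open>nonzero E\<close>.\<close>

definition free_mult :: "('g, 'a) gsl \<Rightarrow> ('a \<Rightarrow>\<^sub>0 int) \<Rightarrow> ('a \<Rightarrow>\<^sub>0 int) \<Rightarrow> ('a \<Rightarrow>\<^sub>0 int)" where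
  "free_mult E x y =
     frag_extend (\<lambda>e. frag_extend (\<lambda>f. if meet E e f = bot E then 0 else frag_of (meet E e f)) y) x"

definition free_act :: "('g, 'a) gsl \<Rightarrow> 'g \<Rightarrow> ('a \<Rightarrow>\<^sub>0 int) \<Rightarrow> ('a \<Rightarrow>\<^sub>0 int)" where
  "free_act E g = frag_extend (\<lambda>e. frag_of (act E g e))"

text \<open>Algebras need not be unital. They are represented by ring records whose field \<^const>\<open>one\<close>
  carries no meaning.\<close>

definition free_alg :: "('g, 'a) gsl \<Rightarrow> ('a \<Rightarrow>\<^sub>0 int) ring" where
  "free_alg E = \<lparr>carrier = {x. Poly_Mapping.keys x \<subseteq> nonzero E}, mult = free_mult E,
     one = undefined, zero = 0, add = (+)\<rparr>"

definition join :: "('g, 'a) gsl \<Rightarrow> 'a set \<Rightarrow> ('a \<Rightarrow>\<^sub>0 int)" where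
  "join E R = (\<Sum>J \<in> {J. J \<subseteq> R \<and> J \<noteq> {}}.
     frag_cmul ((-1) ^ (card J - 1)) (set_prod (free_mult E) frag_of J))"


section \<open>Finite covers and the conditions (i)--(iii)\<close>

definition finite_cover :: "('g, 'a) gsl \<Rightarrow> 'a \<Rightarrow> 'a set \<Rightarrow> bool" where
  "finite_cover E e R \<longleftrightarrow> finite R \<and> R \<subseteq> nonzero E \<and> (\<forall>f\<in>R. sl_le E f e) \<and>
     (\<forall>f'\<in>nonzero E. sl_le E f' e \<longrightarrow> (\<exists>f\<in>R. meet E f' f \<noteq> bot E))"

text \<open>The values of a collection of finite covers outside \<^term>\<open>nonzero E\<close> are irrelevant.\<close>

definition cover_collection :: "('g, 'a) gsl \<Rightarrow> ('a \<Rightarrow> 'a set set) \<Rightarrow> bool" where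
  "cover_collection E \<RR> \<longleftrightarrow> (\<forall>e\<in>nonzero E. \<forall>R\<in>\<RR> e. finite_cover E e R)"

definition cond_i :: "('g, 'a) gsl \<Rightarrow> ('a \<Rightarrow> 'a set set) \<Rightarrow> bool" where
  "cond_i E \<RR> \<longleftrightarrow> (\<forall>d\<in>nonzero E. \<forall>e\<in>nonzero E. \<forall>R\<in>\<RR> e. meet E d e \<noteq> bot E \<longrightarrow>
     meet E d e \<in> meet E d ` R \<inter> nonzero E \<or> meet E d ` R \<inter> nonzero E \<in> \<RR> (meet E d e))"

definition cond_ii :: "('g, 'a) gsl \<Rightarrow> ('a \<Rightarrow> 'a set set) \<Rightarrow> bool" where
  "cond_ii E \<RR> \<longleftrightarrow> (\<forall>e\<in>nonzero E. \<forall>r::nat. \<forall>R :: nat \<Rightarrow> 'a set. \<forall>\<epsilon> :: nat \<Rightarrow> 'a.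
     1 \<le> r \<longrightarrow> inj_on R {1..r} \<longrightarrow>
     (\<forall>i\<in>{1..r}. R i \<in> \<RR> e \<and> \<epsilon> i \<in> Poly_Mapping.keys (join E (R i))) \<longrightarrow>
     (\<forall>j\<in>{1..r}.
        let p = set_prod (meet E) \<epsilon> {1..r};
            q = (if r = 1 then e else set_prod (meet E) \<epsilon> ({1..r} - {j}))
        in q \<noteq> bot E \<longrightarrow> sl_less E p q))"

definition cond_iii ::
    "('g, 'm) monoid_scheme \<Rightarrow> ('g, 'a) gsl \<Rightarrow> ('a \<Rightarrow> 'a set set) \<Rightarrow> bool" where
  "cond_iii G E \<RR> \<longleftrightarrow>
     (\<forall>g\<in>carrier G. \<forall>e\<in>nonzero E. (\<lambda>R. act E g ` R) ` \<RR> e = \<RR> (act E g e))"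


section \<open>The construction \<open>(E(E,\<RR>), \<RR>(E,\<RR>))\<close>\<close>

definition cover_diff :: "('g, 'a) gsl \<Rightarrow> 'a \<Rightarrow> 'a set \<Rightarrow> ('a \<Rightarrow>\<^sub>0 int)" where
  "cover_diff E e R = frag_of e - join E R"

definition cover_prod :: "('g, 'a) gsl \<Rightarrow> 'a \<Rightarrow> 'a set set \<Rightarrow> ('a \<Rightarrow>\<^sub>0 int)" where
  "cover_prod E e S = set_prod (free_mult E) (cover_diff E e) S"

definition next_sl :: "('g, 'a) gsl \<Rightarrow> ('a \<Rightarrow> 'a set set) \<Rightarrow> ('g, 'a \<Rightarrow>\<^sub>0 int) gsl" where
  "next_sl E \<RR> =
     \<lparr>carrier = {cover_prod E e S | e S. e \<in> nonzero E \<and> finite S \<and> S \<noteq> {} \<and> S \<subseteq> \<RR> e} \<union> {0},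
      meet = free_mult E, bot = 0, act = free_act E\<rparr>"

definition next_cover ::
    "('g, 'a) gsl \<Rightarrow> 'a \<Rightarrow> 'a set set \<Rightarrow> 'a set \<Rightarrow> ('a \<Rightarrow>\<^sub>0 int) set" where
  "next_cover E e S R = {cover_prod E e (S \<union> {R})} \<union>
     {free_mult E (frag_of f) (cover_prod E e S) | f.
        f \<in> R \<and> free_mult E (frag_of f) (cover_prod E e S) \<noteq> 0}"

text \<open>The pair \<open>(e, S)\<close> is determined by \<^term>\<open>cover_prod E e S\<close> when (i)--(iii) hold, so at most
  one pair contributes to the set below.\<close>

definition next_covers ::
    "('g, 'a) gsl \<Rightarrow> ('a \<Rightarrow> 'a set set) \<Rightarrow> ('a \<Rightarrow>\<^sub>0 int) \<Rightarrow> ('a \<Rightarrow>\<^sub>0 int) set set" where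
  "next_covers E \<RR> x = {next_cover E e S R | e S R.
     e \<in> nonzero E \<and> finite S \<and> S \<noteq> {} \<and> S \<subseteq> \<RR> e \<and> x = cover_prod E e S \<and> R \<in> \<RR> e - S}"


section \<open>Iterating the construction\<close>

text \<open>Since \<open>E\<^sub>k\<^sub>+\<^sub>1\<close> consists of elements of \<open>\<int>[E\<^sub>k\<^sup>\<times>]\<close>, its type changes with \<open>k\<close>. The type below
  contains a copy of \<open>'a\<close> (via \<open>Base\<close>) and of the finitely supported integer functions on itself
  (via \<open>comb\<close>, which records the graph over the support), so that all \<open>E\<^sub>k\<close> can be transported to
  it.\<close>

datatype 'a iter = Base 'a | Comb "('a iter \<times> int) fset"

definition comb :: "('a iter \<Rightarrow>\<^sub>0 int) \<Rightarrow> 'a iter" where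
  "comb x = Comb (Abs_fset ((\<lambda>e. (e, Poly_Mapping.lookup x e)) ` Poly_Mapping.keys x))"

lemma inj_Base: "inj Base"
  by (simp add: inj_def)

lemma inj_comb: "inj comb"
proof (rule injI)
  fix x y :: "'a iter \<Rightarrow>\<^sub>0 int"
  let ?gr = "\<lambda>x :: 'a iter \<Rightarrow>\<^sub>0 int. (\<lambda>e. (e, Poly_Mapping.lookup x e)) ` Poly_Mapping.keys x"
  assume "comb x = comb y"
  then have gr: "?gr x = ?gr y"
    by (simp add: comb_def Abs_fset_inject)
  have mem: "(e, n) \<in> ?gr z \<longleftrightarrow> n = Poly_Mapping.lookup z e \<and> n \<noteq> 0" for e n z
    by (auto simp: in_keys_iff)
  show "x = y"
  proof (rule poly_mapping_eqI)
    fix e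
    show "Poly_Mapping.lookup x e = Poly_Mapping.lookup y e"
      using mem[of e _ x] mem[of e _ y] gr by metis
  qed
qed

text \<open>Transport of structure along an injection.\<close>

definition transport_sl :: "('a \<Rightarrow> 'b) \<Rightarrow> ('g, 'a) gsl \<Rightarrow> ('g, 'b) gsl" where
  "transport_sl h E =
     \<lparr>carrier = h ` carrier E,
      meet = (\<lambda>x y. h (meet E (inv_into UNIV h x) (inv_into UNIV h y))),
      bot = h (bot E),
      act = (\<lambda>g x. h (act E g (inv_into UNIV h x)))\<rparr>"

definition transport_covers :: "('a \<Rightarrow> 'b) \<Rightarrow> ('a \<Rightarrow> 'a set set) \<Rightarrow> ('b \<Rightarrow> 'b set set)" where
  "transport_covers h \<RR> x = (\<lambda>R. h ` R) ` \<RR> (inv_into UNIV h x)"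

primrec iter_pair :: "('g, 'a) gsl \<Rightarrow> ('a \<Rightarrow> 'a set set) \<Rightarrow> nat \<Rightarrow>
    ('g, 'a iter) gsl \<times> ('a iter \<Rightarrow> 'a iter set set)" where
  "iter_pair E \<RR> 0 = (transport_sl Base E, transport_covers Base \<RR>)"
| "iter_pair E \<RR> (Suc k) =
     (let (F, \<SS>) = iter_pair E \<RR> k
      in (transport_sl comb (next_sl F \<SS>), transport_covers comb (next_covers F \<SS>)))"

definition iter_sl :: "('g, 'a) gsl \<Rightarrow> ('a \<Rightarrow> 'a set set) \<Rightarrow> nat \<Rightarrow> ('g, 'a iter) gsl" where
  "iter_sl E \<RR> k = fst (iter_pair E \<RR> k)"

text \<open>The homomorphism \<open>\<int>[E\<^sub>k\<^sub>+\<^sub>1\<^sup>\<times>] \<rightarrow> \<int>[E\<^sub>k\<^sup>\<times>]\<close> extending the inclusion of \<open>E\<^sub>k\<^sub>+\<^sub>1\<close>, for every \<open>k\<close>.\<close>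

definition iter_diff :: "('a iter \<Rightarrow>\<^sub>0 int) \<Rightarrow> ('a iter \<Rightarrow>\<^sub>0 int)" where
  "iter_diff = frag_extend (inv_into UNIV comb)"


section \<open>The quotient \<open>\<int>[E\<^sup>\<times>]/I\<close>\<close>

text \<open>\<^const>\<open>ideal\<close> and \<^const>\<open>genideal\<close> presuppose a unital ring, hence the following.\<close>

definition alg_ideal :: "'a set \<Rightarrow> ('a, 'm) ring_scheme \<Rightarrow> bool" where
  "alg_ideal I A \<longleftrightarrow> additive_subgroup I A \<and>
     (\<forall>a\<in>carrier A. \<forall>x\<in>I. a \<otimes>\<^bsub>A\<^esub> x \<in> I \<and> x \<otimes>\<^bsub>A\<^esub> a \<in> I)"

definition gen_alg_ideal :: "('a, 'm) ring_scheme \<Rightarrow> 'a set \<Rightarrow> 'a set" where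
  "gen_alg_ideal A X = \<Inter>{I. alg_ideal I A \<and> X \<subseteq> I}"

definition cover_ideal :: "('g, 'a) gsl \<Rightarrow> ('a \<Rightarrow> 'a set set) \<Rightarrow> ('a \<Rightarrow>\<^sub>0 int) set" where
  "cover_ideal E \<RR> =
     gen_alg_ideal (free_alg E) {cover_diff E e R | e R. e \<in> nonzero E \<and> R \<in> \<RR> e}"

definition cover_quot :: "('g, 'a) gsl \<Rightarrow> ('a \<Rightarrow> 'a set set) \<Rightarrow> ('a \<Rightarrow>\<^sub>0 int) set ring" where
  "cover_quot E \<RR> = free_alg E Quot cover_ideal E \<RR>"

definition cover_quot_act :: "('g, 'a) gsl \<Rightarrow> 'g \<Rightarrow> ('a \<Rightarrow>\<^sub>0 int) set \<Rightarrow> ('a \<Rightarrow>\<^sub>0 int) set" where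
  "cover_quot_act E g X = free_act E g ` X"

text \<open>The canonical projection, precomposed with the identification of \<open>\<int>[E\<^sub>0\<^sup>\<times>]\<close>, where \<open>E\<^sub>0\<close> is the
  copy of \<open>E\<close> under \<open>Base\<close>, with \<open>\<int>[E\<^sup>\<times>]\<close>.\<close>

definition cover_proj ::
    "('g, 'a) gsl \<Rightarrow> ('a \<Rightarrow> 'a set set) \<Rightarrow> ('a iter \<Rightarrow>\<^sub>0 int) \<Rightarrow> ('a \<Rightarrow>\<^sub>0 int) set" where
  "cover_proj E \<RR> x =
     cover_ideal E \<RR> +>\<^bsub>free_alg E\<^esub> frag_extend (\<lambda>b. frag_of (inv_into UNIV Base b)) x"


section \<open>Algebraic independent resolutions\<close>

locale comm_alg = abelian_group A for A (structure) +
  assumes alg_closed: "\<lbrakk>x \<in> carrier A; y \<in> carrier A\<rbrakk> \<Longrightarrow> x \<otimes> y \<in> carrier A"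
    and alg_assoc: "\<lbrakk>x \<in> carrier A; y \<in> carrier A; z \<in> carrier A\<rbrakk>
          \<Longrightarrow> (x \<otimes> y) \<otimes> z = x \<otimes> (y \<otimes> z)"
    and alg_comm: "\<lbrakk>x \<in> carrier A; y \<in> carrier A\<rbrakk> \<Longrightarrow> x \<otimes> y = y \<otimes> x"
    and alg_distrib: "\<lbrakk>x \<in> carrier A; y \<in> carrier A; z \<in> carrier A\<rbrakk>
          \<Longrightarrow> (x \<oplus> y) \<otimes> z = x \<otimes> z \<oplus> y \<otimes> z"

definition alg_hom :: "('a, 'm) ring_scheme \<Rightarrow> ('b, 'n) ring_scheme \<Rightarrow> ('a \<Rightarrow> 'b) set" where
  "alg_hom A B = {h \<in> carrier A \<rightarrow> carrier B.
     \<forall>x\<in>carrier A. \<forall>y\<in>carrier A.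
       h (x \<oplus>\<^bsub>A\<^esub> y) = h x \<oplus>\<^bsub>B\<^esub> h y \<and> h (x \<otimes>\<^bsub>A\<^esub> y) = h x \<otimes>\<^bsub>B\<^esub> h y}"

definition gamma_alg ::
    "('g, 'k) monoid_scheme \<Rightarrow> ('a, 'm) ring_scheme \<Rightarrow> ('g \<Rightarrow> 'a \<Rightarrow> 'a) \<Rightarrow> bool" where
  "gamma_alg G A \<alpha> \<longleftrightarrow> comm_alg A \<and>
     group_action G (carrier A) (\<lambda>g. restrict (\<alpha> g) (carrier A)) \<and>
     (\<forall>g\<in>carrier G. \<alpha> g \<in> alg_hom A A)"

definition equivariant_hom :: "('g, 'k) monoid_scheme \<Rightarrow>
    ('a, 'm) ring_scheme \<Rightarrow> ('g \<Rightarrow> 'a \<Rightarrow> 'a) \<Rightarrow>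
    ('b, 'n) ring_scheme \<Rightarrow> ('g \<Rightarrow> 'b \<Rightarrow> 'b) \<Rightarrow> ('a \<Rightarrow> 'b) \<Rightarrow> bool" where
  "equivariant_hom G A \<alpha> B \<beta> h \<longleftrightarrow> h \<in> alg_hom A B \<and>
     (\<forall>g\<in>carrier G. \<forall>x\<in>carrier A. h (\<alpha> g x) = \<beta> g (h x))"

text \<open>\<open>p\<close> is the map \<open>\<int>[E\<^sub>0\<^sup>\<times>] \<rightarrow> D\<close> and \<open>d k\<close> the map \<open>\<int>[E\<^sub>k\<^sub>+\<^sub>1\<^sup>\<times>] \<rightarrow> \<int>[E\<^sub>k\<^sup>\<times>]\<close>.\<close>

definition algebraic_independent_resolution :: "('g, 'k) monoid_scheme \<Rightarrow>
    ('d, 'm) ring_scheme \<Rightarrow> ('g \<Rightarrow> 'd \<Rightarrow> 'd) \<Rightarrow> (nat \<Rightarrow> ('g, 'a) gsl) \<Rightarrow>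
    (nat \<Rightarrow> ('a \<Rightarrow>\<^sub>0 int) \<Rightarrow> ('a \<Rightarrow>\<^sub>0 int)) \<Rightarrow> (('a \<Rightarrow>\<^sub>0 int) \<Rightarrow> 'd) \<Rightarrow> bool" where
  "algebraic_independent_resolution G D \<delta> E d p \<longleftrightarrow>
     gamma_alg G D \<delta> \<and>
     (\<forall>k. gamma_semilattice G (E k)) \<and>
     equivariant_hom G (free_alg (E 0)) (free_act (E 0)) D \<delta> p \<and>
     (\<forall>k. equivariant_hom G (free_alg (E (Suc k))) (free_act (E (Suc k)))
             (free_alg (E k)) (free_act (E k)) (d k)) \<and>
     p ` carrier (free_alg (E 0)) = carrier D \<and>
     d 0 ` carrier (free_alg (E 1)) = a_kernel (free_alg (E 0)) D p \<and>
     (\<forall>k. d (Suc k) ` carrier (free_alg (E (Suc (Suc k)))) =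
            a_kernel (free_alg (E (Suc k))) (free_alg (E k)) (d k))"

definition resolution_length :: "(nat \<Rightarrow> ('g, 'a) gsl) \<Rightarrow> enat" where
  "resolution_length E =
     (if \<exists>n. carrier (E (Suc n)) = {bot (E (Suc n))}
      then enat (LEAST n. carrier (E (Suc n)) = {bot (E (Suc n))})
      else \<infinity>)"

text \<open>\<^const>\<open>card\<close> is \<open>0\<close> on infinite sets; \<open>ecard\<close> is \<open>\<infinity>\<close> there.\<close>

definition ecard :: "'a set \<Rightarrow> enat" where
  "ecard A = (if finite A then enat (card A) else \<infinity>)"

definition cover_bound :: "('g, 'a) gsl \<Rightarrow> ('a \<Rightarrow> 'a set set) \<Rightarrow> enat" where
  "cover_bound E \<RR> = (SUP e\<in>nonzero E. ecard (\<RR> e))"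

end

theory Submission
  imports Defs
begin

text \<open>Sending a basis element \<open>e\<close> to the indicator function of \<open>{d. d \<le> e}\<close> embeds
  \<open>\<int>[E\<^sup>\<times>]\<close> into the integer functions on \<open>E\<^sup>\<times>\<close> (Moebius inversion), and \<open>e(\<SS>)\<close> becomes
  the indicator of the \<open>d \<le> e\<close> lying below no element of \<open>\<Union>\<SS>\<close>. All identities between
  products and joins, and with them the conditions for the next pair, are checked at points \<open>d\<close>.

  For exactness, \<open>e(\<SS>) - \<Squnion>\<R>(\<SS>, R)\<close> lies in the kernel and rewrites \<open>e(\<SS>)\<close> as
  \<open>e(\<SS> \<union> {R})\<close> plus terms over smaller elements of the finite subsemilattice generated by
  everything in sight. Given an element of the kernel, all terms over a maximal \<open>e\<close> can thus be brought
  to the same \<open>e(\<SS>)\<close>; evaluation at \<open>e\<close> shows that its coefficient vanishes, and one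
  descends through the finite subsemilattice. Every step of the iteration removes at least one cover
  from each \<open>\<RR>(e)\<close>, which bounds the length.\<close>

section \<open>Evaluating elements of \<open>\<int>[E\<^sup>\<times>]\<close> at characters\<close>

text \<open>Condition (ii) speaks of supports of joins. One level up, terms of the
  inclusion-exclusion sum may cancel, and supports are not easily read off at points, so (ii) is not
  carried through the iteration. It enters once, to yield \<open>indep\<close>: a nonzero product of
  e with maximal members of distinct covers of e lies below no member of a further cover. Maximal
  members always survive in the support, and \<open>indep\<close> can be tested at points.
  Everything rests on two consequences: e(S) has value 1 at e, so it is nonzero and determines e;
  and a maximal member of a cover R separates e(S) from e(S') when R lies in S but not in S', so the
  covers of e(S) are well defined.

  Exactness at all places is reduced to one subgroup, \<open>cover_span\<close>, the integer
  combinations of the next semilattice. It is the image of the induced map by definition, the ideal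
  I at the bottom, and higher up the kernel of the map leaving that algebra. Hence a single kernel
  computation for an arbitrary pair is enough, once its hypotheses pass to the next pair and to
  copies along injections.\<close>

lemma group_actionI:
  assumes "group G"
    and closed: "\<And>g x. \<lbrakk>g \<in> carrier G; x \<in> X\<rbrakk> \<Longrightarrow> a g x \<in> X"
    and one: "\<And>x. x \<in> X \<Longrightarrow> a \<one>\<^bsub>G\<^esub> x = x"
    and mult: "\<And>g h x. \<lbrakk>g \<in> carrier G; h \<in> carrier G; x \<in> X\<rbrakk> \<Longrightarrow> a (g \<otimes>\<^bsub>G\<^esub> h) x = a g (a h x)"
  shows "group_action G X (\<lambda>g. restrict (a g) X)"
proof -
  interpret group G by fact
  have bij: "restrict (a g) X \<in> Bij X" if g: "g \<in> carrier G" for g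
  proof -
    have "bij_betw (restrict (a g) X) X X"
    proof (rule bij_betwI[where g = "restrict (a (inv\<^bsub>G\<^esub> g)) X"])
      show "restrict (a (inv\<^bsub>G\<^esub> g)) X (restrict (a g) X x) = x" if "x \<in> X" for x
        using that g closed mult[of "inv\<^bsub>G\<^esub> g" g x, symmetric] one by simp
      show "restrict (a g) X (restrict (a (inv\<^bsub>G\<^esub> g)) X x) = x" if "x \<in> X" for x
        using that g closed mult[of g "inv\<^bsub>G\<^esub> g" x, symmetric] one by simp
    qed (use g closed in auto)
    then show ?thesis by (simp add: Bij_def)
  qed
  have "restrict (a (g \<otimes>\<^bsub>G\<^esub> h)) X = compose X (restrict (a g) X) (restrict (a h) X)"
    if "g \<in> carrier G" "h \<in> carrier G" for g h
    using that by (auto simp: compose_def mult closed fun_eq_iff)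
  then show ?thesis
    using bij group_BijGroup assms(1)
    by (auto simp: group_action_def group_hom_def group_hom_axioms_def hom_def BijGroup_def)
qed

lemma (in group_action) restrict_action_rules:
  assumes "\<phi> = (\<lambda>g. restrict (a g) E)"
  shows "\<And>g x. \<lbrakk>g \<in> carrier G; x \<in> E\<rbrakk> \<Longrightarrow> a g x \<in> E"
    and "\<And>x. x \<in> E \<Longrightarrow> a \<one> x = x"
    and "\<And>g h x. \<lbrakk>g \<in> carrier G; h \<in> carrier G; x \<in> E\<rbrakk> \<Longrightarrow> a (g \<otimes> h) x = a g (a h x)"
proof -
  have grp: "group G" using group_hom unfolding group_hom_def by blast
  show cl: "a g x \<in> E" if "g \<in> carrier G" "x \<in> E" for g x
    using element_image[OF that refl] that assms by simp
  show "a \<one> x = x" if "x \<in> E" for x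
    using id_eq_one assms that by (metis restrict_apply')
  show "a (g \<otimes> h) x = a g (a h x)" if "g \<in> carrier G" "h \<in> carrier G" "x \<in> E" for g h x
    using composition_rule[OF that(3,1,2)] assms that cl by simp
qed

text \<open>For a semilattice character \<chi> this is the ring homomorphism to the integers that
  extends it (\<open>lin_free_mult\<close>). Evaluation at a point d is the case
  \<open>sl_le E d\<close>.\<close>

definition lin :: "('a \<Rightarrow> bool) \<Rightarrow> ('a \<Rightarrow>\<^sub>0 int) \<Rightarrow> int" where
  "lin \<chi> x = (\<Sum>e\<in>Poly_Mapping.keys x. Poly_Mapping.lookup x e * of_bool (\<chi> e))"

lemma lin_superset:
  "\<lbrakk>finite I; Poly_Mapping.keys x \<subseteq> I\<rbrakk>
    \<Longrightarrow> lin \<chi> x = (\<Sum>e\<in>I. Poly_Mapping.lookup x e * of_bool (\<chi> e))"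
  unfolding lin_def by (rule sum.mono_neutral_left) (auto simp: in_keys_iff)

lemma lin_zero [simp]: "lin \<chi> 0 = 0"
  by (simp add: lin_def)

lemma lin_frag_of [simp]: "lin \<chi> (frag_of e) = of_bool (\<chi> e)"
  by (simp add: lin_def)

lemma lin_cmul: "lin \<chi> (frag_cmul c x) = c * lin \<chi> x"
proof -
  have "lin \<chi> (frag_cmul c x)
      = (\<Sum>e\<in>Poly_Mapping.keys x. Poly_Mapping.lookup (frag_cmul c x) e * of_bool (\<chi> e))"
    by (rule lin_superset) (auto simp: keys_cmul)
  also have "\<dots> = (\<Sum>e\<in>Poly_Mapping.keys x. c * (Poly_Mapping.lookup x e * of_bool (\<chi> e)))"
    by (simp only: lookup_frag_cmul mult.assoc)
  finally show ?thesis by (simp only: lin_def sum_distrib_left)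
qed

lemma lin_add: "lin \<chi> (x + y) = lin \<chi> x + lin \<chi> y"
proof -
  let ?I = "Poly_Mapping.keys x \<union> Poly_Mapping.keys y"
  have "Poly_Mapping.keys (x + y) \<subseteq> ?I" by (rule keys_add)
  then show ?thesis
    by (simp add: lin_superset[of ?I] lookup_add algebra_simps sum.distrib)
qed

lemma lin_diff: "lin \<chi> (x - y) = lin \<chi> x - lin \<chi> y"
  using lin_add[of \<chi> "x - y" y] by simp

lemma lin_sum: "lin \<chi> (sum f I) = (\<Sum>i\<in>I. lin \<chi> (f i))"
  by (induction I rule: infinite_finite_induct) (simp_all add: lin_add)

lemma lin_cong: "(\<And>e. e \<in> Poly_Mapping.keys x \<Longrightarrow> \<chi> e = \<psi> e) \<Longrightarrow> lin \<chi> x = lin \<psi> x"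
  by (simp add: lin_def)

lemma lin_nonzeroD: "lin \<chi> x \<noteq> 0 \<Longrightarrow> \<exists>e\<in>Poly_Mapping.keys x. \<chi> e"
  unfolding lin_def by (rule ccontr) (auto intro: sum.neutral)

section \<open>Bilinearity and supports of products\<close>

lemma frag_extend_plus_fun:
  "frag_extend (\<lambda>e. b e + c e) x = frag_extend b x + frag_extend c x"
  by (simp add: frag_extend_def frag_cmul_distrib2 sum.distrib)

lemma frag_extend_zero_fun [simp]: "frag_extend (\<lambda>e. 0) x = 0"
  by (simp add: frag_extend_def)

lemma free_mult_zero [simp]: "free_mult E 0 y = 0" "free_mult E x 0 = 0"
  by (simp_all add: free_mult_def)

lemma free_mult_add_left: "free_mult E (x + x') y = free_mult E x y + free_mult E x' y"
  by (simp add: free_mult_def frag_extend_add)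

lemma free_mult_add_right: "free_mult E x (y + y') = free_mult E x y + free_mult E x y'"
  by (simp add: free_mult_def frag_extend_add frag_extend_plus_fun)

lemma free_mult_diff_left: "free_mult E (x - x') y = free_mult E x y - free_mult E x' y"
  by (simp add: free_mult_def frag_extend_diff)

lemma free_mult_diff_right: "free_mult E x (y - y') = free_mult E x y - free_mult E x y'"
  using free_mult_add_right[of E x "y - y'" y'] by simp

lemma free_mult_of:
  "free_mult E (frag_of e) (frag_of f) = (if meet E e f = bot E then 0 else frag_of (meet E e f))"
  by (simp add: free_mult_def)

text \<open>Reduces bilinear identities to basis elements. The steps are differences rather than
  sums because zero and the basis elements generate all integer combinations under subtraction
  alone, as in \<open>frag_induction\<close>.\<close>

lemma bilinear_induct [consumes 2, case_names zero_left zero_right basis diff_left diff_right]: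
  assumes "Poly_Mapping.keys x \<subseteq> S" "Poly_Mapping.keys y \<subseteq> T"
    and z1: "\<And>y. P 0 y" and z2: "\<And>x. P x 0"
    and b: "\<And>e f. \<lbrakk>e \<in> S; f \<in> T\<rbrakk> \<Longrightarrow> P (frag_of e) (frag_of f)"
    and d1: "\<And>x x' y. \<lbrakk>P x y; P x' y\<rbrakk> \<Longrightarrow> P (x - x') y"
    and d2: "\<And>x y y'. \<lbrakk>P x y; P x y'\<rbrakk> \<Longrightarrow> P x (y - y')"
  shows "P x y"
  using assms(1)
proof (induction x rule: frag_induction)
  case (one e)
  show ?case using assms(2)
    by (induction y rule: frag_induction) (use one z2 b d2 in auto)
qed (use z1 d1 in auto)

lemma keys_diff_subset: "Poly_Mapping.keys (a - b) \<subseteq> Poly_Mapping.keys a \<union> Poly_Mapping.keys b"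
  for a b :: "'a \<Rightarrow>\<^sub>0 int"
  by (auto simp: in_keys_iff lookup_minus)

lemma keys_sub_diff:
  fixes a b :: "'a \<Rightarrow>\<^sub>0 int"
  assumes "Poly_Mapping.keys a \<subseteq> S" "Poly_Mapping.keys b \<subseteq> S"
  shows "Poly_Mapping.keys (a - b) \<subseteq> S" "Poly_Mapping.keys (a + b) \<subseteq> S"
  using keys_diff_subset[of a b] keys_add[of a b] assms by auto

lemma keys_frag_extend_sub:
  assumes "\<And>e. e \<in> Poly_Mapping.keys x \<Longrightarrow> Poly_Mapping.keys (b e) \<subseteq> S"
  shows "Poly_Mapping.keys (frag_extend b x) \<subseteq> S"
  using keys_frag_extend[of b x] assms by blast

lemma keys_free_mult:
  assumes "Poly_Mapping.keys x \<subseteq> S" "Poly_Mapping.keys y \<subseteq> T"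
    and "\<And>e f. \<lbrakk>e \<in> S; f \<in> T; meet E e f \<noteq> bot E\<rbrakk> \<Longrightarrow> meet E e f \<in> U"
  shows "Poly_Mapping.keys (free_mult E x y) \<subseteq> U"
  unfolding free_mult_def using assms by (intro keys_frag_extend_sub) auto

text \<open>On the carrier these are the filters without zero, the empty one included. Two families
  occur: \<open>sl_le E d\<close> on E, and \<open>pt E d\<close> on the next semilattice.\<close>

definition is_char :: "('g, 'a) gsl \<Rightarrow> ('a \<Rightarrow> bool) \<Rightarrow> bool" where
  "is_char E \<chi> \<longleftrightarrow>
     (\<forall>e\<in>carrier E. \<forall>f\<in>carrier E. \<chi> (meet E e f) = (\<chi> e \<and> \<chi> f)) \<and> \<not> \<chi> (bot E)"

text \<open>The only delicate case is a pair of basis elements with product zero: there \<chi>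
  cannot hold at both, since it fails at \<open>bot E\<close>, so both sides vanish.\<close>

lemma lin_free_mult:
  assumes "is_char E \<chi>" "Poly_Mapping.keys x \<subseteq> nonzero E" "Poly_Mapping.keys y \<subseteq> nonzero E"
  shows "lin \<chi> (free_mult E x y) = lin \<chi> x * lin \<chi> y"
  using assms(2,3)
proof (induction x y rule: bilinear_induct)
  case (basis e f)
  have ef: "\<chi> (meet E e f) = (\<chi> e \<and> \<chi> f)" "\<not> \<chi> (bot E)"
    using basis assms(1) by (auto simp: is_char_def nonzero_def)
  show ?case
  proof (cases "meet E e f = bot E")
    case True
    then have "\<not> (\<chi> e \<and> \<chi> f)" using ef by metis
    then show ?thesis using True by (auto simp: free_mult_of)
  qed (use ef in \<open>auto simp: free_mult_of\<close>)
qed (simp_all add: free_mult_diff_left free_mult_diff_right lin_diff algebra_simps)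

text \<open>Inclusion-exclusion: expanding the product of the factors 1 - \<chi> f over R gives the
  signed sum over all subsets. Removing the empty subset, which contributes 1, and reversing the
  sign leaves 1 minus the indicator that \<chi> fails on all of R.\<close>

lemma alternating_sum_subsets:
  assumes "finite R"
  shows "(\<Sum>J | J \<subseteq> R \<and> J \<noteq> {}. (-1) ^ (card J - 1) * of_bool (\<forall>f\<in>J. \<chi> f))
    = (of_bool (\<exists>f\<in>R. \<chi> f) :: int)"
proof -
  let ?g = "\<lambda>J. (-1) ^ card J * of_bool (\<forall>f\<in>J. \<chi> f) :: int"
  have ind: "(\<Sum>J\<in>Pow R. ?g J) = (\<Prod>f\<in>R. 1 - of_bool (\<chi> f))"
    using assms
  proof (induction R rule: finite_induct)
    case (insert a R)
    have "(\<Sum>J\<in>Pow (insert a R). ?g J) = (\<Sum>J\<in>Pow R. ?g J) + (\<Sum>J\<in>insert a ` Pow R. ?g J)"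
      unfolding Pow_insert using insert by (intro sum.union_disjoint) auto
    also have "(\<Sum>J\<in>insert a ` Pow R. ?g J) = (\<Sum>J\<in>Pow R. ?g (insert a J))"
      using insert by (subst sum.reindex) (auto simp: inj_on_def)
    also have "\<dots> = (\<Sum>J\<in>Pow R. - of_bool (\<chi> a) * ?g J)"
    proof (rule sum.cong[OF refl])
      fix J assume J: "J \<in> Pow R"
      then have "finite J" "a \<notin> J" using insert finite_subset by auto
      then show "?g (insert a J) = - of_bool (\<chi> a) * ?g J" by simp
    qed
    also have "\<dots> = - of_bool (\<chi> a) * (\<Sum>J\<in>Pow R. ?g J)"
      by (rule sum_distrib_left[symmetric])
    finally show ?case using insert by (simp add: algebra_simps)
  qed simp
  have neg: "(-1) ^ (card J - 1) * of_bool (\<forall>f\<in>J. \<chi> f) = - ?g J" if "J \<subseteq> R" "J \<noteq> {}" for J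
  proof -
    have "card J > 0" using that assms finite_subset card_gt_0_iff by blast
    then show ?thesis by (cases "card J") auto
  qed
  have "(\<Sum>J | J \<subseteq> R \<and> J \<noteq> {}. (-1) ^ (card J - 1) * of_bool (\<forall>f\<in>J. \<chi> f))
      = (\<Sum>J\<in>Pow R - {{}}. - ?g J)"
    by (rule sum.cong) (blast, rule neg, blast+)
  also have "\<dots> = - ((\<Sum>J\<in>Pow R. ?g J) - 1)"
    using sum_diff1[of "Pow R" ?g "{}"] assms by (simp only: sum_negf) simp
  also have "\<dots> = 1 - (\<Prod>f\<in>R. 1 - of_bool (\<chi> f))"
    unfolding ind by simp
  also have "(\<Prod>f\<in>R. 1 - of_bool (\<chi> f)) = (of_bool (\<not> (\<exists>f\<in>R. \<chi> f)) :: int)"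
    using assms by (induction R rule: finite_induct) auto
  finally show ?thesis by simp
qed

section \<open>Action, order and points of a semilattice\<close>

context gamma_semilattice
begin

lemma act_closed: "\<lbrakk>g \<in> carrier G; e \<in> carrier E\<rbrakk> \<Longrightarrow> act E g e \<in> carrier E"
  and act_one: "e \<in> carrier E \<Longrightarrow> act E \<one>\<^bsub>G\<^esub> e = e"
  and act_mult: "\<lbrakk>g \<in> carrier G; h \<in> carrier G; e \<in> carrier E\<rbrakk>
        \<Longrightarrow> act E (g \<otimes>\<^bsub>G\<^esub> h) e = act E g (act E h e)"
  using group_action.restrict_action_rules[OF action refl] by auto

lemma act_inv:
  assumes "g \<in> carrier G" "e \<in> carrier E"
  shows "act E (inv\<^bsub>G\<^esub> g) (act E g e) = e" "act E g (act E (inv\<^bsub>G\<^esub> g) e) = e"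
proof -
  interpret G: group G by (rule group_G)
  show "act E (inv\<^bsub>G\<^esub> g) (act E g e) = e" "act E g (act E (inv\<^bsub>G\<^esub> g) e) = e"
    using assms act_mult[of "inv\<^bsub>G\<^esub> g" g e] act_mult[of g "inv\<^bsub>G\<^esub> g" e] act_one by auto
qed

lemma act_inj: "\<lbrakk>g \<in> carrier G; e \<in> carrier E; f \<in> carrier E; act E g e = act E g f\<rbrakk> \<Longrightarrow> e = f"
  using act_inv(1) by metis

text \<open>Zero absorbs its own preimage under g. Applying g to this product shows that the image
  of zero, multiplied by zero, is unchanged.\<close>

lemma act_bot: "g \<in> carrier G \<Longrightarrow> act E g (bot E) = bot E"
proof -
  assume g: "g \<in> carrier G"
  interpret G: group G by (rule group_G)
  let ?b = "act E (inv\<^bsub>G\<^esub> g) (bot E)"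
  have b: "?b \<in> carrier E" using g act_closed bot_closed by auto
  have "act E g (bot E) = act E g (meet E (bot E) ?b)" using b bot_meet by simp
  also have "\<dots> = meet E (act E g (bot E)) (bot E)"
    using g b bot_closed act_meet act_inv by simp
  also have "\<dots> = bot E" using g bot_closed act_closed bot_meet meet_comm by metis
  finally show ?thesis .
qed

lemma nonzero_closed: "e \<in> nonzero E \<Longrightarrow> e \<in> carrier E"
  by (simp add: nonzero_def)

lemma act_nonzero: "\<lbrakk>g \<in> carrier G; e \<in> nonzero E\<rbrakk> \<Longrightarrow> act E g e \<in> nonzero E"
  using act_closed act_inj[of g e "bot E"] act_bot bot_closed by (auto simp: nonzero_def)

lemma meet_nonzero_iff: "\<lbrakk>e \<in> carrier E; f \<in> carrier E\<rbrakk> \<Longrightarrow> meet E e f \<in> nonzero E \<longleftrightarrow> meet E e f \<noteq> bot E"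
  by (simp add: nonzero_def meet_closed)

lemma le_refl: "e \<in> carrier E \<Longrightarrow> sl_le E e e"
  by (simp add: sl_le_def meet_idem)

lemma le_trans: "\<lbrakk>d \<in> carrier E; e \<in> carrier E; f \<in> carrier E; sl_le E d e; sl_le E e f\<rbrakk> \<Longrightarrow> sl_le E d f"
  unfolding sl_le_def using meet_assoc by metis

lemma le_antisym: "\<lbrakk>d \<in> carrier E; e \<in> carrier E; sl_le E d e; sl_le E e d\<rbrakk> \<Longrightarrow> d = e"
  unfolding sl_le_def using meet_comm by metis

lemma le_meet_iff:
  assumes "d \<in> carrier E" "e \<in> carrier E" "f \<in> carrier E"
  shows "sl_le E d (meet E e f) \<longleftrightarrow> sl_le E d e \<and> sl_le E d f"
proof
  assume d: "sl_le E d (meet E e f)"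
  have "meet E d e = meet E (meet E d (meet E e f)) e" using d by (simp add: sl_le_def)
  also have "\<dots> = meet E d (meet E (meet E e e) f)"
    using assms by (simp add: meet_assoc meet_closed meet_comm[of f e])
  finally have 1: "meet E d e = d" using assms d by (simp add: meet_idem sl_le_def)
  have "meet E d f = meet E (meet E d (meet E e f)) f" using d by (simp add: sl_le_def)
  also have "\<dots> = meet E d (meet E e f)"
    using assms by (simp add: meet_assoc meet_closed meet_idem)
  finally show "sl_le E d e \<and> sl_le E d f" using 1 d by (simp add: sl_le_def)
next
  assume "sl_le E d e \<and> sl_le E d f"
  then show "sl_le E d (meet E e f)"
    using assms by (simp add: sl_le_def meet_assoc[symmetric])
qed

lemma meet_le: assumes "e \<in> carrier E" "f \<in> carrier E"
  shows "sl_le E (meet E e f) e" "sl_le E (meet E e f) f"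
  using le_meet_iff[of "meet E e f" e f] le_refl[of "meet E e f"] assms meet_closed by auto

lemma meet_bot: "e \<in> carrier E \<Longrightarrow> meet E e (bot E) = bot E"
  using bot_meet meet_comm bot_closed by metis

lemma nonzero_le: "\<lbrakk>d \<in> nonzero E; e \<in> carrier E; sl_le E d e\<rbrakk> \<Longrightarrow> e \<in> nonzero E"
  using meet_bot by (auto simp: nonzero_def sl_le_def)

lemma is_char_le: "d \<in> nonzero E \<Longrightarrow> is_char E (sl_le E d)"
  using le_meet_iff meet_bot by (auto simp: is_char_def nonzero_def sl_le_def)

lemma act_le_iff:
  assumes "g \<in> carrier G" "d \<in> carrier E" "e \<in> carrier E"
  shows "sl_le E (act E g d) (act E g e) \<longleftrightarrow> sl_le E d e"
  using assms act_inj[OF assms(1) meet_closed[OF assms(2,3)] assms(2)]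
  by (auto simp: sl_le_def act_meet[symmetric])

lemma act_meet_nonzero_iff:
  assumes "g \<in> carrier G" "d \<in> carrier E" "e \<in> carrier E"
  shows "meet E (act E g d) (act E g e) = bot E \<longleftrightarrow> meet E d e = bot E"
  using assms act_meet act_inj meet_closed act_bot bot_closed by metis

lemma finite_has_maximal:
  assumes "finite K" "K \<noteq> {}" "K \<subseteq> carrier E"
  shows "\<exists>m\<in>K. \<forall>k\<in>K. sl_le E m k \<longrightarrow> k = m"
  using assms
proof (induction K rule: finite_ne_induct)
  case (insert x K)
  then obtain m where m: "m \<in> K" "\<And>k. k \<in> K \<Longrightarrow> sl_le E m k \<Longrightarrow> k = m" by auto
  show ?case
  proof (cases "sl_le E m x")
    case True
    have "k = x" if "k \<in> insert x K" "sl_le E x k" for k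
    proof -
      have "sl_le E m k" using True that insert.prems m le_trans[of m x k] by auto
      then show ?thesis using that m True insert.prems le_antisym[of m x] by auto
    qed
    then show ?thesis by auto
  next
    case False
    then show ?thesis using m by auto
  qed
qed simp

lemma finite_maximal_above:
  assumes "finite K" "K \<subseteq> carrier E" "f \<in> K"
  shows "\<exists>m\<in>K. sl_le E f m \<and> (\<forall>k\<in>K. sl_le E m k \<longrightarrow> k = m)"
proof -
  let ?K = "{k\<in>K. sl_le E f k}"
  obtain m where m: "m \<in> ?K" "\<And>k. k \<in> ?K \<Longrightarrow> sl_le E m k \<Longrightarrow> k = m"
    using finite_has_maximal[of ?K] assms le_refl[of f] by auto
  then have "k = m" if "k \<in> K" "sl_le E m k" for k
    using that assms le_trans[of f m k] by auto
  then show ?thesis using m by auto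
qed

text \<open>At a maximal element m of the support only m itself contributes, so the value there is
  the nonzero coefficient of m.\<close>

lemma lin_le_eq_zeroD:
  assumes "Poly_Mapping.keys x \<subseteq> nonzero E" "\<And>d. d \<in> nonzero E \<Longrightarrow> lin (sl_le E d) x = 0"
  shows "x = 0"
proof (rule ccontr)
  assume "x \<noteq> 0"
  then obtain m where m: "m \<in> Poly_Mapping.keys x"
    "\<And>k. k \<in> Poly_Mapping.keys x \<Longrightarrow> sl_le E m k \<Longrightarrow> k = m"
    using finite_has_maximal[of "Poly_Mapping.keys x"] assms(1) by (auto simp: nonzero_def)
  then have "lin (sl_le E m) x = lin (\<lambda>k. k = m) x"
    using assms(1) nonzero_closed le_refl by (intro lin_cong) blast
  also have "\<dots> = Poly_Mapping.lookup x m"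
    using m(1) lin_superset[of "{m}"] sum.mono_neutral_right[of "Poly_Mapping.keys x" "{m}"]
    unfolding lin_def by (subst sum.mono_neutral_right[of _ "{m}"]) auto
  finally show False using assms m(1) by (auto simp: in_keys_iff)
qed

lemma free_alg_eqI:
  assumes "Poly_Mapping.keys x \<subseteq> nonzero E" "Poly_Mapping.keys y \<subseteq> nonzero E"
    and "\<And>d. d \<in> nonzero E \<Longrightarrow> lin (sl_le E d) x = lin (sl_le E d) y"
  shows "x = y"
  using lin_le_eq_zeroD[of "x - y"] assms by (simp add: keys_sub_diff lin_diff)

lemma free_mult_closed:
  "\<lbrakk>Poly_Mapping.keys x \<subseteq> nonzero E; Poly_Mapping.keys y \<subseteq> nonzero E\<rbrakk>
    \<Longrightarrow> Poly_Mapping.keys (free_mult E x y) \<subseteq> nonzero E"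
  by (rule keys_free_mult) (auto simp: nonzero_def meet_closed)

text \<open>Evaluation at points turns this law, and associativity below, into the laws of integer
  multiplication.\<close>

lemma free_mult_comm:
  "\<lbrakk>Poly_Mapping.keys x \<subseteq> nonzero E; Poly_Mapping.keys y \<subseteq> nonzero E\<rbrakk>
    \<Longrightarrow> free_mult E x y = free_mult E y x"
  by (rule free_alg_eqI) (auto simp: free_mult_closed lin_free_mult is_char_le)

lemma free_mult_assoc:
  "\<lbrakk>Poly_Mapping.keys x \<subseteq> nonzero E; Poly_Mapping.keys y \<subseteq> nonzero E; Poly_Mapping.keys z \<subseteq> nonzero E\<rbrakk>
    \<Longrightarrow> free_mult E (free_mult E x y) z = free_mult E x (free_mult E y z)"
  by (rule free_alg_eqI) (auto simp: free_mult_closed lin_free_mult is_char_le)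

lemma set_prod_free_mult_insert:
  assumes "finite J" "J \<noteq> {}" "j \<notin> J"
    and "\<And>i. i \<in> insert j J \<Longrightarrow> Poly_Mapping.keys (f i) \<subseteq> nonzero E"
  shows "set_prod (free_mult E) f (insert j J) = free_mult E (f j) (set_prod (free_mult E) f J)"
  using assms
  by (intro set_prod_insert[where C = "{x. Poly_Mapping.keys x \<subseteq> nonzero E}"])
    (auto simp: free_mult_closed free_mult_assoc intro: free_mult_comm)

lemma set_prod_closed:
  assumes "finite J" "J \<noteq> {}" "\<And>i. i \<in> J \<Longrightarrow> Poly_Mapping.keys (f i) \<subseteq> S" "S \<subseteq> nonzero E"
    and "\<And>e f. \<lbrakk>e \<in> S; f \<in> S; meet E e f \<noteq> bot E\<rbrakk> \<Longrightarrow> meet E e f \<in> S"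
  shows "Poly_Mapping.keys (set_prod (free_mult E) f J) \<subseteq> S"
  using assms(1-3)
proof (induction J rule: finite_ne_induct)
  case (singleton j)
  then show ?case by (simp add: set_prod_singleton)
next
  case (insert j J)
  have "Poly_Mapping.keys (free_mult E (f j) (set_prod (free_mult E) f J)) \<subseteq> S"
    using insert assms(5) by (intro keys_free_mult[of _ S _ S]) auto
  moreover have "Poly_Mapping.keys (f i) \<subseteq> nonzero E" if "i \<in> insert j J" for i
    using insert.prems[OF that] assms(4) by blast
  ultimately show ?case using insert by (subst set_prod_free_mult_insert) auto
qed

lemma lin_set_prod:
  assumes "is_char E \<chi>" "finite J" "J \<noteq> {}" "\<And>i. i \<in> J \<Longrightarrow> Poly_Mapping.keys (f i) \<subseteq> nonzero E"
  shows "lin \<chi> (set_prod (free_mult E) f J) = (\<Prod>i\<in>J. lin \<chi> (f i))"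
  using assms(2-4)
proof (induction J rule: finite_ne_induct)
  case (singleton j)
  then show ?case by (simp add: set_prod_singleton)
next
  case (insert j J)
  have "Poly_Mapping.keys (set_prod (free_mult E) f J) \<subseteq> nonzero E"
    using insert meet_closed by (intro set_prod_closed) (auto simp: nonzero_def)
  then show ?case
    using insert assms(1) by (subst set_prod_free_mult_insert) (auto simp: lin_free_mult)
qed

text \<open>S is left general because three closed sets are used: all nonzero elements, the nonzero
  elements below a member of R, and the normal forms \<open>NF F U\<close> of the kernel
  argument.\<close>

lemma keys_join_subset:
  assumes "finite R" "R \<subseteq> S" "S \<subseteq> nonzero E"
    and "\<And>e f. \<lbrakk>e \<in> S; f \<in> S; meet E e f \<noteq> bot E\<rbrakk> \<Longrightarrow> meet E e f \<in> S"
  shows "Poly_Mapping.keys (join E R) \<subseteq> S"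
proof -
  have "Poly_Mapping.keys (set_prod (free_mult E) frag_of J) \<subseteq> S" if "J \<subseteq> R" "J \<noteq> {}" for J
    using that assms finite_subset[OF that(1)] by (intro set_prod_closed) auto
  then have "Poly_Mapping.keys (frag_cmul c (set_prod (free_mult E) frag_of J)) \<subseteq> S"
    if "J \<subseteq> R" "J \<noteq> {}" for J c
    using that keys_cmul by blast
  then show ?thesis
    unfolding join_def by (intro order_trans[OF keys_sum]) auto
qed

lemma keys_join: "\<lbrakk>finite R; R \<subseteq> nonzero E\<rbrakk> \<Longrightarrow> Poly_Mapping.keys (join E R) \<subseteq> nonzero E"
  by (rule keys_join_subset) (auto simp: nonzero_def meet_closed)

lemma keys_join_le:
  assumes "finite R" "R \<subseteq> nonzero E" "e \<in> Poly_Mapping.keys (join E R)"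
  shows "\<exists>f\<in>R. sl_le E e f"
proof -
  let ?S = "{e \<in> nonzero E. \<exists>f\<in>R. sl_le E e f}"
  have "meet E d e \<in> ?S" if "d \<in> ?S" "e \<in> ?S" "meet E d e \<noteq> bot E" for d e
  proof -
    have c: "d \<in> carrier E" "e \<in> carrier E" using that nonzero_closed by auto
    from that obtain f where f: "f \<in> R" "sl_le E d f" by auto
    have "sl_le E (meet E d e) f"
      using le_trans[of "meet E d e" d f] c f meet_le(1)[of d e] meet_closed assms(2) nonzero_closed by auto
    then show ?thesis using c f(1) that(3) meet_nonzero_iff by blast
  qed
  then have "Poly_Mapping.keys (join E R) \<subseteq> ?S"
    using assms(1,2) le_refl nonzero_closed by (intro keys_join_subset) blast+
  then show ?thesis using assms by blast
qed

lemma lin_join: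
  assumes "is_char E \<chi>" "finite R" "R \<subseteq> nonzero E"
  shows "lin \<chi> (join E R) = of_bool (\<exists>f\<in>R. \<chi> f)"
proof -
  have "lin \<chi> (join E R) = (\<Sum>J | J \<subseteq> R \<and> J \<noteq> {}. (-1) ^ (card J - 1) * of_bool (\<forall>f\<in>J. \<chi> f))"
    unfolding join_def lin_sum
  proof (intro sum.cong refl)
    fix J assume "J \<in> {J. J \<subseteq> R \<and> J \<noteq> {}}"
    then have J: "J \<subseteq> R" "J \<noteq> {}" "finite J" using assms finite_subset by auto
    have "lin \<chi> (set_prod (free_mult E) frag_of J) = (\<Prod>f\<in>J. of_bool (\<chi> f))"
      using J assms by (subst lin_set_prod) auto
    also have "\<dots> = of_bool (\<forall>f\<in>J. \<chi> f)"
      using J(3) by (induction J rule: finite_induct) auto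
    finally show "lin \<chi> (frag_cmul ((-1) ^ (card J - 1)) (set_prod (free_mult E) frag_of J))
        = (-1) ^ (card J - 1) * of_bool (\<forall>f\<in>J. \<chi> f)"
      by (simp add: lin_cmul)
  qed
  then show ?thesis using alternating_sum_subsets[OF assms(2)] by simp
qed

end

section \<open>Independence in terms of maximal elements\<close>

text \<open>Both products run along the same chosen enumeration, which depends on J alone.\<close>

lemma set_prod_cong:
  assumes "finite J" "J \<noteq> {}" "\<And>i. i \<in> J \<Longrightarrow> f i = g i"
  shows "set_prod m f J = set_prod m g J"
proof -
  define xs where "xs = (SOME xs. set xs = J \<and> distinct xs)"
  have xs: "set xs = J"
    using someI_ex[OF finite_distinct_list[OF assms(1)]] unfolding xs_def by blast
  then have ne: "xs \<noteq> []" using assms(2) by auto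
  have "map f (butlast xs) = map g (butlast xs)"
    using xs assms(3) in_set_butlastD by fastforce
  moreover have "f (last xs) = g (last xs)"
    using xs assms(3) last_in_set[OF ne] by auto
  ultimately show ?thesis
    by (simp add: set_prod_def list_prod_def del: map_eq_conv flip: xs_def)
qed

definition max_elts :: "('g, 'a) gsl \<Rightarrow> 'a set \<Rightarrow> 'a set" where
  "max_elts E R = {f \<in> R. \<forall>k\<in>R. sl_le E f k \<longrightarrow> k = f}"

text \<open>The set S records which covers have contributed a factor, so that a further cover can be
  required to be new. Starting from e matches the convention of (ii) that the empty product is e.
  All partial products are nonzero.\<close>

inductive cprod :: "('g, 'a) gsl \<Rightarrow> ('a \<Rightarrow> 'a set set) \<Rightarrow> 'a \<Rightarrow> 'a set set \<Rightarrow> 'a \<Rightarrow> bool"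
  for E \<RR> e where
  base: "cprod E \<RR> e {} e"
| step: "\<lbrakk>cprod E \<RR> e S d; R \<in> \<RR> e; R \<notin> S; f \<in> max_elts E R; meet E d f \<noteq> bot E\<rbrakk>
    \<Longrightarrow> cprod E \<RR> e (insert R S) (meet E d f)"

text \<open>A consequence of (ii) that, unlike (ii) itself, does not mention the supports of the joins;
  it is this form of independence that the iteration preserves.\<close>

definition indep :: "('g, 'a) gsl \<Rightarrow> ('a \<Rightarrow> 'a set set) \<Rightarrow> bool" where
  "indep E \<RR> \<longleftrightarrow> (\<forall>e\<in>nonzero E. \<forall>S d R f.
     cprod E \<RR> e S d \<longrightarrow> R \<in> \<RR> e \<longrightarrow> R \<notin> S \<longrightarrow> f \<in> R \<longrightarrow> \<not> sl_le E d f)"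

context gamma_semilattice
begin

text \<open>The join has value 1 at a maximal member f, so some d in its support lies above f. As d
  lies below a member k of R, maximality gives k = f, hence d = f.\<close>

lemma max_elts_subset_keys_join:
  assumes "finite R" "R \<subseteq> nonzero E"
  shows "max_elts E R \<subseteq> Poly_Mapping.keys (join E R)"
proof
  fix f assume f: "f \<in> max_elts E R"
  then have fR: "f \<in> R" "f \<in> nonzero E" using assms by (auto simp: max_elts_def)
  then have "lin (sl_le E f) (join E R) \<noteq> 0"
    using assms is_char_le le_refl[of f] nonzero_closed by (subst lin_join) auto
  then obtain d where d: "d \<in> Poly_Mapping.keys (join E R)" "sl_le E f d"
    using lin_nonzeroD by blast
  obtain k where k: "k \<in> R" "sl_le E d k" using keys_join_le[OF assms d(1)] by blast
  have c: "d \<in> carrier E" "k \<in> carrier E" "f \<in> carrier E"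
    using d(1) keys_join[OF assms] k(1) fR assms nonzero_closed by auto
  have "k = f" using f k le_trans[OF c(3,1,2) d(2)] by (auto simp: max_elts_def)
  then have "d = f" using le_antisym[OF c(1,3)] k d by simp
  then show "f \<in> Poly_Mapping.keys (join E R)" using d by simp
qed

lemma max_elts_above:
  assumes "finite R" "R \<subseteq> nonzero E" "f \<in> R"
  shows "\<exists>m\<in>max_elts E R. sl_le E f m"
proof -
  have "R \<subseteq> carrier E" using assms nonzero_closed by auto
  from finite_maximal_above[OF assms(1) this assms(3)] show ?thesis
    by (auto simp: max_elts_def)
qed

lemma cprod_nonzero:
  assumes "cprod E \<RR> e S d" "e \<in> nonzero E" "\<And>R. R \<in> \<RR> e \<Longrightarrow> R \<subseteq> nonzero E"
  shows "d \<in> nonzero E \<and> sl_le E d e"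
  using assms(1)
proof induction
  case base
  then show ?case using assms nonzero_closed le_refl by auto
next
  case (step S d R f)
  have c: "d \<in> carrier E" "f \<in> carrier E" "e \<in> carrier E"
    using step assms by (auto simp: max_elts_def nonzero_def)
  then show ?case
    using step meet_le(1)[of d f] meet_closed[of d f] le_trans[of "meet E d f" d e]
    by (auto simp: nonzero_def)
qed

lemma meet_set_prod_insert:
  assumes "finite J" "J \<noteq> {}" "j \<notin> J" "\<epsilon> ` insert j J \<subseteq> carrier E"
  shows "set_prod (meet E) \<epsilon> (insert j J) = meet E (\<epsilon> j) (set_prod (meet E) \<epsilon> J)"
  by (rule set_prod_insert[where C = "carrier E"])
    (use assms meet_closed meet_assoc meet_comm in auto)

text \<open>Passes from the inductive form to the indexed families over which (ii)
  quantifies.\<close>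

lemma cprod_as_set_prod:
  assumes "cprod E \<RR> e S d" "cover_collection E \<RR>" "e \<in> nonzero E"
  shows "\<exists>n Q \<epsilon>. inj_on Q {1..n::nat} \<and> Q ` {1..n} = S \<and>
    (\<forall>i\<in>{1..n}. Q i \<in> \<RR> e \<and> \<epsilon> i \<in> max_elts E (Q i)) \<and>
    d = (if n = 0 then e else set_prod (meet E) \<epsilon> {1..n})"
  using assms(1)
proof induction
  case base
  show ?case by (rule exI[of _ 0]) auto
next
  case (step S d R f)
  then obtain n Q \<epsilon> where IH: "inj_on Q {1..n::nat}" "Q ` {1..n} = S"
    "\<forall>i\<in>{1..n}. Q i \<in> \<RR> e \<and> \<epsilon> i \<in> max_elts E (Q i)"
    "d = (if n = 0 then e else set_prod (meet E) \<epsilon> {1..n})"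
    by blast
  let ?Q = "Q(Suc n := R)" and ?\<epsilon> = "\<epsilon>(Suc n := f)"
  have ins: "{1..Suc n} = insert (Suc n) {1..n}" by auto
  have nin: "Suc n \<notin> {1..n}" by auto
  have sub: "R \<subseteq> nonzero E \<and> (\<forall>f\<in>R. sl_le E f e)" if "R \<in> \<RR> e" for R
    using assms(2,3) that by (auto simp: cover_collection_def finite_cover_def)
  have car: "\<epsilon> i \<in> carrier E" if "i \<in> {1..n}" for i
    using IH(3) sub that nonzero_closed unfolding max_elts_def by blast
  have f: "f \<in> carrier E" "sl_le E f e" "e \<in> carrier E"
    using step sub[of R] assms(3) by (auto simp: max_elts_def nonzero_def)
  have eqon: "?Q ` {1..n} = S" "\<And>i. i \<in> {1..n} \<Longrightarrow> ?\<epsilon> i = \<epsilon> i" using IH by auto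
  have inj: "inj_on ?Q {1..Suc n}"
    unfolding ins inj_on_insert using IH(1,2) step.hyps nin by (auto intro!: inj_on_fun_updI)
  have "meet E d f = set_prod (meet E) ?\<epsilon> {1..Suc n}"
  proof (cases "n = 0")
    case True
    \<comment> \<open>The first factor absorbs the initial e because members of a cover of e lie
      below e.\<close>
    then have "meet E d f = f" using IH(4) f meet_comm by (auto simp: sl_le_def)
    then show ?thesis using True by (simp add: set_prod_singleton)
  next
    case False
    have "set_prod (meet E) ?\<epsilon> {1..n} = d"
      using False IH(4) by (simp, intro set_prod_cong) auto
    moreover have "set_prod (meet E) ?\<epsilon> {1..Suc n} = meet E (?\<epsilon> (Suc n)) (set_prod (meet E) ?\<epsilon> {1..n})"
      unfolding ins using False car f by (intro meet_set_prod_insert) auto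
    moreover have "d \<in> carrier E"
      using cprod_nonzero[OF step.hyps(1) assms(3)] sub nonzero_closed by blast
    ultimately show ?thesis using f meet_comm by simp
  qed
  moreover have "\<forall>i\<in>{1..Suc n}. ?Q i \<in> \<RR> e \<and> ?\<epsilon> i \<in> max_elts E (?Q i)"
    using IH(3) step.hyps unfolding ins by auto
  moreover have "?Q ` {1..Suc n} = insert R S"
    unfolding ins image_insert eqon(1) by simp
  ultimately show ?case
    using inj by (intro exI[of _ "Suc n"] exI[of _ ?Q] exI[of _ ?\<epsilon>]) (simp del: fun_upd_apply)
qed

text \<open>If d lies below f, it lies below a maximal member m of R above f, so d m = d. Since m is
  in the support of the join of R, this contradicts the strict inequality in (ii) for the family
  extended by R and m, with the last index removed.\<close>

lemma cond_ii_imp_indep: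
  assumes cc: "cover_collection E \<RR>" and ii: "cond_ii E \<RR>"
  shows "indep E \<RR>"
  unfolding indep_def
proof (intro ballI allI impI notI)
  fix e S d R f
  assume e: "e \<in> nonzero E" and cp: "cprod E \<RR> e S d" and R: "R \<in> \<RR> e" "R \<notin> S"
    and f: "f \<in> R" "sl_le E d f"
  have fin: "finite R" "R \<subseteq> nonzero E" if "R \<in> \<RR> e" for R
    using cc e that by (auto simp: cover_collection_def finite_cover_def)
  have d: "d \<in> nonzero E" "sl_le E d e" using cprod_nonzero[OF cp e] fin by auto
  obtain m where m: "m \<in> max_elts E R" "sl_le E f m"
    using max_elts_above[OF fin[OF R(1)] f(1)] by blast
  have mc: "m \<in> carrier E" "f \<in> carrier E" "d \<in> carrier E"
    using m f fin[OF R(1)] d by (auto simp: max_elts_def nonzero_def)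
  have "meet E d m \<noteq> bot E"
    using le_trans[of d f m] mc m f d by (auto simp: sl_le_def nonzero_def)
  have dm: "meet E d m = d" using le_trans[of d f m] mc m f by (auto simp: sl_le_def)
  obtain n Q \<epsilon> where nQ: "inj_on Q {1..n::nat}" "Q ` {1..n} = S"
    "\<forall>i\<in>{1..n}. Q i \<in> \<RR> e \<and> \<epsilon> i \<in> max_elts E (Q i)"
    "d = (if n = 0 then e else set_prod (meet E) \<epsilon> {1..n})"
    using cprod_as_set_prod[OF cp cc e] by blast
  let ?Q = "Q(Suc n := R)" and ?\<epsilon> = "\<epsilon>(Suc n := m)"
  have ins: "{1..Suc n} = insert (Suc n) {1..n}" by auto
  have del: "{1..Suc n} - {Suc n} = {1..n}" by auto
  have eqon: "?Q ` {1..n} = S" "\<And>i. i \<in> {1..n} \<Longrightarrow> ?\<epsilon> i = \<epsilon> i" using nQ by auto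
  have inj: "inj_on ?Q {1..Suc n}"
    unfolding ins inj_on_insert using nQ(1,2) R(2) by (auto intro!: inj_on_fun_updI)
  have keys: "\<forall>i\<in>{1..Suc n}. ?Q i \<in> \<RR> e \<and> ?\<epsilon> i \<in> Poly_Mapping.keys (join E (?Q i))"
    using nQ(3) R m max_elts_subset_keys_join[OF fin] unfolding ins by auto
  have car: "\<epsilon> i \<in> carrier E" if "i \<in> {1..n}" for i
    using nQ(3) fin that nonzero_closed unfolding max_elts_def by blast
  \<comment> \<open>For n = 0 both sides are e: the convention of (ii) for r = 1 agrees with
    \<open>cprod.base\<close>.\<close>
  have q: "(if Suc n = 1 then e else set_prod (meet E) ?\<epsilon> ({1..Suc n} - {Suc n})) = d"
    unfolding del using nQ(4) by (auto intro: set_prod_cong)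
  have p: "set_prod (meet E) ?\<epsilon> {1..Suc n} = d"
  proof (cases "n = 0")
    case True
    then have "d = e" using nQ by simp
    moreover have "sl_le E m e"
      using m R cc e by (auto simp: cover_collection_def finite_cover_def max_elts_def)
    ultimately have "m = d" using dm mc meet_comm by (auto simp: sl_le_def)
    then show ?thesis using True by (simp add: set_prod_singleton)
  next
    case False
    have "set_prod (meet E) ?\<epsilon> {1..n} = d"
      using False nQ(4) by (simp, intro set_prod_cong) auto
    moreover have "set_prod (meet E) ?\<epsilon> {1..Suc n} = meet E (?\<epsilon> (Suc n)) (set_prod (meet E) ?\<epsilon> {1..n})"
      unfolding ins using False car mc by (intro meet_set_prod_insert) auto
    ultimately show ?thesis using mc meet_comm dm by simp
  qed
  have "1 \<le> Suc n" "Suc n \<in> {1..Suc n}" by auto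
  then have "let p = set_prod (meet E) ?\<epsilon> {1..Suc n};
      q = (if Suc n = 1 then e else set_prod (meet E) ?\<epsilon> ({1..Suc n} - {Suc n}))
      in q \<noteq> bot E \<longrightarrow> sl_less E p q"
    using ii e inj keys unfolding cond_ii_def by blast
  then show False
    unfolding Let_def p q using d by (auto simp: nonzero_def sl_less_def)
qed

end

section \<open>The elements \<open>e(\<SS>)\<close>\<close>

locale covers = gamma_semilattice G E
  for G :: "('g, 'm) monoid_scheme" and E :: "('g, 'a) gsl" +
  fixes \<RR> :: "'a \<Rightarrow> 'a set set"
  assumes cover_coll: "cover_collection E \<RR>"
    and cond_i: "cond_i E \<RR>"
    and indep: "indep E \<RR>"
    and cond_iii: "cond_iii G E \<RR>"

text \<open>Here \<open>S = {}\<close> is admitted, with \<open>el E e {} = e\<close>, so that products with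
  elements of \<open>E\<close> need no separate treatment.\<close>

definition el :: "('g, 'a) gsl \<Rightarrow> 'a \<Rightarrow> 'a set set \<Rightarrow> ('a \<Rightarrow>\<^sub>0 int)" where
  "el E e S = (if S = {} then frag_of e else cover_prod E e S)"

definition adm :: "('g, 'a) gsl \<Rightarrow> ('a \<Rightarrow> 'a set set) \<Rightarrow> 'a \<Rightarrow> 'a set set \<Rightarrow> bool" where
  "adm E \<RR> e S \<longleftrightarrow> e \<in> nonzero E \<and> finite S \<and> S \<subseteq> \<RR> e"

text \<open>The restriction of a cover to d, written (d R) with zero removed in condition
  (i).\<close>

definition restr :: "('g, 'a) gsl \<Rightarrow> 'a \<Rightarrow> 'a set \<Rightarrow> 'a set" where
  "restr E d R = meet E d ` R \<inter> nonzero E"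

text \<open>Elements of the next semilattice take only the values 0 and 1 at points
  (\<open>lin_N\<close>), so for them this says that d belongs to the set of which x is the
  indicator.\<close>

definition pt :: "('g, 'a) gsl \<Rightarrow> 'a \<Rightarrow> ('a \<Rightarrow>\<^sub>0 int) \<Rightarrow> bool" where
  "pt E d x \<longleftrightarrow> lin (sl_le E d) x \<noteq> 0"

lemma pt_zero [simp]: "\<not> pt E d 0"
  by (simp add: pt_def)

context covers
begin

abbreviation "N \<equiv> next_sl E \<RR>"
abbreviation "M \<equiv> next_covers E \<RR>"

lemma coverD:
  assumes "e \<in> nonzero E" "R \<in> \<RR> e"
  shows "finite R" "R \<subseteq> nonzero E" "\<And>f. f \<in> R \<Longrightarrow> sl_le E f e"
    "\<And>f. \<lbrakk>f \<in> nonzero E; sl_le E f e\<rbrakk> \<Longrightarrow> \<exists>k\<in>R. meet E f k \<noteq> bot E"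
  using assms cover_coll by (auto simp: cover_collection_def finite_cover_def)

lemma indepD:
  "\<lbrakk>e \<in> nonzero E; cprod E \<RR> e S d; R \<in> \<RR> e; R \<notin> S; f \<in> R\<rbrakk> \<Longrightarrow> \<not> sl_le E d f"
  using indep unfolding indep_def by blast

lemma not_le_cover: "\<lbrakk>e \<in> nonzero E; R \<in> \<RR> e; f \<in> R\<rbrakk> \<Longrightarrow> \<not> sl_le E e f"
  using indepD[OF _ cprod.base] by blast

lemma keys_cover_diff:
  "\<lbrakk>e \<in> nonzero E; R \<in> \<RR> e\<rbrakk> \<Longrightarrow> Poly_Mapping.keys (cover_diff E e R) \<subseteq> nonzero E"
  unfolding cover_diff_def using coverD by (intro keys_sub_diff keys_join) auto

lemma keys_el: assumes "adm E \<RR> e S" shows "Poly_Mapping.keys (el E e S) \<subseteq> nonzero E"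
proof (cases "S = {}")
  case True
  then show ?thesis using assms by (simp add: el_def adm_def)
next
  case False
  then have "Poly_Mapping.keys (set_prod (free_mult E) (cover_diff E e) S) \<subseteq> nonzero E"
    using assms keys_cover_diff[THEN subsetD] meet_nonzero_iff nonzero_closed
    by (intro set_prod_closed) (auto simp: adm_def)
  then show ?thesis using False by (simp add: el_def cover_prod_def)
qed

lemma lin_el:
  assumes "is_char E \<chi>" "adm E \<RR> e S"
  shows "lin \<chi> (el E e S) = of_bool (\<chi> e \<and> (\<forall>R\<in>S. \<forall>f\<in>R. \<not> \<chi> f))"
proof (cases "S = {}")
  case True
  then show ?thesis by (simp add: el_def)
next
  case False
  have e: "e \<in> nonzero E" "finite S" "S \<subseteq> \<RR> e" using assms by (auto simp: adm_def)
  have diff: "lin \<chi> (cover_diff E e R) = of_bool (\<chi> e \<and> (\<forall>f\<in>R. \<not> \<chi> f))" if "R \<in> S" for R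
  proof -
    have R: "R \<in> \<RR> e" using that e by auto
    have "\<chi> e" if f: "f \<in> R" "\<chi> f" for f
    proof -
      have "\<chi> (meet E f e)" using coverD(3)[OF e(1) R f(1)] f(2) by (simp add: sl_le_def)
      moreover have "f \<in> carrier E" "e \<in> carrier E" using coverD(2)[OF e(1) R] f e nonzero_closed by auto
      ultimately show ?thesis using assms(1) by (auto simp: is_char_def)
    qed
    then show ?thesis
      using coverD[OF e(1) R] assms(1) by (auto simp: cover_diff_def lin_diff lin_join)
  qed
  have "lin \<chi> (cover_prod E e S) = (\<Prod>R\<in>S. lin \<chi> (cover_diff E e R))"
    unfolding cover_prod_def using assms(1) e False keys_cover_diff by (intro lin_set_prod) auto
  also have "\<dots> = (\<Prod>R\<in>S. of_bool (\<chi> e \<and> (\<forall>f\<in>R. \<not> \<chi> f)))"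
    using diff by (intro prod.cong) auto
  also have "\<dots> = of_bool (\<chi> e \<and> (\<forall>R\<in>S. \<forall>f\<in>R. \<not> \<chi> f))"
    using e(2) False by (induction S rule: finite_ne_induct) auto
  finally show ?thesis using False by (simp add: el_def)
qed

lemma pt_el:
  "\<lbrakk>d \<in> nonzero E; adm E \<RR> e S\<rbrakk>
    \<Longrightarrow> pt E d (el E e S) \<longleftrightarrow> sl_le E d e \<and> (\<forall>R\<in>S. \<forall>f\<in>R. \<not> sl_le E d f)"
  by (simp add: pt_def lin_el is_char_le)

lemma pt_frag_of: "pt E d (frag_of e) \<longleftrightarrow> sl_le E d e"
  by (simp add: pt_def)

lemma pt_mult:
  "\<lbrakk>d \<in> nonzero E; Poly_Mapping.keys x \<subseteq> nonzero E; Poly_Mapping.keys y \<subseteq> nonzero E\<rbrakk>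
    \<Longrightarrow> pt E d (free_mult E x y) \<longleftrightarrow> pt E d x \<and> pt E d y"
  by (simp add: pt_def lin_free_mult is_char_le)

lemma pt_self: "adm E \<RR> e S \<Longrightarrow> pt E e (el E e S)"
  using not_le_cover le_refl nonzero_closed by (subst pt_el) (auto simp: adm_def subset_iff)

lemma el_nonzero: "adm E \<RR> e S \<Longrightarrow> el E e S \<noteq> 0"
  using pt_self by fastforce

text \<open>Suppose R is in S but not in S'. By independence a maximal member m of R lies below no
  member of the covers in S', so m is a point of e(S') but not of e(S).\<close>

lemma el_inj_subset:
  assumes "adm E \<RR> e S" "adm E \<RR> e S'" "el E e S = el E e S'"
  shows "S \<subseteq> S'"
proof (rule ccontr)
  assume "\<not> S \<subseteq> S'"
  then obtain R where R: "R \<in> S" "R \<notin> S'" by blast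
  have e: "e \<in> nonzero E" "R \<in> \<RR> e" "e \<in> carrier E" using assms R by (auto simp: adm_def nonzero_def)
  \<comment> \<open>A cover of e is non-empty because e itself has to meet one of its
    members.\<close>
  obtain f where "f \<in> R" using coverD(4)[OF e(1,2) e(1)] e le_refl by blast
  then obtain m where m: "m \<in> max_elts E R" using max_elts_above[OF coverD(1,2)[OF e(1,2)]] by blast
  then have mR: "m \<in> R" by (auto simp: max_elts_def)
  then have mn: "m \<in> nonzero E" "sl_le E m e" using coverD[OF e(1,2)] by auto
  then have em: "meet E e m = m" using e meet_comm by (auto simp: sl_le_def nonzero_def)
  then have "cprod E \<RR> e {R} m"
    using cprod.step[OF cprod.base[of E \<RR> e] e(2) _ m] mn by (auto simp: nonzero_def)
  then have "\<not> sl_le E m f" if "R' \<in> S'" "f \<in> R'" for R' f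
    using indepD[OF e(1) _ _ _ that(2), of "{R}" m] that R assms(2) by (auto simp: adm_def)
  then have "pt E m (el E e S')" using pt_el[OF mn(1) assms(2)] mn by auto
  then have "pt E m (el E e S)" using assms(3) by simp
  then show False using pt_el[OF mn(1) assms(1)] R(1) mR le_refl nonzero_closed[OF mn(1)] by blast
qed

lemma el_inj:
  assumes "adm E \<RR> e S" "adm E \<RR> e' S'" "el E e S = el E e' S'"
  shows "e = e' \<and> S = S'"
proof -
  have n: "e \<in> nonzero E" "e' \<in> nonzero E" using assms by (auto simp: adm_def)
  have "sl_le E e e'" "sl_le E e' e"
    using pt_self[OF assms(1)] pt_self[OF assms(2)] pt_el[OF n(1) assms(2)] pt_el[OF n(2) assms(1)]
      assms(3) by auto
  then have "e = e'" using le_antisym n nonzero_closed by auto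
  then show ?thesis using el_inj_subset assms by (metis subset_antisym)
qed

lemma le_restr_iff:
  assumes "x \<in> nonzero E" "d \<in> carrier E" "R \<subseteq> nonzero E" "sl_le E x d"
  shows "(\<exists>f\<in>restr E d R. sl_le E x f) \<longleftrightarrow> (\<exists>f\<in>R. sl_le E x f)"
proof
  assume "\<exists>f\<in>restr E d R. sl_le E x f"
  then obtain f where "f \<in> R" "sl_le E x (meet E d f)" by (auto simp: restr_def)
  then show "\<exists>f\<in>R. sl_le E x f" using assms le_meet_iff nonzero_closed by blast
next
  assume "\<exists>f\<in>R. sl_le E x f"
  then obtain f where f: "f \<in> R" "sl_le E x f" by blast
  then have le: "sl_le E x (meet E d f)" using assms le_meet_iff nonzero_closed by blast
  then have "meet E d f \<in> nonzero E"
    using assms nonzero_le meet_closed nonzero_closed f by blast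
  then show "\<exists>f\<in>restr E d R. sl_le E x f" using f le by (auto simp: restr_def)
qed

text \<open>The point x lies below d e but below no member of R. This excludes the alternative in
  (i) that d e is itself a member of the restricted cover.\<close>

lemma restr_cover:
  assumes "d \<in> nonzero E" "e \<in> nonzero E" "R \<in> \<RR> e" "x \<in> nonzero E" "sl_le E x d" "sl_le E x e"
    "\<forall>f\<in>R. \<not> sl_le E x f"
  shows "restr E d R \<in> \<RR> (meet E d e)"
proof -
  have le: "sl_le E x (meet E d e)" using assms le_meet_iff nonzero_closed by blast
  then have "meet E d e \<in> nonzero E" using assms nonzero_le meet_closed nonzero_closed by blast
  moreover have "meet E d e \<notin> restr E d R"
    using le le_restr_iff[of x d R] coverD(2)[OF assms(2,3)] assms nonzero_closed by blast
  ultimately show ?thesis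
    using cond_i assms unfolding cond_i_def restr_def nonzero_def by blast
qed

text \<open>A nonzero product has a point y, and y makes \<open>restr_cover\<close> applicable to
  every cover in S and T. At points below both e and d, restricting a cover does not change whether
  the point lies below one of its members, so the two sides agree.\<close>

lemma el_mult:
  assumes "adm E \<RR> e S" "adm E \<RR> d T" "free_mult E (el E e S) (el E d T) \<noteq> 0"
  defines "U \<equiv> restr E d ` S \<union> restr E e ` T"
  shows "adm E \<RR> (meet E e d) U \<and> free_mult E (el E e S) (el E d T) = el E (meet E e d) U"
proof -
  let ?x = "free_mult E (el E e S) (el E d T)"
  have n: "e \<in> nonzero E" "d \<in> nonzero E" "e \<in> carrier E" "d \<in> carrier E"
    using assms by (auto simp: adm_def nonzero_def)
  have kx: "Poly_Mapping.keys ?x \<subseteq> nonzero E"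
    using assms keys_el free_mult_closed by blast
  then obtain y where y: "y \<in> nonzero E" "pt E y ?x"
    using assms(3) lin_le_eq_zeroD unfolding pt_def by blast
  have yy: "sl_le E y e" "sl_le E y d" "\<forall>R\<in>S. \<forall>f\<in>R. \<not> sl_le E y f" "\<forall>R\<in>T. \<forall>f\<in>R. \<not> sl_le E y f"
    using y pt_mult keys_el assms(1,2) pt_el by auto
  have de: "meet E e d = meet E d e" using n meet_comm by auto
  have ned: "meet E e d \<in> nonzero E"
    using nonzero_le[OF y(1) meet_closed[OF n(3,4)]] le_meet_iff[OF nonzero_closed[OF y(1)] n(3,4)] yy
    by blast
  have "restr E d R \<in> \<RR> (meet E e d)" if "R \<in> S" for R
    unfolding de using restr_cover[OF n(2,1) _ y(1)] yy that assms(1) by (auto simp: adm_def)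
  moreover have "restr E e R \<in> \<RR> (meet E e d)" if "R \<in> T" for R
    using restr_cover[OF n(1,2) _ y(1)] yy that assms(2) by (auto simp: adm_def)
  ultimately have a: "adm E \<RR> (meet E e d) U"
    using ned assms(1,2) by (auto simp: adm_def U_def)
  have sub: "R \<subseteq> nonzero E" if "R \<in> S \<union> T" for R
    using that assms(1,2) coverD(2) n by (auto simp: adm_def subset_iff)
  have "?x = el E (meet E e d) U"
  proof (rule free_alg_eqI[OF kx keys_el[OF a]])
    fix z assume z: "z \<in> nonzero E"
    have "(sl_le E z e \<and> (\<forall>R\<in>S. \<forall>f\<in>R. \<not> sl_le E z f)) \<and> sl_le E z d \<and> (\<forall>R\<in>T. \<forall>f\<in>R. \<not> sl_le E z f)
      \<longleftrightarrow> sl_le E z (meet E e d) \<and> (\<forall>R\<in>U. \<forall>f\<in>R. \<not> sl_le E z f)" (is "?L = ?R")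
    proof (cases "sl_le E z e \<and> sl_le E z d")
      case True
      have 1: "(\<forall>f\<in>restr E d R. \<not> sl_le E z f) = (\<forall>f\<in>R. \<not> sl_le E z f)" if "R \<in> S" for R
        using le_restr_iff[OF z n(4)] that sub True by auto
      have 2: "(\<forall>f\<in>restr E e R. \<not> sl_le E z f) = (\<forall>f\<in>R. \<not> sl_le E z f)" if "R \<in> T" for R
        using le_restr_iff[OF z n(3)] that sub True by auto
      have "(\<forall>R\<in>U. \<forall>f\<in>R. \<not> sl_le E z f)
        = ((\<forall>R\<in>S. \<forall>f\<in>R. \<not> sl_le E z f) \<and> (\<forall>R\<in>T. \<forall>f\<in>R. \<not> sl_le E z f))"
        by (simp add: U_def ball_Un 1 2)
      then show ?thesis
        using True le_meet_iff[OF nonzero_closed[OF z] n(3,4)] by blast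
    next
      case False
      then show ?thesis using le_meet_iff[OF nonzero_closed[OF z] n(3,4)] by blast
    qed
    then show "lin (sl_le E z) ?x = lin (sl_le E z) (el E (meet E e d) U)"
      using assms(1,2) keys_el by (auto simp: lin_free_mult is_char_le lin_el z a)
  qed
  then show ?thesis using a by blast
qed

end

section \<open>The construction preserves the conditions\<close>

lemma lin_frag_map: "lin \<chi> (frag_extend (\<lambda>e. frag_of (p e)) x) = lin (\<lambda>e. \<chi> (p e)) x"
proof -
  have "Poly_Mapping.keys x \<subseteq> UNIV" by simp
  then show ?thesis
    by (induction x rule: frag_induction) (auto simp: frag_extend_diff lin_diff)
qed

lemma free_act_diff: "free_act E g (x - y) = free_act E g x - free_act E g y"
  by (simp add: free_act_def frag_extend_diff)

lemma free_act_add: "free_act E g (x + y) = free_act E g x + free_act E g y"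
  by (simp add: free_act_def frag_extend_add)

lemma free_act_zero [simp]: "free_act E g 0 = 0"
  by (simp add: free_act_def)

lemma free_act_of [simp]: "free_act E g (frag_of e) = frag_of (act E g e)"
  by (simp add: free_act_def)

section \<open>The action on the free algebra\<close>

context gamma_semilattice
begin

lemma keys_free_act:
  "\<lbrakk>g \<in> carrier G; Poly_Mapping.keys x \<subseteq> nonzero E\<rbrakk> \<Longrightarrow> Poly_Mapping.keys (free_act E g x) \<subseteq> nonzero E"
  unfolding free_act_def by (rule keys_frag_extend_sub) (use act_nonzero in auto)

lemma free_act_one:
  assumes "Poly_Mapping.keys x \<subseteq> nonzero E"
  shows "free_act E \<one>\<^bsub>G\<^esub> x = x"
  using assms by (induction x rule: frag_induction) (auto simp: free_act_diff act_one nonzero_closed)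

lemma free_act_act:
  assumes "g \<in> carrier G" "h \<in> carrier G" "Poly_Mapping.keys x \<subseteq> nonzero E"
  shows "free_act E (g \<otimes>\<^bsub>G\<^esub> h) x = free_act E g (free_act E h x)"
  using assms(3,1,2)
  by (induction x rule: frag_induction) (auto simp: free_act_diff act_mult nonzero_closed)

lemma free_act_free_mult:
  assumes "g \<in> carrier G" "Poly_Mapping.keys x \<subseteq> nonzero E" "Poly_Mapping.keys y \<subseteq> nonzero E"
  shows "free_act E g (free_mult E x y) = free_mult E (free_act E g x) (free_act E g y)"
  using assms(2,3)
proof (induction x y rule: bilinear_induct)
  case (basis e f)
  then have ef: "e \<in> carrier E" "f \<in> carrier E" by (auto simp: nonzero_def)
  then show ?case
    using assms(1) act_meet act_meet_nonzero_iff[OF assms(1) ef] by (simp add: free_mult_of)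
qed (auto simp: free_act_diff free_mult_diff_left free_mult_diff_right)

lemma lin_free_act:
  assumes "g \<in> carrier G" "d \<in> nonzero E" "Poly_Mapping.keys x \<subseteq> nonzero E"
  shows "lin (sl_le E (act E g d)) (free_act E g x) = lin (sl_le E d) x"
  unfolding free_act_def lin_frag_map using assms act_le_iff nonzero_closed
  by (intro lin_cong) blast

text \<open>The element g permutes the points, so comparison at the points g d is enough.\<close>

lemma free_act_eqI:
  assumes "g \<in> carrier G" "Poly_Mapping.keys x \<subseteq> nonzero E" "Poly_Mapping.keys y \<subseteq> nonzero E"
    and "\<And>d. d \<in> nonzero E \<Longrightarrow> lin (sl_le E (act E g d)) x = lin (sl_le E (act E g d)) y"
  shows "x = y"
proof (rule free_alg_eqI[OF assms(2,3)])
  fix d assume d: "d \<in> nonzero E"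
  interpret Gr: group G by (rule group_G)
  have "act E g (act E (inv\<^bsub>G\<^esub> g) d) = d" "act E (inv\<^bsub>G\<^esub> g) d \<in> nonzero E"
    using d assms(1) act_inv act_nonzero nonzero_closed by auto
  then show "lin (sl_le E d) x = lin (sl_le E d) y" using assms(4) by metis
qed

end

section \<open>The next semilattice as a semilattice of indicators\<close>

context covers
begin

lemma N_sel [simp]: "meet N = free_mult E" "bot N = 0" "act N = free_act E"
  by (simp_all add: next_sl_def)

lemma carrier_N: "carrier N = {el E e S | e S. adm E \<RR> e S \<and> S \<noteq> {}} \<union> {0}"
  by (auto simp: next_sl_def el_def adm_def)

lemma nonzero_N: "nonzero N = {el E e S | e S. adm E \<RR> e S \<and> S \<noteq> {}}"
  using el_nonzero by (auto simp: nonzero_def carrier_N)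

lemma keys_N: "x \<in> carrier N \<Longrightarrow> Poly_Mapping.keys x \<subseteq> nonzero E"
  using keys_el by (auto simp: carrier_N)

lemma lin_N: "\<lbrakk>x \<in> carrier N; d \<in> nonzero E\<rbrakk> \<Longrightarrow> lin (sl_le E d) x = of_bool (pt E d x)"
  by (auto simp: carrier_N pt_def lin_el is_char_le)

lemma pt_N_mult: "\<lbrakk>x \<in> carrier N; y \<in> carrier N; d \<in> nonzero E\<rbrakk>
    \<Longrightarrow> pt E d (free_mult E x y) \<longleftrightarrow> pt E d x \<and> pt E d y"
  using pt_mult keys_N by blast

lemma N_eqI:
  "\<lbrakk>x \<in> carrier N; y \<in> carrier N; \<And>d. d \<in> nonzero E \<Longrightarrow> pt E d x = pt E d y\<rbrakk> \<Longrightarrow> x = y"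
  by (rule free_alg_eqI) (auto simp: keys_N lin_N)

text \<open>Since products of indicators are indicators of intersections, the order is inclusion of
  sets of points.\<close>

lemma le_N_iff:
  assumes "x \<in> carrier N" "y \<in> carrier N"
  shows "sl_le N x y \<longleftrightarrow> (\<forall>d\<in>nonzero E. pt E d x \<longrightarrow> pt E d y)"
proof
  assume "sl_le N x y"
  then show "\<forall>d\<in>nonzero E. pt E d x \<longrightarrow> pt E d y"
    using pt_N_mult[OF assms] by (auto simp: sl_le_def)
next
  assume "\<forall>d\<in>nonzero E. pt E d x \<longrightarrow> pt E d y"
  then have "free_mult E x y = x"
    using assms keys_N free_mult_closed
    by (intro free_alg_eqI) (auto simp: lin_free_mult is_char_le lin_N)
  then show "sl_le N x y" by (simp add: sl_le_def)
qed

lemma N_nonzero_iff: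
  assumes "x \<in> carrier N"
  shows "x \<in> nonzero N \<longleftrightarrow> (\<exists>d\<in>nonzero E. pt E d x)"
  using assms pt_self by (fastforce simp: nonzero_N carrier_N adm_def)

lemma el_N: "\<lbrakk>adm E \<RR> e S; S \<noteq> {}\<rbrakk> \<Longrightarrow> el E e S \<in> nonzero N"
  by (auto simp: nonzero_N)

lemma N_closed: "x \<in> nonzero N \<Longrightarrow> x \<in> carrier N"
  by (simp add: nonzero_def)

lemma el_mult_N:
  assumes "adm E \<RR> e S" "adm E \<RR> d T" "S \<union> T \<noteq> {}"
  shows "free_mult E (el E e S) (el E d T) \<in> carrier N"
proof (cases "free_mult E (el E e S) (el E d T) = 0")
  case False
  then show ?thesis
    using el_mult[OF assms(1,2) False] assms(3) by (auto simp: carrier_N)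
qed (simp add: carrier_N)

lemma frag_mult_N:
  assumes "d \<in> nonzero E" "x \<in> carrier N"
  shows "free_mult E (frag_of d) x \<in> carrier N"
proof (cases "x = 0")
  case False
  then obtain e S where x: "adm E \<RR> e S" "S \<noteq> {}" "x = el E e S" using assms by (auto simp: carrier_N)
  have d: "adm E \<RR> d {}" "frag_of d = el E d {}" using assms by (auto simp: adm_def el_def)
  show ?thesis unfolding x(3) d(2) using el_mult_N[OF d(1) x(1)] x(2) by simp
qed (simp add: carrier_N)

lemma pt_frag_mult:
  assumes "d \<in> nonzero E" "x \<in> carrier N" "c \<in> nonzero E"
  shows "pt E c (free_mult E (frag_of d) x) \<longleftrightarrow> sl_le E c d \<and> pt E c x"
  using assms keys_N by (subst pt_mult) (auto simp: pt_frag_of)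

lemma act_adm:
  assumes "g \<in> carrier G" "adm E \<RR> e S"
  shows "adm E \<RR> (act E g e) ((`) (act E g) ` S)"
proof -
  have "(`) (act E g) ` \<RR> e = \<RR> (act E g e)"
    using cond_iii assms by (auto simp: cond_iii_def adm_def)
  moreover have "(`) (act E g) ` S \<subseteq> (`) (act E g) ` \<RR> e"
    using assms by (auto simp: adm_def)
  ultimately show ?thesis using assms act_nonzero by (simp add: adm_def)
qed

lemma free_act_el:
  assumes "g \<in> carrier G" "adm E \<RR> e S"
  shows "free_act E g (el E e S) = el E (act E g e) ((`) (act E g) ` S)"
proof (rule free_act_eqI[OF assms(1)])
  fix d assume d: "d \<in> nonzero E"
  have c: "d \<in> carrier E" "e \<in> carrier E" "\<And>R f. R \<in> S \<Longrightarrow> f \<in> R \<Longrightarrow> f \<in> carrier E"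
    using d assms coverD(2) nonzero_closed unfolding adm_def by blast+
  have "sl_le E d e \<and> (\<forall>R\<in>S. \<forall>f\<in>R. \<not> sl_le E d f) \<longleftrightarrow>
    sl_le E (act E g d) (act E g e) \<and> (\<forall>R\<in>(`) (act E g) ` S. \<forall>f\<in>R. \<not> sl_le E (act E g d) f)"
    using act_le_iff[OF assms(1) c(1)] c by auto
  then show "lin (sl_le E (act E g d)) (free_act E g (el E e S))
    = lin (sl_le E (act E g d)) (el E (act E g e) ((`) (act E g) ` S))"
    using assms d keys_el act_nonzero
    by (simp add: lin_free_act lin_el[OF is_char_le] act_adm)
qed (use assms keys_el act_adm keys_free_act in auto)

lemma next_gamma_semilattice: "gamma_semilattice G N"
proof (rule gamma_semilattice.intro)
  show "group G" by (rule group_G)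
  fix x y z assume x: "x \<in> carrier N" and y: "y \<in> carrier N"
  show xy: "meet N x y \<in> carrier N"
  proof (cases "x = 0 \<or> y = 0")
    case False
    then show ?thesis using x y el_mult_N by (auto simp: carrier_N)
  qed (auto simp: carrier_N)
  show "meet N x y = meet N y x" using x y free_mult_comm keys_N by simp
  show "meet N (meet N x y) z = meet N x (meet N y z)" if "z \<in> carrier N"
    using x y that free_mult_assoc keys_N by simp
  fix g assume g: "g \<in> carrier G"
  show "act N g (meet N x y) = meet N (act N g x) (act N g y)"
    using g x y free_act_free_mult keys_N by simp
next
  fix x assume x: "x \<in> carrier N"
  show "meet N x x = x"
    using x keys_N free_mult_closed
    by (intro free_alg_eqI) (auto simp: lin_free_mult is_char_le lin_N)
  show "meet N (bot N) x = bot N" by simp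
next
  show "bot N \<in> carrier N" by (simp add: carrier_N)
  show "group_action G (carrier N) (\<lambda>g. restrict (act N g) (carrier N))"
  proof (rule group_actionI[OF group_G])
    fix g x assume g: "g \<in> carrier G" and x: "x \<in> carrier N"
    show "act N g x \<in> carrier N"
    proof (cases "x = 0")
      case False
      then obtain e S where eS: "adm E \<RR> e S" "S \<noteq> {}" "x = el E e S"
        using x by (auto simp: carrier_N)
      then show ?thesis
        using el_N[OF act_adm[OF g eS(1)]] N_closed free_act_el[OF g eS(1)] by simp
    qed (simp add: carrier_N)
  qed (use free_act_one free_act_act keys_N in auto)
qed

section \<open>Covers of the next semilattice\<close>

lemma next_cover_el:
  "S \<noteq> {} \<Longrightarrow> next_cover E e S R = insert (el E e (insert R S))
     {free_mult E (frag_of f) (el E e S) | f. f \<in> R \<and> free_mult E (frag_of f) (el E e S) \<noteq> 0}"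
  by (auto simp: next_cover_def el_def)

lemma adm_insert: "\<lbrakk>adm E \<RR> e S; R \<in> \<RR> e\<rbrakk> \<Longrightarrow> adm E \<RR> e (insert R S)"
  by (simp add: adm_def)

lemma next_covers_el:
  assumes "adm E \<RR> e S" "S \<noteq> {}"
  shows "M (el E e S) = next_cover E e S ` (\<RR> e - S)"
proof -
  have "M (el E e S) = {next_cover E e' S' R | e' S' R.
      adm E \<RR> e' S' \<and> S' \<noteq> {} \<and> el E e S = el E e' S' \<and> R \<in> \<RR> e' - S'}"
    unfolding next_covers_def by (intro Collect_cong ex_cong1) (auto simp: adm_def el_def)
  also have "\<dots> = {next_cover E e S R | R. R \<in> \<RR> e - S}"
    using el_inj[OF assms(1)] assms by (intro Collect_cong) blast
  finally show ?thesis by auto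
qed

lemma next_cover_subset:
  assumes "adm E \<RR> e S" "S \<noteq> {}" "R \<in> \<RR> e"
  shows "next_cover E e S R \<subseteq> nonzero N"
proof -
  have "free_mult E (frag_of f) (el E e S) \<in> carrier N" if "f \<in> R" for f
    using that assms frag_mult_N[of f "el E e S"] coverD(2) el_N[OF assms(1,2)] N_closed
    by (auto simp: adm_def)
  then show ?thesis
    using el_N[OF adm_insert[OF assms(1,3)]] by (auto simp: next_cover_el[OF assms(2)] nonzero_def)
qed

text \<open>A point of e(S) either lies below some f in R, and is then a point of f e(S), or below
  none, and is then a point of the element with R added to S. This gives both the covering property
  and, later, the vanishing of composed maps.\<close>

lemma pt_next_cover:
  assumes "adm E \<RR> e S" "S \<noteq> {}" "R \<in> \<RR> e" "d \<in> nonzero E"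
  shows "(\<exists>q\<in>next_cover E e S R. pt E d q) \<longleftrightarrow> pt E d (el E e S)"
proof
  assume "\<exists>q\<in>next_cover E e S R. pt E d q"
  then consider "pt E d (el E e (insert R S))"
    | f where "f \<in> R" "pt E d (free_mult E (frag_of f) (el E e S))"
    by (auto simp: next_cover_el[OF assms(2)])
  then show "pt E d (el E e S)"
  proof cases
    case 1
    then show ?thesis using pt_el[OF assms(4)] adm_insert assms by auto
  next
    case (2 f)
    then have "f \<in> nonzero E" using assms coverD(2)[of e R] by (auto simp: adm_def)
    then show ?thesis
      using 2 pt_frag_mult[of f "el E e S" d] el_N[OF assms(1,2)] N_closed assms(4) by blast
  qed
next
  assume p: "pt E d (el E e S)"
  show "\<exists>q\<in>next_cover E e S R. pt E d q"
  proof (cases "\<exists>f\<in>R. sl_le E d f")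
    case True
    then obtain f where f: "f \<in> R" "sl_le E d f" by blast
    have "f \<in> nonzero E" using f assms coverD(2) by (auto simp: adm_def)
    then have "pt E d (free_mult E (frag_of f) (el E e S))"
      using f p assms by (subst pt_frag_mult) (auto simp: el_N N_closed)
    moreover from this have "free_mult E (frag_of f) (el E e S) \<noteq> 0" by fastforce
    ultimately show ?thesis using f by (auto simp: next_cover_el[OF assms(2)])
  next
    case False
    then have "pt E d (el E e (insert R S))"
      using p pt_el[OF assms(4)] adm_insert assms by auto
    then show ?thesis by (auto simp: next_cover_el[OF assms(2)])
  qed
qed

lemma next_finite_cover:
  assumes "adm E \<RR> e S" "S \<noteq> {}" "R \<in> \<RR> e"
  shows "finite_cover N (el E e S) (next_cover E e S R)"
  unfolding finite_cover_def
proof (intro conjI ballI impI)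
  let ?Q = "next_cover E e S R"
  have "finite R" using assms coverD(1) by (auto simp: adm_def)
  then have "finite ((\<lambda>f. free_mult E (frag_of f) (el E e S)) ` R)" by simp
  then show "finite ?Q"
    unfolding next_cover_el[OF assms(2)] by (auto elim: rev_finite_subset)
  show sub: "?Q \<subseteq> nonzero N" by (rule next_cover_subset[OF assms])
  have X: "el E e S \<in> carrier N" using el_N assms N_closed by blast
  show "sl_le N q (el E e S)" if "q \<in> ?Q" for q
    using that sub X pt_next_cover[OF assms] N_closed by (subst le_N_iff) auto
  fix x assume x: "x \<in> nonzero N" "sl_le N x (el E e S)"
  then obtain d where d: "d \<in> nonzero E" "pt E d x" using N_nonzero_iff N_closed by blast
  then have "pt E d (el E e S)" using le_N_iff[OF N_closed[OF x(1)] X] x by blast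
  then obtain q where q: "q \<in> ?Q" "pt E d q" using pt_next_cover[OF assms d(1)] by blast
  have "pt E d (meet N x q)"
    using q d x sub by (simp add: pt_N_mult N_closed subset_iff)
  then have "meet N x q \<noteq> bot N" by fastforce
  then show "\<exists>q\<in>?Q. meet N x q \<noteq> bot N" using q by blast
qed

lemma next_cover_collection: "cover_collection N M"
  unfolding cover_collection_def
proof (intro ballI)
  fix x Q assume x: "x \<in> nonzero N" and Q: "Q \<in> M x"
  obtain e S where eS: "adm E \<RR> e S" "S \<noteq> {}" "x = el E e S" using x by (auto simp: nonzero_N)
  then show "finite_cover N x Q"
    using next_finite_cover[OF eS(1,2)] Q next_covers_el[OF eS(1,2)] by auto
qed

text \<open>By \<open>el_mult\<close> the product P of D = d(T) and X = e(S) is the element over d e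
  with the set U of restricted covers. The argument splits according to what the restriction of R to
  d is: not a cover of d e, a cover already in U, or a new one.\<close>

lemma next_cond_i: "cond_i N M"
  unfolding cond_i_def
proof (intro ballI impI)
  fix D X Q assume D: "D \<in> nonzero N" and X: "X \<in> nonzero N" and Q: "Q \<in> M X"
    and nz: "meet N D X \<noteq> bot N"
  interpret N: gamma_semilattice G N by (rule next_gamma_semilattice)
  obtain d T where dT: "adm E \<RR> d T" "T \<noteq> {}" "D = el E d T" using D by (auto simp: nonzero_N)
  obtain e S where eS: "adm E \<RR> e S" "S \<noteq> {}" "X = el E e S" using X by (auto simp: nonzero_N)
  obtain R where R: "R \<in> \<RR> e" "R \<notin> S" "Q = next_cover E e S R"
    using Q unfolding eS(3) next_covers_el[OF eS(1,2)] by blast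
  have DX: "D \<in> carrier N" "X \<in> carrier N" using D X N_closed by auto
  have n: "d \<in> nonzero E" "e \<in> nonzero E" "d \<in> carrier E" "e \<in> carrier E"
    using dT eS by (auto simp: adm_def nonzero_def)
  have RE: "R \<subseteq> nonzero E" using coverD(2)[OF n(2) R(1)] .
  define U where "U = restr E e ` T \<union> restr E d ` S"
  let ?de = "meet E d e"
  let ?P = "free_mult E D X"
  have U: "adm E \<RR> ?de U" "?P = el E ?de U" "U \<noteq> {}"
    using el_mult[OF dT(1) eS(1)] nz dT(2) by (auto simp: U_def dT(3) eS(3))
  have P: "?P \<in> carrier N" using N.meet_closed[OF DX] by simp
  have ptP: "pt E c ?P \<longleftrightarrow> pt E c D \<and> pt E c X" if "c \<in> nonzero E" for c
    using pt_N_mult DX that by blast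
  have de: "?de \<in> nonzero E" "?de \<in> carrier E" using U(1) by (auto simp: adm_def nonzero_def)
  have ptde: "sl_le E c ?de" if "c \<in> nonzero E" "pt E c ?P" for c
    using that pt_el[OF that(1) U(1)] U(2) by simp
  have cd: "sl_le E c d" "sl_le E c e" if "c \<in> nonzero E" "pt E c ?P" for c
    using ptde[OF that] le_meet_iff nonzero_closed that n by blast+
  have fX: "free_mult E (frag_of f) X \<in> carrier N" if "f \<in> R" for f
    using frag_mult_N DX RE that by blast
  have DfX: "free_mult E D (free_mult E (frag_of f) X) \<in> carrier N" if "f \<in> R" for f
    using N.meet_closed[OF DX(1) fX[OF that]] by simp
  have ptDfX: "pt E c (free_mult E D (free_mult E (frag_of f) X)) \<longleftrightarrow> sl_le E c f \<and> pt E c ?P"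
    if "f \<in> R" "c \<in> nonzero E" for f c
    using pt_N_mult[OF DX(1) fX[OF that(1)] that(2)] pt_frag_mult[OF _ DX(2) that(2), of f] RE that ptP
    by blast
  have Q': "Q = insert (el E e (insert R S))
      {free_mult E (frag_of f) X | f. f \<in> R \<and> free_mult E (frag_of f) X \<noteq> 0}"
    unfolding R(3) eS(3) by (rule next_cover_el[OF eS(2)])
  have eR: "el E e (insert R S) \<in> nonzero N" "adm E \<RR> e (insert R S)"
    using el_N adm_insert eS R by auto
  have DeR: "free_mult E D (el E e (insert R S)) \<in> carrier N"
    using N.meet_closed[OF DX(1) N_closed[OF eR(1)]] by simp
  have ptDeR: "pt E c (free_mult E D (el E e (insert R S))) \<longleftrightarrow> pt E c ?P \<and> (\<forall>f\<in>R. \<not> sl_le E c f)"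
    if "c \<in> nonzero E" for c
    using pt_N_mult[OF DX(1) N_closed[OF eR(1)] that] pt_el[OF that eR(2)] pt_el[OF that eS(1)]
      ptP[OF that] eS(3) by auto
  have nzP: "?P \<noteq> 0" using nz by simp
  show "meet N D X \<in> meet N D ` Q \<inter> nonzero N \<or> meet N D ` Q \<inter> nonzero N \<in> M (meet N D X)"
  \<comment> \<open>If d e = d f with f in R, every point of P lies below f, so the member f X of Q
    already yields all of P.\<close>
  proof (cases "?de \<in> restr E d R")
    case True
    then obtain f where f: "f \<in> R" "?de = meet E d f" by (auto simp: restr_def)
    have "sl_le E c f" if "c \<in> nonzero E" "pt E c ?P" for c
      using ptde[OF that] f le_meet_iff[of c d f] that n RE nonzero_closed by auto
    then have eq: "free_mult E D (free_mult E (frag_of f) X) = ?P"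
      using DfX P ptDfX f by (intro N_eqI) auto
    then have "free_mult E (frag_of f) X \<noteq> 0" using nzP by auto
    then have "?P \<in> meet N D ` Q"
      using f eq[symmetric] unfolding Q' by auto
    then show ?thesis using P nzP by (auto simp: nonzero_def)
  next
    case False
    then have rR: "restr E d R \<in> \<RR> ?de"
      using cond_i n R de unfolding cond_i_def restr_def by (auto simp: nonzero_def)
    have le_restr: "(\<exists>f\<in>restr E d R. sl_le E c f) \<longleftrightarrow> (\<exists>f\<in>R. sl_le E c f)"
      if "c \<in> nonzero E" "pt E c ?P" for c
      using le_restr_iff[OF that(1) n(3) RE] cd[OF that] by blast
    show ?thesis
    \<comment> \<open>If the restriction is already in U, no point of P lies below a member of R, so
      the member of Q with R added to S yields all of P.\<close>
    proof (cases "restr E d R \<in> U")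
      case True
      have "\<not> sl_le E c f" if "c \<in> nonzero E" "pt E c ?P" "f \<in> R" for c f
        using le_restr[OF that(1,2)] that True pt_el[OF that(1) U(1)] U(2) by auto
      then have "free_mult E D (el E e (insert R S)) = ?P"
        using DeR P ptDeR by (intro N_eqI) auto
      then have "?P \<in> meet N D ` Q" unfolding Q' by (auto intro: rev_image_eqI)
      then show ?thesis using P nzP by (auto simp: nonzero_def)
    next
      case rU: False
      \<comment> \<open>In the remaining case multiplication by D carries Q to the cover of P given
        by the restriction: \<open>first\<close> and \<open>second\<close> match the two kinds of
        members, and \<open>nz2\<close> ensures that nonzero products come from nonzero d f.\<close>
      let ?Q' = "next_cover E ?de U (restr E d R)"
      have Q'': "?Q' = insert (el E ?de (insert (restr E d R) U))
          {free_mult E (frag_of f) ?P | f. f \<in> restr E d R \<and> free_mult E (frag_of f) ?P \<noteq> 0}"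
        unfolding U(2) by (rule next_cover_el[OF U(3)])
      have a: "adm E \<RR> ?de (insert (restr E d R) U)" using adm_insert U rR by blast
      have first: "free_mult E D (el E e (insert R S)) = el E ?de (insert (restr E d R) U)"
      proof (rule N_eqI[OF DeR])
        show "el E ?de (insert (restr E d R) U) \<in> carrier N" using el_N[OF a] N_closed by blast
        fix c assume c: "c \<in> nonzero E"
        have "pt E c (el E ?de (insert (restr E d R) U))
            \<longleftrightarrow> pt E c ?P \<and> (\<forall>f\<in>restr E d R. \<not> sl_le E c f)"
          using pt_el[OF c a] pt_el[OF c U(1)] U(2) by auto
        then show "pt E c (free_mult E D (el E e (insert R S)))
            \<longleftrightarrow> pt E c (el E ?de (insert (restr E d R) U))"
          using ptDeR[OF c] le_restr[OF c] by blast
      qed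
      have second: "free_mult E D (free_mult E (frag_of f) X) = free_mult E (frag_of (meet E d f)) ?P"
        if f: "f \<in> R" "meet E d f \<in> nonzero E" for f
      proof (rule N_eqI[OF DfX[OF f(1)] frag_mult_N[OF f(2) P]])
        fix c assume c: "c \<in> nonzero E"
        have "sl_le E c (meet E d f) \<longleftrightarrow> sl_le E c d \<and> sl_le E c f"
          using c f n RE nonzero_closed by (intro le_meet_iff) auto
        then show "pt E c (free_mult E D (free_mult E (frag_of f) X))
            = pt E c (free_mult E (frag_of (meet E d f)) ?P)"
          using ptDfX[OF f(1) c] pt_frag_mult[OF f(2) P c] cd[OF c] by blast
      qed
      have nz2: "meet E d f \<in> nonzero E"
        if f: "f \<in> R" "free_mult E D (free_mult E (frag_of f) X) \<noteq> 0" for f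
      proof -
        have "free_mult E D (free_mult E (frag_of f) X) \<in> nonzero N"
          using DfX f by (auto simp: nonzero_def)
        then obtain c where c: "c \<in> nonzero E" "pt E c (free_mult E D (free_mult E (frag_of f) X))"
          using N_nonzero_iff[OF DfX[OF f(1)]] by blast
        then have "sl_le E c f" "sl_le E c d" using ptDfX f cd by auto
        then have "sl_le E c (meet E d f)" using c f n RE nonzero_closed le_meet_iff by blast
        then show ?thesis using nonzero_le[OF c(1)] meet_closed n f RE nonzero_closed by blast
      qed
      have "meet N D ` Q \<inter> nonzero N = ?Q'"
      proof
        show "meet N D ` Q \<inter> nonzero N \<subseteq> ?Q'"
        proof
          fix y assume y: "y \<in> meet N D ` Q \<inter> nonzero N"
          then have y0: "y \<noteq> 0" by (auto simp: nonzero_def)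
          from y consider "y = free_mult E D (el E e (insert R S))"
            | f where "f \<in> R" "y = free_mult E D (free_mult E (frag_of f) X)"
            unfolding Q' by auto
          then show "y \<in> ?Q'"
          proof cases
            case 1
            then show ?thesis using first Q'' by auto
          next
            case (2 f)
            have m: "meet E d f \<in> nonzero E" using nz2 2 y0 by blast
            then have "y = free_mult E (frag_of (meet E d f)) ?P" using second 2 by blast
            moreover have "meet E d f \<in> restr E d R" using m 2 by (auto simp: restr_def)
            ultimately show ?thesis unfolding Q'' using y0 by blast
          qed
        qed
        show "?Q' \<subseteq> meet N D ` Q \<inter> nonzero N"
        proof
          fix y assume y: "y \<in> ?Q'"
          have yN: "y \<in> nonzero N" using next_cover_subset[OF U(1,3) rR] y by blast
          from y consider "y = el E ?de (insert (restr E d R) U)"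
            | f where "f \<in> restr E d R" "y = free_mult E (frag_of f) ?P" "y \<noteq> 0"
            unfolding Q'' by auto
          then show "y \<in> meet N D ` Q \<inter> nonzero N"
          proof cases
            case 1
            then have "y = meet N D (el E e (insert R S))" using first by simp
            then show ?thesis using yN unfolding Q' by blast
          next
            case (2 k)
            then obtain f where f: "f \<in> R" "k = meet E d f" "k \<in> nonzero E" by (auto simp: restr_def)
            then have yy: "y = meet N D (free_mult E (frag_of f) X)" using second 2 by simp
            then have "free_mult E (frag_of f) X \<noteq> 0" using 2 by auto
            then show ?thesis using yN yy f unfolding Q' by blast
          qed
        qed
      qed
      moreover have "?Q' \<in> M ?P" unfolding U(2) next_covers_el[OF U(1,3)] using rR rU by blast
      ultimately show ?thesis by simp
    qed
  qed
qed

lemma act_next_cover: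
  assumes "g \<in> carrier G" "adm E \<RR> e S" "S \<noteq> {}" "R \<in> \<RR> e"
  shows "free_act E g ` next_cover E e S R
    = next_cover E (act E g e) ((`) (act E g) ` S) (act E g ` R)"
proof -
  let ?a = "(`) (act E g)"
  have ne: "?a ` S \<noteq> {}" using assms by simp
  have RE: "R \<subseteq> nonzero E" using coverD(2) assms by (auto simp: adm_def)
  have 1: "free_act E g (free_mult E (frag_of f) (el E e S))
      = free_mult E (frag_of (act E g f)) (el E (act E g e) (?a ` S))" if "f \<in> R" for f
    using that RE assms keys_el[OF assms(2)] free_act_free_mult[of g "frag_of f" "el E e S"]
    by (auto simp: free_act_el)
  have 2: "free_act E g x = 0 \<longleftrightarrow> x = 0" if "Poly_Mapping.keys x \<subseteq> nonzero E" for x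
  proof
    interpret Gr: group G by (rule group_G)
    assume "free_act E g x = 0"
    then have "free_act E (inv\<^bsub>G\<^esub> g \<otimes>\<^bsub>G\<^esub> g) x = 0"
      using free_act_act[OF _ assms(1) that, of "inv\<^bsub>G\<^esub> g"] assms(1) by (simp del: Gr.l_inv)
    then show "x = 0" using assms(1) free_act_one[OF that] by (simp only: Gr.l_inv)
  qed simp
  have 3: "free_mult E (frag_of (act E g f)) (el E (act E g e) (?a ` S)) \<noteq> 0
      \<longleftrightarrow> free_mult E (frag_of f) (el E e S) \<noteq> 0" if "f \<in> R" for f
    using 1[OF that] 2 free_mult_closed[of "frag_of f" "el E e S"] keys_el[OF assms(2)] RE that by force
  have "free_act E g (el E e (insert R S)) = el E (act E g e) (insert (act E g ` R) (?a ` S))"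
    using free_act_el[OF assms(1) adm_insert[OF assms(2,4)]] by simp
  moreover have "free_act E g ` {free_mult E (frag_of f) (el E e S) | f.
        f \<in> R \<and> free_mult E (frag_of f) (el E e S) \<noteq> 0}
    = {free_mult E (frag_of f) (el E (act E g e) (?a ` S)) | f.
        f \<in> act E g ` R \<and> free_mult E (frag_of f) (el E (act E g e) (?a ` S)) \<noteq> 0}" (is "?A = ?B")
  proof
    show "?A \<subseteq> ?B" using 1 3 by fastforce
    show "?B \<subseteq> ?A"
    proof
      fix y assume "y \<in> ?B"
      then obtain f where f: "f \<in> R" "y = free_mult E (frag_of (act E g f)) (el E (act E g e) (?a ` S))"
        "free_mult E (frag_of (act E g f)) (el E (act E g e) (?a ` S)) \<noteq> 0" by blast
      then have "y = free_act E g (free_mult E (frag_of f) (el E e S))"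
        "free_mult E (frag_of f) (el E e S) \<noteq> 0" using 1 3 by auto
      then show "y \<in> ?A" using f(1) by blast
    qed
  qed
  ultimately show ?thesis
    unfolding next_cover_el[OF assms(3)] next_cover_el[OF ne] by simp
qed

lemma next_cond_iii: "cond_iii G N M"
  unfolding cond_iii_def
proof (intro ballI)
  fix g x assume g: "g \<in> carrier G" and x: "x \<in> nonzero N"
  let ?a = "(`) (act E g)"
  obtain e S where eS: "adm E \<RR> e S" "S \<noteq> {}" "x = el E e S" using x by (auto simp: nonzero_N)
  have e: "e \<in> nonzero E" "S \<subseteq> \<RR> e" using eS by (auto simp: adm_def)
  have sub: "\<RR> e \<subseteq> Pow (carrier E)" using coverD(2)[OF e(1)] nonzero_closed by blast
  have "inj_on (act E g) (carrier E)" using act_inj[OF g] by (auto simp: inj_on_def)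
  then have "inj_on ?a (\<RR> e)" using inj_on_image_Pow inj_on_subset sub by blast
  \<comment> \<open>Injectivity of g on covers is needed here: otherwise a cover outside S could be
    sent into the image of S.\<close>
  then have diff: "?a ` (\<RR> e - S) = ?a ` \<RR> e - ?a ` S"
    using e by (intro inj_on_image_set_diff[of _ "\<RR> e"]) auto
  have iii: "?a ` \<RR> e = \<RR> (act E g e)" using cond_iii g e by (auto simp: cond_iii_def)
  have "(\<lambda>R. act N g ` R) ` M x = (\<lambda>R. free_act E g ` next_cover E e S R) ` (\<RR> e - S)"
    unfolding eS(3) next_covers_el[OF eS(1,2)] by (simp add: image_image)
  also have "\<dots> = (\<lambda>R. next_cover E (act E g e) (?a ` S) (?a R)) ` (\<RR> e - S)"
    using act_next_cover[OF g eS(1,2)] by (intro image_cong) auto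
  also have "\<dots> = next_cover E (act E g e) (?a ` S) ` (?a ` \<RR> e - ?a ` S)"
    by (simp add: image_image flip: diff)
  also have "\<dots> = M (act N g x)"
    unfolding iii eS(3) N_sel free_act_el[OF g eS(1)]
    using next_covers_el[OF act_adm[OF g eS(1)]] eS(2) by simp
  finally show "(\<lambda>R. act N g ` R) ` M x = M (act N g x)" .
qed

text \<open>If f lies below a maximal member m of R, then f e(S) lies below m e(S). So a maximal
  member of the second kind can be written with a maximal f.\<close>

lemma max_next_cover:
  assumes "adm E \<RR> e S" "S \<noteq> {}" "R \<in> \<RR> e" "q \<in> max_elts N (next_cover E e S R)"
  shows "q = el E e (insert R S) \<or> (\<exists>f\<in>max_elts E R. q = free_mult E (frag_of f) (el E e S))"
proof (rule ccontr)
  assume neg: "\<not> ?thesis"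
  have R: "finite R" "R \<subseteq> nonzero E" using coverD(1,2)[of e R] assms by (auto simp: adm_def)
  have X: "el E e S \<in> carrier N" using el_N assms N_closed by blast
  have q: "q \<in> next_cover E e S R" "\<And>k. k \<in> next_cover E e S R \<Longrightarrow> sl_le N q k \<Longrightarrow> k = q"
    using assms(4) by (auto simp: max_elts_def)
  then obtain f where f: "f \<in> R" "q = free_mult E (frag_of f) (el E e S)" "q \<noteq> 0"
    using neg by (auto simp: next_cover_el[OF assms(2)])
  obtain m where m: "m \<in> max_elts E R" "sl_le E f m" using max_elts_above[OF R f(1)] by blast
  let ?k = "free_mult E (frag_of m) (el E e S)"
  have mR: "m \<in> R" "m \<in> nonzero E" "f \<in> nonzero E" using m f R by (auto simp: max_elts_def)
  have k: "?k \<in> carrier N" "q \<in> carrier N" using frag_mult_N X mR f by auto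
  have le: "sl_le N q ?k"
    unfolding le_N_iff[OF k(2,1)]
    using m(2) f mR X le_trans[of _ f m] nonzero_closed by (auto simp: pt_frag_mult)
  then have "?k \<noteq> 0" using f(3) by (auto simp: sl_le_def)
  then have "?k \<in> next_cover E e S R" using mR by (auto simp: next_cover_el[OF assms(2)])
  then have "?k = q" using q le by blast
  then show False using neg m by blast
qed

text \<open>Each factor is of one of two kinds. A factor with R added to S puts R into B; a factor f
  e(S) with f maximal in R puts R into A and multiplies d by f. Thus d is again a product of the
  kind controlled by \<open>indep\<close>, built from the covers in A.\<close>

lemma next_cprod:
  assumes "adm E \<RR> e S" "S \<noteq> {}" "cprod N M (el E e S) T x"
  shows "\<exists>A B d. cprod E \<RR> e A d \<and> finite B \<and> B \<subseteq> \<RR> e \<and> A \<subseteq> \<RR> e \<and> (S \<union> B) \<inter> A = {} \<and>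
    x = free_mult E (frag_of d) (el E e (S \<union> B)) \<and> T = next_cover E e S ` (A \<union> B)"
  using assms(3)
proof induction
  case base
  have "free_mult E (frag_of e) (el E e S) = el E e S"
    using assms(1) keys_el[OF assms(1)]
    by (intro free_alg_eqI free_mult_closed)
      (auto simp: lin_free_mult is_char_le lin_el adm_def)
  then show ?case using cprod.base[of E \<RR> e]
    by (intro exI[of _ "{}"] exI[of _ e]) auto
next
  case (step T x Q q)
  then obtain A B d where IH: "cprod E \<RR> e A d" "finite B" "B \<subseteq> \<RR> e" "A \<subseteq> \<RR> e" "(S \<union> B) \<inter> A = {}"
    "x = free_mult E (frag_of d) (el E e (S \<union> B))" "T = next_cover E e S ` (A \<union> B)" by blast
  have e: "e \<in> nonzero E" using assms(1) by (simp add: adm_def)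
  obtain R where R: "R \<in> \<RR> e" "R \<notin> S" "Q = next_cover E e S R"
    using step.hyps(2) unfolding next_covers_el[OF assms(1,2)] by blast
  have RAB: "R \<notin> A \<union> B" using step.hyps(3) R(3) IH(7) by blast
  have a: "adm E \<RR> e (S \<union> B)" "adm E \<RR> e (insert R (S \<union> B))" "adm E \<RR> e (insert R S)"
    using assms(1) IH R by (auto simp: adm_def)
  have d: "d \<in> nonzero E" using cprod_nonzero[OF IH(1) e] coverD(2)[OF e] by blast
  have nz: "free_mult E x q \<noteq> 0" using step.hyps(5) by simp
  have k: "Poly_Mapping.keys (el E e (S \<union> B)) \<subseteq> nonzero E" "Poly_Mapping.keys (frag_of d) \<subseteq> nonzero E"
    "Poly_Mapping.keys (el E e S) \<subseteq> nonzero E" "Poly_Mapping.keys (el E e (insert R S)) \<subseteq> nonzero E"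
    "Poly_Mapping.keys (el E e (insert R (S \<union> B))) \<subseteq> nonzero E"
    using keys_el a assms d by auto
  consider "q = el E e (insert R S)"
    | f where "f \<in> max_elts E R" "q = free_mult E (frag_of f) (el E e S)"
    using max_next_cover[OF assms(1,2) R(1)] step.hyps(4) R(3) by blast
  then show ?case
  proof cases
    case 1
    have "free_mult E x q = free_mult E (frag_of d) (el E e (insert R (S \<union> B)))"
      unfolding IH(6) 1 using k a
      by (intro free_alg_eqI free_mult_closed) (auto simp: lin_free_mult is_char_le lin_el free_mult_closed)
    then show ?thesis
      using IH R RAB by (intro exI[of _ A] exI[of _ "insert R B"] exI[of _ d]) auto
  next
    case (2 f)
    have f: "f \<in> nonzero E" using 2 coverD(2)[OF e R(1)] by (auto simp: max_elts_def)
    have c: "d \<in> carrier E" "f \<in> carrier E" using d f nonzero_closed by auto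
    \<comment> \<open>\<open>cprod\<close> demands that d f be nonzero. A point of the nonzero
      product lies below both d and f and shows this.\<close>
    have "\<exists>y\<in>nonzero E. pt E y (free_mult E x q)"
    proof (rule ccontr)
      assume "\<not> ?thesis"
      then have "free_mult E x q = 0"
        unfolding IH(6) 2(2) pt_def using k f by (intro lin_le_eq_zeroD free_mult_closed) auto
      then show False using nz by simp
    qed
    then obtain y where y: "y \<in> nonzero E" "pt E y (free_mult E x q)" by blast
    then have "sl_le E y d" "sl_le E y f"
      unfolding IH(6) 2(2) using k f by (auto simp: pt_mult free_mult_closed pt_frag_of)
    then have "sl_le E y (meet E d f)" using le_meet_iff nonzero_closed y c by blast
    then have m: "meet E d f \<in> nonzero E" using nonzero_le y meet_closed c by blast
    then have "cprod E \<RR> e (insert R A) (meet E d f)"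
      using cprod.step[OF IH(1) R(1) _ 2(1)] RAB by (auto simp: nonzero_def)
    moreover have "free_mult E x q = free_mult E (frag_of (meet E d f)) (el E e (S \<union> B))"
      unfolding IH(6) 2(2) using k a m f c assms
      by (intro free_alg_eqI free_mult_closed)
        (auto simp: lin_free_mult is_char_le lin_el free_mult_closed le_meet_iff nonzero_closed)
    ultimately show ?thesis
      using IH R RAB by (intro exI[of _ "insert R A"] exI[of _ B] exI[of _ "meet E d f"]) auto
  qed
qed

text \<open>The product of elements of \<open>E\<close> occurring in an element of \<^const>\<open>cprod\<close> one level up is
  itself a point witnessing that the element is not below a member of a further cover.\<close>

lemma next_indep: "indep N M"
  unfolding indep_def
proof (intro ballI allI impI notI)
  fix X T x Q q
  assume X: "X \<in> nonzero N" and cp: "cprod N M X T x" and Q: "Q \<in> M X" "Q \<notin> T"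
    and q: "q \<in> Q" "sl_le N x q"
  obtain e S where eS: "adm E \<RR> e S" "S \<noteq> {}" "X = el E e S" using X by (auto simp: nonzero_N)
  obtain R where R: "R \<in> \<RR> e" "R \<notin> S" "Q = next_cover E e S R"
    using Q(1) unfolding eS(3) next_covers_el[OF eS(1,2)] by blast
  obtain A B d where AB: "cprod E \<RR> e A d" "finite B" "B \<subseteq> \<RR> e" "A \<subseteq> \<RR> e" "(S \<union> B) \<inter> A = {}"
    "x = free_mult E (frag_of d) (el E e (S \<union> B))" "T = next_cover E e S ` (A \<union> B)"
    using next_cprod[OF eS(1,2) cp[unfolded eS(3)]] by blast
  have RAB: "R \<notin> A \<union> B" using Q(2) R(3) AB(7) by blast
  have e: "e \<in> nonzero E" using eS(1) by (simp add: adm_def)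
  have RE: "finite R" "R \<subseteq> nonzero E" using coverD[OF e R(1)] by auto
  have d: "d \<in> nonzero E" "sl_le E d e" using cprod_nonzero[OF AB(1) e] coverD(2)[OF e] by blast+
  have a: "adm E \<RR> e (S \<union> B)" "adm E \<RR> e (insert R S)" using eS AB R by (auto simp: adm_def)
  have XN: "el E e (S \<union> B) \<in> carrier N" "el E e S \<in> carrier N"
    using el_N a eS N_closed by auto
  have xN: "x \<in> carrier N" unfolding AB(6) using frag_mult_N d XN by blast
  have qN: "q \<in> carrier N" using next_cover_subset[OF eS(1,2) R(1)] q(1) R(3) N_closed by blast
  have ptx: "pt E c x \<longleftrightarrow> sl_le E c d \<and> pt E c (el E e (S \<union> B))" if "c \<in> nonzero E" for c
    using pt_frag_mult[OF d(1) XN(1) that] by (simp only: AB(6))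
  have le: "pt E c q" if "c \<in> nonzero E" "pt E c x" for c
    using q(2) le_N_iff[OF xN qN] that by blast
  from q(1) consider "q = el E e (insert R S)"
    | f where "f \<in> R" "q = free_mult E (frag_of f) (el E e S)"
    unfolding R(3) next_cover_el[OF eS(2)] by blast
  then show False
  proof cases
    case 1
    \<comment> \<open>Here d itself may lie outside all of R. The covering property makes d meet R,
      and for a suitable maximal m the product d m is a point of x below m, whereas no point of q
      lies below a member of R.\<close>
    obtain f where f: "f \<in> R" "meet E d f \<noteq> bot E" using coverD(4)[OF e R(1) d] by blast
    obtain m where m: "m \<in> max_elts E R" "sl_le E f m" using max_elts_above[OF RE f(1)] by blast
    have c: "d \<in> carrier E" "f \<in> carrier E" "m \<in> carrier E" "e \<in> carrier E"
      using d f m RE e nonzero_closed by (auto simp: max_elts_def)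
    have "sl_le E (meet E d f) (meet E d m)"
      using meet_le[OF c(1,2)] m(2) c le_trans[of "meet E d f" f m] meet_closed le_meet_iff[of "meet E d f" d m]
      by auto
    then have dm: "meet E d m \<in> nonzero E"
      using f nonzero_le[of "meet E d f"] meet_closed c by (auto simp: nonzero_def)
    then have cp': "cprod E \<RR> e (insert R A) (meet E d m)"
      using cprod.step[OF AB(1) R(1) _ m(1)] RAB by (auto simp: nonzero_def)
    have "\<not> sl_le E (meet E d m) f" if "R' \<in> S \<union> B" "f \<in> R'" for R' f
      using indepD[OF e cp' _ _ that(2)] that(1) AB R RAB eS(1) by (auto simp: adm_def)
    moreover have "sl_le E (meet E d m) d" "sl_le E (meet E d m) e" "sl_le E (meet E d m) m"
      using meet_le[OF c(1,3)] d le_trans[of "meet E d m" d e] c meet_closed by auto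
    ultimately have "pt E (meet E d m) x"
      unfolding ptx[OF dm] pt_el[OF dm a(1)] by blast
    then have "pt E (meet E d m) q" using le dm by blast
    then have "\<not> sl_le E (meet E d m) m"
      using pt_el[OF dm a(2)] 1 m by (auto simp: max_elts_def)
    then show False using meet_le[OF c(1,3)] by blast
  next
    case (2 f)
    have "\<not> sl_le E d k" if "R' \<in> S \<union> B" "k \<in> R'" for R' k
      using indepD[OF e AB(1) _ _ that(2)] that(1) AB eS(1) by (auto simp: adm_def)
    then have "pt E d x"
      unfolding ptx[OF d(1)] pt_el[OF d(1) a(1)] using d le_refl nonzero_closed by blast
    then have "pt E d q" using le d by blast
    then have "sl_le E d f" using pt_frag_mult[OF _ XN(2) d(1)] 2 RE by blast
    then show False using indepD[OF e AB(1) R(1) _ 2(1)] RAB by blast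
  qed
qed

lemma next_covers: "covers G N M"
  by (intro covers.intro covers_axioms.intro next_gamma_semilattice next_cover_collection
      next_cond_i next_indep next_cond_iii)

end

section \<open>Images and kernels\<close>

definition cover_span :: "('g, 'a) gsl \<Rightarrow> ('a \<Rightarrow> 'a set set) \<Rightarrow> ('a \<Rightarrow>\<^sub>0 int) set" where
  "cover_span E \<RR> = frag_extend id ` {z. Poly_Mapping.keys z \<subseteq> nonzero (next_sl E \<RR>)}"

lemma cover_span_zero: "0 \<in> cover_span E \<RR>"
  unfolding cover_span_def by (rule image_eqI[of _ _ 0]) auto

lemma cover_span_diff:
  assumes "x \<in> cover_span E \<RR>" "y \<in> cover_span E \<RR>"
  shows "x - y \<in> cover_span E \<RR>"
proof -
  obtain a b where "x = frag_extend id a" "Poly_Mapping.keys a \<subseteq> nonzero (next_sl E \<RR>)"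
    "y = frag_extend id b" "Poly_Mapping.keys b \<subseteq> nonzero (next_sl E \<RR>)"
    using assms by (auto simp: cover_span_def)
  then show ?thesis
    unfolding cover_span_def
    by (intro image_eqI[of _ _ "a - b"]) (auto simp: frag_extend_diff dest: keys_diff_subset[THEN subsetD])
qed

lemma cover_span_add:
  assumes "x \<in> cover_span E \<RR>" "y \<in> cover_span E \<RR>"
  shows "x + y \<in> cover_span E \<RR>"
  using cover_span_diff[OF assms(1) cover_span_diff[OF cover_span_zero assms(2)]] by simp

lemma cover_span_basis: "x \<in> nonzero (next_sl E \<RR>) \<Longrightarrow> x \<in> cover_span E \<RR>"
  unfolding cover_span_def by (rule image_eqI[of _ _ "frag_of x"]) auto

section \<open>Subgroups of the free algebra\<close>

lemma free_alg_sel [simp]: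
  "carrier (free_alg E) = {x. Poly_Mapping.keys x \<subseteq> nonzero E}"
  "mult (free_alg E) = free_mult E" "zero (free_alg E) = 0" "add (free_alg E) = (+)"
  by (simp_all add: free_alg_def)

lemma abelian_group_free_alg: "abelian_group (free_alg E)"
proof (rule abelian_groupI)
  fix x assume "x \<in> carrier (free_alg E)"
  then show "\<exists>y\<in>carrier (free_alg E). y \<oplus>\<^bsub>free_alg E\<^esub> x = \<zero>\<^bsub>free_alg E\<^esub>"
    by (intro bexI[of _ "- x"]) auto
qed (auto simp: keys_sub_diff add.assoc add.commute)

lemma a_inv_free_alg:
  assumes "Poly_Mapping.keys x \<subseteq> nonzero E"
  shows "a_inv (free_alg E) x = - x"
proof -
  interpret abelian_group "free_alg E" by (rule abelian_group_free_alg)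
  show ?thesis by (rule minus_equality) (use assms in auto)
qed

lemma additive_subgroup_free_alg_iff:
  "additive_subgroup I (free_alg E) \<longleftrightarrow>
    I \<subseteq> {x. Poly_Mapping.keys x \<subseteq> nonzero E} \<and> 0 \<in> I \<and> (\<forall>x\<in>I. \<forall>y\<in>I. x - y \<in> I)"
proof
  interpret abelian_group "free_alg E" by (rule abelian_group_free_alg)
  {
    assume "additive_subgroup I (free_alg E)"
    then interpret additive_subgroup I "free_alg E" .
    have sub: "I \<subseteq> {x. Poly_Mapping.keys x \<subseteq> nonzero E}" using a_subset by simp
    have "x - y \<in> I" if "x \<in> I" "y \<in> I" for x y
      using a_closed[OF that(1) a_inv_closed[OF that(2)]] that sub
      by (simp add: a_inv_free_alg subset_iff)
    then show "I \<subseteq> {x. Poly_Mapping.keys x \<subseteq> nonzero E} \<and> 0 \<in> I \<and> (\<forall>x\<in>I. \<forall>y\<in>I. x - y \<in> I)"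
      using sub zero_closed by auto
  next
    assume I: "I \<subseteq> {x. Poly_Mapping.keys x \<subseteq> nonzero E} \<and> 0 \<in> I \<and> (\<forall>x\<in>I. \<forall>y\<in>I. x - y \<in> I)"
    then have neg: "- x \<in> I" if "x \<in> I" for x
      using that by (metis diff_0)
    then have "x + y \<in> I" if "x \<in> I" "y \<in> I" for x y
      using I that by (metis diff_minus_eq_add)
    then show "additive_subgroup I (free_alg E)"
      using I neg a_inv_free_alg[of _ E, unfolded a_inv_def]
      by (intro additive_subgroup.intro subgroup.intro) (simp_all add: subset_iff)
  }
qed

context gamma_semilattice
begin

text \<open>If F is finite and closed under meets, it stays so after adding x and all products of x
  with members of F.\<close>

lemma finite_subsemilattice:
  assumes "finite X" "X \<subseteq> carrier E"
  shows "\<exists>F. finite F \<and> X \<subseteq> F \<and> F \<subseteq> carrier E \<and> (\<forall>e\<in>F. \<forall>f\<in>F. meet E e f \<in> F)"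
  using assms
proof (induction X rule: finite_induct)
  case empty
  show ?case by (rule exI[of _ "{}"]) auto
next
  case (insert x X)
  then have "\<exists>F. finite F \<and> X \<subseteq> F \<and> F \<subseteq> carrier E \<and> (\<forall>e\<in>F. \<forall>f\<in>F. meet E e f \<in> F)"
    by simp
  then obtain F where F: "finite F" "X \<subseteq> F" "F \<subseteq> carrier E"
    and FF: "\<forall>e\<in>F. \<forall>f\<in>F. meet E e f \<in> F"
    by blast
  have x: "x \<in> carrier E" using insert by auto
  let ?F = "insert x (F \<union> meet E x ` F)"
  have a: "meet E x (meet E x f) = meet E x f" if "f \<in> F" for f
    using that F x meet_assoc[of x x f] meet_idem by auto
  have b: "meet E e (meet E x f) = meet E x (meet E e f)" if "e \<in> F" "f \<in> F" for e f
  proof -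
    have ef: "e \<in> carrier E" "f \<in> carrier E" using that F(3) by auto
    have "meet E e (meet E x f) = meet E (meet E e x) f" using ef x meet_assoc by simp
    also have "\<dots> = meet E x (meet E e f)" using ef x meet_assoc by (simp add: meet_comm[of e x])
    finally show ?thesis .
  qed
  have c: "meet E (meet E x e) y = meet E y (meet E x e)" if "e \<in> F" "y \<in> carrier E" for e y
    using that F(3) x meet_closed meet_comm by blast
  have d: "meet E (meet E x e) (meet E x f) = meet E x (meet E e f)" if "e \<in> F" "f \<in> F" for e f
    using that F(3) a FF b[OF that] x meet_assoc[of x e "meet E x f"] meet_closed by (auto simp: subset_iff)
  have "meet E e f \<in> ?F" if "e \<in> ?F" "f \<in> ?F" for e f
  proof -
    have m: "meet E f x = meet E x f" if "f \<in> F" for f using that F x meet_comm by auto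
    show ?thesis
      using that F(3) FF x by (auto simp: a b c d m meet_idem subset_iff)
  qed
  moreover have "finite ?F" "insert x X \<subseteq> ?F" "?F \<subseteq> carrier E"
    using F x meet_closed by auto
  ultimately show ?case by blast
qed

end

context covers
begin

text \<open>Evaluating the image of y at d is evaluating y itself at the character
  \<open>pt E d\<close>, because the basis elements of y are 0/1-valued at d.\<close>

lemma lin_frag_extend_id:
  assumes "Poly_Mapping.keys y \<subseteq> nonzero N" "d \<in> nonzero E"
  shows "lin (sl_le E d) (frag_extend id y) = lin (pt E d) y"
  using assms(1)
  by (induction y rule: frag_induction) (auto simp: frag_extend_diff lin_diff lin_N N_closed assms(2))

lemma keys_frag_extend_id:
  "Poly_Mapping.keys y \<subseteq> nonzero N \<Longrightarrow> Poly_Mapping.keys (frag_extend id y) \<subseteq> nonzero E"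
  by (rule keys_frag_extend_sub) (auto dest: keys_N[OF N_closed])

lemma keys_cover_span: "x \<in> cover_span E \<RR> \<Longrightarrow> Poly_Mapping.keys x \<subseteq> nonzero E"
  using keys_frag_extend_id by (auto simp: cover_span_def)

text \<open>The product of a basis element with an element of the next semilattice is zero or again
  in that semilattice, so the span absorbs multiplication.\<close>

lemma cover_span_mult:
  assumes "Poly_Mapping.keys a \<subseteq> nonzero E" "x \<in> cover_span E \<RR>"
  shows "free_mult E a x \<in> cover_span E \<RR>"
proof -
  obtain z where z: "Poly_Mapping.keys z \<subseteq> nonzero N" "x = frag_extend id z"
    using assms(2) by (auto simp: cover_span_def)
  have "free_mult E a (frag_extend id z) \<in> cover_span E \<RR>"
    using assms(1) z(1)
  proof (induction a z rule: bilinear_induct)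
    case (basis d y)
    then have "free_mult E (frag_of d) y \<in> carrier N" using frag_mult_N N_closed by blast
    then consider "free_mult E (frag_of d) y = 0" | "free_mult E (frag_of d) y \<in> nonzero N"
      by (auto simp: nonzero_def)
    then show ?case
    proof cases
      case 1
      then show ?thesis by (simp add: cover_span_zero)
    next
      case 2
      then show ?thesis by (simp add: cover_span_basis)
    qed
  qed (auto simp: free_mult_diff_left free_mult_diff_right frag_extend_diff
      intro: cover_span_diff cover_span_zero)
  then show ?thesis using z by simp
qed

lemma alg_ideal_cover_span: "alg_ideal (cover_span E \<RR>) (free_alg E)"
proof -
  have "additive_subgroup (cover_span E \<RR>) (free_alg E)"
    unfolding additive_subgroup_free_alg_iff
    using keys_cover_span cover_span_diff cover_span_zero by blast
  moreover have "free_mult E x a = free_mult E a x"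
    if "Poly_Mapping.keys a \<subseteq> nonzero E" "x \<in> cover_span E \<RR>" for a x
    using free_mult_comm[OF keys_cover_span[OF that(2)] that(1)] .
  ultimately show ?thesis
    unfolding alg_ideal_def using cover_span_mult by simp
qed

text \<open>The generators of the ideal are the elements e({R}), which lie in the span, and the span
  is an ideal. Conversely each e(S) is a product of generators.\<close>

lemma cover_ideal_eq: "cover_ideal E \<RR> = cover_span E \<RR>"
proof
  have "cover_diff E e R \<in> cover_span E \<RR>" if "e \<in> nonzero E" "R \<in> \<RR> e" for e R
    using that el_N[of e "{R}"] cover_span_basis[of "el E e {R}" E \<RR>]
    by (simp add: adm_def el_def cover_prod_def set_prod_singleton)
  then show "cover_ideal E \<RR> \<subseteq> cover_span E \<RR>"
    unfolding cover_ideal_def gen_alg_ideal_def using alg_ideal_cover_span by blast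
next
  have "x \<in> I" if x: "x \<in> cover_span E \<RR>" and I: "alg_ideal I (free_alg E)"
    and gen: "{cover_diff E e R | e R. e \<in> nonzero E \<and> R \<in> \<RR> e} \<subseteq> I" for x I
  proof -
    have I0: "0 \<in> I" "\<And>x y. x \<in> I \<Longrightarrow> y \<in> I \<Longrightarrow> x - y \<in> I"
      and Im: "\<And>a x. Poly_Mapping.keys a \<subseteq> nonzero E \<Longrightarrow> x \<in> I \<Longrightarrow> free_mult E a x \<in> I"
      using I unfolding alg_ideal_def additive_subgroup_free_alg_iff by auto
    have el: "set_prod (free_mult E) (cover_diff E e) S \<in> I"
      if "finite S" "S \<noteq> {}" "S \<subseteq> \<RR> e" "e \<in> nonzero E" for e S
      using that
    proof (induction S rule: finite_ne_induct)
      case (singleton R)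
      then show ?case using gen by (auto simp: set_prod_singleton)
    next
      case (insert R S)
      then have "Poly_Mapping.keys (cover_diff E e R') \<subseteq> nonzero E" if "R' \<in> insert R S" for R'
        using that keys_cover_diff by blast
      then show ?case
        using insert Im by (subst set_prod_free_mult_insert) auto
    qed
    obtain z where z: "Poly_Mapping.keys z \<subseteq> nonzero N" "x = frag_extend id z"
      using x by (auto simp: cover_span_def)
    have NI: "y \<in> I" if y: "y \<in> nonzero N" for y
    proof -
      obtain e S where "adm E \<RR> e S" "S \<noteq> {}" "y = el E e S" using y by (auto simp: nonzero_N)
      then show ?thesis using el[of S e] by (simp add: adm_def el_def cover_prod_def)
    qed
    have "frag_extend id z \<in> I"
      using z(1) by (induction z rule: frag_induction) (use I0 NI in \<open>auto simp: frag_extend_diff\<close>)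
    then show ?thesis using z by simp
  qed
  then show "cover_span E \<RR> \<subseteq> cover_ideal E \<RR>"
    unfolding cover_ideal_def gen_alg_ideal_def by blast
qed

section \<open>The kernel of the induced map\<close>

lemma is_char_pt: "d \<in> nonzero E \<Longrightarrow> is_char N (pt E d)"
  using pt_N_mult by (auto simp: is_char_def)

text \<open>By \<open>pt_next_cover\<close> a point of x is a point of some member of every cover of
  x. So every element built from x and a non-empty set of its covers vanishes under all characters
  \<open>pt E d\<close>.\<close>

lemma frag_extend_id_cover_span:
  assumes "y \<in> cover_span N M"
  shows "frag_extend id y = 0"
proof -
  interpret nx: covers G N M by (rule next_covers)
  obtain z where z: "Poly_Mapping.keys z \<subseteq> nonzero nx.N" "y = frag_extend id z"
    using assms by (auto simp: cover_span_def)
  have basis: "frag_extend id y = 0" if "y \<in> nonzero nx.N" for y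
  proof -
    obtain x T where xT: "adm N M x T" "T \<noteq> {}" "y = el N x T" using \<open>y \<in> nonzero nx.N\<close>
      by (auto simp: nx.nonzero_N)
    obtain e S where eS: "adm E \<RR> e S" "S \<noteq> {}" "x = el E e S"
      using xT(1) by (auto simp: nonzero_N adm_def)
    have ky: "Poly_Mapping.keys y \<subseteq> nonzero N" using nx.keys_el xT by blast
    show ?thesis
    proof (rule lin_le_eq_zeroD[OF keys_frag_extend_id[OF ky]])
      fix d assume d: "d \<in> nonzero E"
      have no: "\<not> (pt E d x \<and> (\<forall>Q\<in>T. \<forall>q\<in>Q. \<not> pt E d q))"
      proof
        assume p: "pt E d x \<and> (\<forall>Q\<in>T. \<forall>q\<in>Q. \<not> pt E d q)"
        obtain Q where Q: "Q \<in> T" using xT by auto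
        then have "Q \<in> M x" using xT(1) by (auto simp: adm_def)
        then obtain R where R: "R \<in> \<RR> e" "Q = next_cover E e S R"
          unfolding eS(3) next_covers_el[OF eS(1,2)] by blast
        show False using pt_next_cover[OF eS(1,2) R(1) d] p Q R(2) eS(3) by blast
      qed
      have "lin (pt E d) (el N x T) = 0"
        unfolding nx.lin_el[OF is_char_pt[OF d] xT(1)] of_bool_eq_0_iff by (rule no)
      then show "lin (sl_le E d) (frag_extend id y) = 0"
        using lin_frag_extend_id[OF ky d] xT(3) by simp
    qed
  qed
  have "frag_extend id (frag_extend id z) = 0"
    using z(1)
  proof (induction z rule: frag_induction)
    case (one x)
    have "frag_extend id (frag_of x) = x" by simp
    then show ?case using basis[OF one] by (simp only:)
  qed (simp_all only: frag_extend_diff frag_extend_0 diff_self)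
  then show ?thesis using z by simp
qed

text \<open>For a finite subsemilattice F and a subset U absorbing products with F, this is a finite
  set closed under nonzero products. In the kernel argument F stays fixed and bounds the covers,
  while U bounds the base elements and shrinks.\<close>

definition NF :: "'a set \<Rightarrow> 'a set \<Rightarrow> ('a \<Rightarrow>\<^sub>0 int) set" where
  "NF F U = {el E e S | e S. e \<in> U \<and> adm E \<RR> e S \<and> S \<noteq> {} \<and> \<Union>S \<subseteq> F}"

lemma NF_subset: "NF F U \<subseteq> nonzero N"
  using el_N by (auto simp: NF_def)

lemma NF_mult:
  assumes F: "\<And>e f. e \<in> F \<Longrightarrow> f \<in> F \<Longrightarrow> meet E e f \<in> F"
    and U: "U \<subseteq> F" "\<And>e f. e \<in> U \<Longrightarrow> f \<in> F \<Longrightarrow> meet E e f \<in> U"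
    and "x \<in> NF F U" "y \<in> NF F U" "free_mult E x y \<noteq> 0"
  shows "free_mult E x y \<in> NF F U"
proof -
  obtain e S where eS: "e \<in> U" "adm E \<RR> e S" "S \<noteq> {}" "\<Union>S \<subseteq> F" "x = el E e S"
    using assms by (auto simp: NF_def)
  obtain d T where dT: "d \<in> U" "adm E \<RR> d T" "T \<noteq> {}" "\<Union>T \<subseteq> F" "y = el E d T"
    using assms by (auto simp: NF_def)
  have "restr E d R \<subseteq> F" if "R \<in> S" for R
    using that eS(4) dT(1) F U(1) unfolding restr_def by blast
  moreover have "restr E e R \<subseteq> F" if "R \<in> T" for R
    using that dT(4) eS(1) F U(1) unfolding restr_def by blast
  ultimately have "\<Union>(restr E d ` S \<union> restr E e ` T) \<subseteq> F" by blast
  moreover have "meet E e d \<in> U" using eS dT U by blast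
  ultimately show ?thesis
    using el_mult[OF eS(2) dT(2)] assms(6) eS(3) unfolding eS(5) dT(5) NF_def by blast
qed

text \<open>Membership in U is asked of f e instead of e, because in the descent e is the element
  that has just been removed from U.\<close>

lemma frag_mult_NF:
  assumes F: "\<And>e f. e \<in> F \<Longrightarrow> f \<in> F \<Longrightarrow> meet E e f \<in> F"
    and "f \<in> F" "f \<in> nonzero E" "meet E f e \<in> U" "adm E \<RR> e S" "S \<noteq> {}" "\<Union>S \<subseteq> F"
    "free_mult E (frag_of f) (el E e S) \<noteq> 0"
  shows "free_mult E (frag_of f) (el E e S) \<in> NF F U"
proof -
  have f: "adm E \<RR> f {}" "frag_of f = el E f {}" using assms by (auto simp: adm_def el_def)
  have "\<Union>(restr E e ` {} \<union> restr E f ` S) \<subseteq> F"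
    using assms(2,7) F by (auto simp: restr_def)
  then show ?thesis
    using el_mult[OF f(1) assms(5)] assms(4,6,8) unfolding f(2) NF_def by blast
qed

text \<open>The join of the cover Q of e(S) given by R is the element with R added to S plus the
  join of the elements f e(S), as the two parts have no common points. So s is e(S) minus the join
  of Q, and z is the join of the f e(S), whose base elements f e lie in U.\<close>

lemma insert_cover_mod_span:
  assumes F: "\<And>e f. e \<in> F \<Longrightarrow> f \<in> F \<Longrightarrow> meet E e f \<in> F"
    and U: "U \<subseteq> F" "\<And>e f. e \<in> U \<Longrightarrow> f \<in> F \<Longrightarrow> meet E e f \<in> U"
    and e: "e \<in> F" "adm E \<RR> e S" "S \<noteq> {}" "\<Union>S \<subseteq> F"
    and R: "R \<in> \<RR> e" "R \<subseteq> U"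
  shows "\<exists>s z. frag_of (el E e S) = frag_of (el E e (insert R S)) + s + z \<and>
    s \<in> cover_span N M \<and> Poly_Mapping.keys z \<subseteq> NF F U"
proof (cases "R \<in> S")
  case True
  then have "insert R S = S" by auto
  then show ?thesis using cover_span_zero by (intro exI[of _ 0]) auto
next
  case False
  interpret nx: covers G N M by (rule next_covers)
  let ?x = "el E e S" and ?a = "el E e (insert R S)"
  let ?Q = "next_cover E e S R"
  define Q0 where "Q0 = {free_mult E (frag_of f) ?x | f. f \<in> R \<and> free_mult E (frag_of f) ?x \<noteq> 0}"
  have Q: "?Q = insert ?a Q0" unfolding Q0_def by (rule next_cover_el[OF e(3)])
  have en: "e \<in> nonzero E" using e by (auto simp: adm_def)
  have RE: "R \<subseteq> nonzero E" using coverD(2)[OF en R(1)] .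
  have xn: "?x \<in> nonzero N" using el_N e by blast
  have QM: "?Q \<in> M ?x" unfolding next_covers_el[OF e(2,3)] using R False by blast
  have fQ: "finite ?Q" "?Q \<subseteq> nonzero N" using nx.coverD[OF xn QM] by auto
  have Q0: "Q0 \<subseteq> NF F U"
  proof
    fix q assume "q \<in> Q0"
    then obtain f where f: "f \<in> R" "q = free_mult E (frag_of f) ?x" "q \<noteq> 0" unfolding Q0_def by auto
    have "meet E f e \<in> U" using f R U e by blast
    then show "q \<in> NF F U" using frag_mult_NF[OF F, of f e U S] f R U e RE by blast
  qed
  \<comment> \<open>A nonzero element below both parts would have a point lying below some f in R
    and below no member of R.\<close>
  have dis: "\<not> (sl_le N c ?a \<and> (\<exists>q\<in>Q0. sl_le N c q))" if c: "c \<in> nonzero N" for c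
  proof
    assume "sl_le N c ?a \<and> (\<exists>q\<in>Q0. sl_le N c q)"
    then obtain q where q: "sl_le N c ?a" "q \<in> Q0" "sl_le N c q" by blast
    obtain d where d: "d \<in> nonzero E" "pt E d c" using N_nonzero_iff[OF N_closed[OF c]] c by blast
    have "?a \<in> carrier N" "q \<in> carrier N" using fQ(2) Q q N_closed by auto
    then have "pt E d ?a" "pt E d q" using le_N_iff[OF N_closed[OF c]] q d by blast+
    moreover obtain f where "f \<in> R" "q = free_mult E (frag_of f) ?x" using q unfolding Q0_def by auto
    ultimately show False
      using pt_el[OF d(1) adm_insert[OF e(2) R(1)]] pt_frag_mult[OF _ N_closed[OF xn] d(1), of f] RE
      by blast
  qed
  have fQ0: "finite Q0" "Q0 \<subseteq> nonzero N" "?a \<in> nonzero N" using fQ Q by auto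
  have "join N ?Q = frag_of ?a + join N Q0"
  proof (rule nx.free_alg_eqI)
    show "Poly_Mapping.keys (join N ?Q) \<subseteq> nonzero N" by (rule nx.keys_join[OF fQ])
    show "Poly_Mapping.keys (frag_of ?a + join N Q0) \<subseteq> nonzero N"
      using nx.keys_join[OF fQ0(1,2)] fQ0(3) by (intro keys_sub_diff) auto
    fix c assume c: "c \<in> nonzero N"
    show "lin (sl_le N c) (join N ?Q) = lin (sl_le N c) (frag_of ?a + join N Q0)"
      unfolding lin_add nx.lin_join[OF nx.is_char_le[OF c] fQ] nx.lin_join[OF nx.is_char_le[OF c] fQ0(1,2)]
      using dis[OF c] unfolding Q by auto
  qed
  then have "frag_of ?x = frag_of ?a + cover_diff N ?x ?Q + join N Q0"
    by (simp add: cover_diff_def)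
  moreover have "cover_diff N ?x ?Q \<in> cover_span N M"
  proof -
    have "adm N M ?x {?Q}" using xn QM by (simp add: adm_def)
    then have "el N ?x {?Q} \<in> nonzero nx.N" using nx.el_N by blast
    then show ?thesis
      using cover_span_basis[of _ N M] by (simp add: el_def cover_prod_def set_prod_singleton)
  qed
  moreover have "Poly_Mapping.keys (join N Q0) \<subseteq> NF F U"
    using NF_mult[OF F U] by (intro nx.keys_join_subset fQ0 Q0 NF_subset) auto
  ultimately show ?thesis by blast
qed

lemma add_covers_mod_span:
  assumes F: "\<And>e f. e \<in> F \<Longrightarrow> f \<in> F \<Longrightarrow> meet E e f \<in> F"
    and U: "U \<subseteq> F" "\<And>e f. e \<in> U \<Longrightarrow> f \<in> F \<Longrightarrow> meet E e f \<in> U"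
    and e: "e \<in> F" "adm E \<RR> e S" "S \<noteq> {}" "\<Union>S \<subseteq> F"
    and T: "finite T" "T \<subseteq> \<RR> e" "\<Union>T \<subseteq> U"
  shows "\<exists>s z. frag_of (el E e S) = frag_of (el E e (T \<union> S)) + s + z \<and>
    s \<in> cover_span N M \<and> Poly_Mapping.keys z \<subseteq> NF F U"
  using T
proof (induction T rule: finite_induct)
  case empty
  then show ?case using cover_span_zero by (intro exI[of _ 0]) auto
next
  case (insert R T)
  then obtain s z where 1: "frag_of (el E e S) = frag_of (el E e (T \<union> S)) + s + z"
    "s \<in> cover_span N M" "Poly_Mapping.keys z \<subseteq> NF F U" by auto
  have "adm E \<RR> e (T \<union> S)" "T \<union> S \<noteq> {}" "\<Union>(T \<union> S) \<subseteq> F" "R \<in> \<RR> e" "R \<subseteq> U"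
    using insert e U by (auto simp: adm_def)
  from insert_cover_mod_span[OF F U e(1) this]
  obtain s' z' where 2: "frag_of (el E e (T \<union> S)) = frag_of (el E e (insert R (T \<union> S))) + s' + z'"
    "s' \<in> cover_span N M" "Poly_Mapping.keys z' \<subseteq> NF F U" by blast
  have "frag_of (el E e S) = frag_of (el E e (insert R T \<union> S)) + (s + s') + (z + z')"
    unfolding 1(1) 2(1) by (simp add: add_ac)
  moreover have "s + s' \<in> cover_span N M" using 1(2) 2(2) by (rule cover_span_add)
  moreover have "Poly_Mapping.keys (z + z') \<subseteq> NF F U" using 1(3) 2(3) by (rule keys_sub_diff)
  ultimately show ?case by blast
qed

lemma kernel_in_span_aux:
  assumes finF: "finite F" and FE: "F \<subseteq> carrier E"
    and F: "\<And>e f. e \<in> F \<Longrightarrow> f \<in> F \<Longrightarrow> meet E e f \<in> F"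
    and "U \<subseteq> F" "\<And>e f. e \<in> U \<Longrightarrow> f \<in> F \<Longrightarrow> meet E e f \<in> U"
    and "Poly_Mapping.keys y \<subseteq> NF F U" "frag_extend id y = 0"
  shows "y \<in> cover_span N M"
proof -
  have "finite U" using finF assms(4) finite_subset by blast
  then show ?thesis using assms(4-)
  proof (induction U arbitrary: y rule: finite_psubset_induct)
    case (psubset U)
    show ?case
    proof (cases "U \<inter> nonzero E = {}")
      case True
      then have "NF F U = {}" by (auto simp: NF_def adm_def)
      then show ?thesis using psubset.prems(3) cover_span_zero by simp
    next
      case False
      obtain e where e: "e \<in> U" "e \<in> nonzero E"
        "\<And>k. k \<in> U \<Longrightarrow> k \<in> nonzero E \<Longrightarrow> sl_le E e k \<Longrightarrow> k = e"
        using finite_has_maximal[of "U \<inter> nonzero E"] False psubset.hyps(1) nonzero_closed by auto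
      have ec: "e \<in> carrier E" using e nonzero_closed by auto
      let ?U = "U - {e}"
      have U': "?U \<subseteq> F" using psubset.prems by auto
      \<comment> \<open>If d f = e, then d lies above e, and maximality of e forces d = e.\<close>
      have U'': "meet E d f \<in> ?U" if "d \<in> ?U" "f \<in> F" for d f
      proof -
        have c: "d \<in> carrier E" "f \<in> carrier E" using that U' FE by auto
        have "meet E d f \<noteq> e"
        proof
          assume m: "meet E d f = e"
          then have "sl_le E e d" using meet_le c by blast
          then have "d \<in> nonzero E" "sl_le E e d" using e nonzero_le c by blast+
          then show False using e(3) that by blast
        qed
        then show ?thesis using psubset.prems(2) that by blast
      qed
      \<comment> \<open>This set is finite because F is, even if \<open>\<RR> e\<close> is infinite.
        It contains every S occurring in a term e(S) over e, so adding T to S always ends at the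
        common element e(T).\<close>
      define T where "T = {R \<in> \<RR> e. R \<subseteq> F}"
      have T: "finite T" "T \<subseteq> \<RR> e" "\<Union>T \<subseteq> F"
        unfolding T_def using finF by (auto intro: finite_subset[of _ "Pow F"])
      have TU: "\<Union>T \<subseteq> ?U"
      proof
        fix f assume "f \<in> \<Union>T"
        then obtain R where R: "R \<in> \<RR> e" "f \<in> R" "f \<in> F" using T by blast
        have f: "sl_le E f e" "f \<in> nonzero E" "\<not> sl_le E e f"
          using coverD(2,3)[OF e(2) R(1)] not_le_cover[OF e(2) R(1)] R(2) by auto
        then have "meet E e f = f" using meet_comm ec nonzero_closed by (auto simp: sl_le_def)
        then have "f \<in> U" using psubset.prems(2)[OF e(1) R(3)] by simp
        then show "f \<in> ?U" using f(3) le_refl ec by blast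
      qed
      have decomp: "\<exists>m s z. y = frag_cmul m (frag_of (el E e T)) + s + z \<and> s \<in> cover_span N M \<and>
          Poly_Mapping.keys z \<subseteq> NF F ?U \<and> (T = {} \<longrightarrow> m = 0)" if "Poly_Mapping.keys y \<subseteq> NF F U" for y
        using that
      proof (induction y rule: frag_induction)
        case zero
        show ?case using cover_span_zero by (intro exI[of _ 0]) auto
      next
        case (one x)
        then obtain e' S where x: "x = el E e' S" "e' \<in> U" "adm E \<RR> e' S" "S \<noteq> {}" "\<Union>S \<subseteq> F"
          by (auto simp: NF_def)
        show ?case
        proof (cases "e' = e")
          case True
          have ST: "S \<subseteq> T" using x True unfolding T_def adm_def by blast
          then have TS: "T \<union> S = T" "T \<noteq> {}" using x by auto
          have "\<exists>s z. frag_of (el E e S) = frag_of (el E e (T \<union> S)) + s + z \<and>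
              s \<in> cover_span N M \<and> Poly_Mapping.keys z \<subseteq> NF F ?U"
            using add_covers_mod_span[OF F U' U'' _ _ x(4,5) T(1,2) TU] x(2,3) psubset.prems(1) True by blast
          then obtain s z where "frag_of x = frag_cmul 1 (frag_of (el E e T)) + s + z"
            "s \<in> cover_span N M" "Poly_Mapping.keys z \<subseteq> NF F ?U"
            unfolding TS(1) using True x(1) by auto
          then show ?thesis using TS(2) by blast
        next
          case False
          then have "x \<in> NF F ?U" using x by (auto simp: NF_def)
          then show ?thesis
            using cover_span_zero by (intro exI[of _ 0] exI[of _ "frag_of x"]) auto
        qed
      next
        case (diff a b)
        then obtain m s z m' s' z' where
          "a = frag_cmul m (frag_of (el E e T)) + s + z" "s \<in> cover_span N M"
          "Poly_Mapping.keys z \<subseteq> NF F ?U" "T = {} \<longrightarrow> m = 0"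
          "b = frag_cmul m' (frag_of (el E e T)) + s' + z'" "s' \<in> cover_span N M"
          "Poly_Mapping.keys z' \<subseteq> NF F ?U" "T = {} \<longrightarrow> m' = 0" by blast
        then have "a - b = frag_cmul (m - m') (frag_of (el E e T)) + (s - s') + (z - z')"
          "s - s' \<in> cover_span N M" "Poly_Mapping.keys (z - z') \<subseteq> NF F ?U" "T = {} \<longrightarrow> m - m' = 0"
          using cover_span_diff keys_sub_diff(1) by (simp_all add: frag_cmul_diff_distrib del: minus_frag_cmul)
        then show ?case by blast
      qed
      obtain m s z where y: "y = frag_cmul m (frag_of (el E e T)) + s + z" "s \<in> cover_span N M"
          "Poly_Mapping.keys z \<subseteq> NF F ?U" "T = {} \<longrightarrow> m = 0"
        using decomp[OF psubset.prems(3)] by blast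
      \<comment> \<open>At e the part s has value 0 because it lies in the kernel, and z has value 0
        because no other nonzero element of U lies above e. Only the multiple of e(T), whose value
        at e is 1, remains.\<close>
      have s0: "frag_extend id s = 0" by (rule frag_extend_id_cover_span[OF y(2)])
      interpret nx: covers G N M by (rule next_covers)
      have ks: "Poly_Mapping.keys s \<subseteq> nonzero N" using nx.keys_cover_span y(2) by blast
      have ls: "lin (pt E e) s = 0" using lin_frag_extend_id[OF ks e(2)] s0 by simp
      have lz: "lin (pt E e) z = 0"
      proof (rule ccontr)
        assume "lin (pt E e) z \<noteq> 0"
        then obtain x where "x \<in> NF F ?U" "pt E e x" using lin_nonzeroD y(3) by blast
        then obtain e' S where "e' \<in> ?U" "adm E \<RR> e' S" "pt E e (el E e' S)" by (auto simp: NF_def)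
        then have "e' \<in> nonzero E" "sl_le E e e'" using pt_el[OF e(2)] by (auto simp: adm_def)
        then show False using e(3) \<open>e' \<in> ?U\<close> by blast
      qed
      have ky: "Poly_Mapping.keys y \<subseteq> nonzero N" using psubset.prems(3) NF_subset by blast
      have "lin (pt E e) y = 0" using lin_frag_extend_id[OF ky e(2)] psubset.prems(4) by simp
      then have "m * of_bool (pt E e (el E e T)) = 0"
        unfolding y(1) lin_add lin_cmul ls lz by simp
      moreover have "pt E e (el E e T)" using pt_self T e(2) by (auto simp: adm_def)
      ultimately have m: "m = 0" by simp
      then have "frag_extend id z = 0"
        using psubset.prems(4) unfolding y(1)
        by (simp only: frag_extend_add s0 frag_cmul_zero frag_extend_0 add_0_left)
      then have "z \<in> cover_span N M"
        using psubset.IH[of ?U z] e(1) U' U'' y(3) by blast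
      then show ?thesis using y(1,2) m cover_span_add by simp
    qed
  qed
qed

lemma kernel_eq_cover_span:
  assumes "Poly_Mapping.keys y \<subseteq> nonzero N"
  shows "frag_extend id y = 0 \<longleftrightarrow> y \<in> cover_span N M"
proof
  assume 0: "frag_extend id y = 0"
  have "\<forall>x\<in>Poly_Mapping.keys y. \<exists>e S. adm E \<RR> e S \<and> S \<noteq> {} \<and> x = el E e S"
    using assms nonzero_N by blast
  then obtain e S where eS: "\<And>x. x \<in> Poly_Mapping.keys y \<Longrightarrow> adm E \<RR> (e x) (S x)"
    and eS2: "\<And>x. x \<in> Poly_Mapping.keys y \<Longrightarrow> S x \<noteq> {} \<and> x = el E (e x) (S x)"
    by metis
  \<comment> \<open>X collects all base elements and all members of covers occurring in y. Every
    term of y is then in \<open>NF F F\<close> for the subsemilattice F generated by X, and the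
    descent starts from U = F.\<close>
  define X where "X = (\<Union>x\<in>Poly_Mapping.keys y. insert (e x) (\<Union>(S x)))"
  have c: "finite R" "R \<subseteq> carrier E" if "x \<in> Poly_Mapping.keys y" "R \<in> S x" for x R
    using coverD(1,2)[of "e x" R] eS[OF that(1)] that(2) nonzero_closed by (auto simp: adm_def)
  have "finite (S x)" "e x \<in> carrier E" if "x \<in> Poly_Mapping.keys y" for x
    using eS[OF that] nonzero_closed by (auto simp: adm_def)
  then have "finite X \<and> X \<subseteq> carrier E" unfolding X_def using c
    by (intro conjI finite_UN_I finite_insert[THEN iffD2] finite_Union UN_least insert_subset[THEN iffD2]
        Union_least) auto
  from finite_subsemilattice[OF conjunct1[OF this] conjunct2[OF this]]
  obtain F where F: "finite F" "X \<subseteq> F" "F \<subseteq> carrier E" "\<forall>e\<in>F. \<forall>f\<in>F. meet E e f \<in> F"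
    by (elim exE conjE)
  have "x \<in> NF F F" if "x \<in> Poly_Mapping.keys y" for x
  proof -
    have "e x \<in> F" "\<Union>(S x) \<subseteq> F" using that F(2) unfolding X_def by blast+
    then show ?thesis unfolding NF_def using eS[OF that] eS2[OF that] by blast
  qed
  then have "Poly_Mapping.keys y \<subseteq> NF F F" by (rule subsetI)
  then show "y \<in> cover_span N M"
    by (intro kernel_in_span_aux[OF F(1,3) _ order_refl _ _ 0]) (use F(4) in auto)
qed (rule frag_extend_id_cover_span)

end

section \<open>Transport along injections\<close>

definition frag_map :: "('a \<Rightarrow> 'b) \<Rightarrow> ('a \<Rightarrow>\<^sub>0 int) \<Rightarrow> ('b \<Rightarrow>\<^sub>0 int)" where
  "frag_map h = frag_extend (\<lambda>e. frag_of (h e))"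

lemma frag_map_of [simp]: "frag_map h (frag_of e) = frag_of (h e)"
  by (simp add: frag_map_def)

lemma frag_map_zero [simp]: "frag_map h 0 = 0"
  by (simp add: frag_map_def)

lemma frag_map_diff: "frag_map h (x - y) = frag_map h x - frag_map h y"
  by (simp add: frag_map_def frag_extend_diff)

lemma frag_map_add: "frag_map h (x + y) = frag_map h x + frag_map h y"
  by (simp add: frag_map_def frag_extend_add)

lemma frag_UNIV_induct [case_names zero one diff]:
  fixes x :: "'a \<Rightarrow>\<^sub>0 int"
  assumes "P 0" "\<And>e. P (frag_of e)" "\<And>x y. P x \<Longrightarrow> P y \<Longrightarrow> P (x - y)"
  shows "P x"
proof -
  have "Poly_Mapping.keys x \<subseteq> UNIV" by simp
  then show ?thesis by (induction x rule: frag_induction) (use assms in auto)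
qed

lemma keys_frag_map: "Poly_Mapping.keys x \<subseteq> S \<Longrightarrow> Poly_Mapping.keys (frag_map h x) \<subseteq> h ` S"
  unfolding frag_map_def by (rule keys_frag_extend_sub) auto

lemma frag_extend_frag_map: "frag_extend k (frag_map h z) = frag_extend (\<lambda>e. k (h e)) z"
  by (induction z rule: frag_UNIV_induct) (simp_all add: frag_map_diff frag_extend_diff)

lemma frag_map_frag_extend: "frag_map h (frag_extend k z) = frag_extend (\<lambda>e. frag_map h (k e)) z"
  by (induction z rule: frag_UNIV_induct) (simp_all add: frag_map_diff frag_extend_diff)

lemma lin_frag_map': "lin \<chi> (frag_map h x) = lin (\<lambda>e. \<chi> (h e)) x"
  by (simp add: frag_map_def lin_frag_map)

lemma frag_map_surj:
  assumes "Poly_Mapping.keys y \<subseteq> h ` S"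
  shows "\<exists>z. Poly_Mapping.keys z \<subseteq> S \<and> y = frag_map h z"
  using assms
proof (induction y rule: frag_induction)
  case zero
  show ?case by (rule exI[of _ 0]) simp
next
  case (one y)
  then obtain x where "x \<in> S" "y = h x" by auto
  then show ?case by (intro exI[of _ "frag_of x"]) simp
next
  case (diff a b)
  then show ?case using keys_sub_diff(1) frag_map_diff by metis
qed

lemma frag_map_image:
  "frag_map h ` {z. Poly_Mapping.keys z \<subseteq> S} = {y. Poly_Mapping.keys y \<subseteq> h ` S}"
proof
  show "frag_map h ` {z. Poly_Mapping.keys z \<subseteq> S} \<subseteq> {y. Poly_Mapping.keys y \<subseteq> h ` S}"
    using keys_frag_map[of _ S h] by blast
  show "{y. Poly_Mapping.keys y \<subseteq> h ` S} \<subseteq> frag_map h ` {z. Poly_Mapping.keys z \<subseteq> S}"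
    using frag_map_surj[of _ h S] by blast
qed

lemma frag_map_inv:
  assumes "inj h"
  shows "frag_extend (\<lambda>b. frag_of (inv_into UNIV h b)) (frag_map h x) = x"
  using assms frag_expansion[of x] by (simp add: frag_extend_frag_map)

locale covers_transport = covers G E \<RR>
  for G :: "('g, 'm) monoid_scheme" and E :: "('g, 'a) gsl" and \<RR> :: "'a \<Rightarrow> 'a set set" +
  fixes h :: "'a \<Rightarrow> 'b"
  assumes inj_h: "inj h"
begin

abbreviation "E' \<equiv> transport_sl h E"
abbreviation "\<RR>' \<equiv> transport_covers h \<RR>"

lemma inv_h [simp]: "inv_into UNIV h (h x) = x"
  using inj_h by simp

lemma h_eq [simp]: "h x = h y \<longleftrightarrow> x = y"
  using inj_h by (simp add: inj_eq)

lemma tr_sel [simp]: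
  "carrier E' = h ` carrier E" "meet E' (h x) (h y) = h (meet E x y)" "bot E' = h (bot E)"
  "act E' g (h x) = h (act E g x)" "\<RR>' (h x) = (`) h ` \<RR> x"
  by (simp_all add: transport_sl_def transport_covers_def)

lemma tr_nonzero: "nonzero E' = h ` nonzero E"
  by (auto simp: nonzero_def)

lemma tr_le [simp]: "sl_le E' (h x) (h y) \<longleftrightarrow> sl_le E x y"
  by (simp add: sl_le_def)

lemma tr_gamma_semilattice: "gamma_semilattice G E'"
proof (rule gamma_semilattice.intro)
  show "group_action G (carrier E') (\<lambda>g. restrict (act E' g) (carrier E'))"
    using act_closed act_one act_mult by (intro group_actionI[OF group_G]) auto
  show "meet E' x y = meet E' y x" if "x \<in> carrier E'" "y \<in> carrier E'" for x y
    using that meet_comm by auto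
qed (use group_G bot_closed in \<open>auto simp: meet_closed meet_assoc meet_idem bot_meet act_meet\<close>)

lemma tr_max_elts: "max_elts E' (h ` R) = h ` max_elts E R"
  by (auto simp: max_elts_def)

lemma tr_cprod:
  assumes "cprod E' \<RR>' (h e) S' d'"
  shows "\<exists>S d. S' = (`) h ` S \<and> d' = h d \<and> cprod E \<RR> e S d"
  using assms
proof induction
  case base
  show ?case using cprod.base by (intro exI[of _ "{}"] exI[of _ e]) auto
next
  case (step S' d' R' f')
  then obtain S d where IH: "S' = (`) h ` S" "d' = h d" "cprod E \<RR> e S d" by blast
  obtain R where R: "R \<in> \<RR> e" "R' = h ` R" using step by auto
  obtain f where f: "f \<in> max_elts E R" "f' = h f" using step R tr_max_elts by auto
  have "cprod E \<RR> e (insert R S) (meet E d f)"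
    using step IH R f by (intro cprod.step) auto
  then show ?case using IH R f by (intro exI[of _ "insert R S"] exI[of _ "meet E d f"]) auto
qed

lemma tr_restr: "meet E' (h d) ` h ` R \<inter> nonzero E' = h ` (meet E d ` R \<inter> nonzero E)"
  unfolding tr_nonzero by (auto simp: image_iff)

lemma tr_covers: "covers G E' \<RR>'"
proof (intro covers.intro covers_axioms.intro tr_gamma_semilattice)
  show "cover_collection E' \<RR>'"
    unfolding cover_collection_def
  proof (intro ballI)
    fix e' R' assume "e' \<in> nonzero E'" "R' \<in> \<RR>' e'"
    then obtain e R where e: "e \<in> nonzero E" "e' = h e" "R \<in> \<RR> e" "R' = h ` R"
      unfolding tr_nonzero by auto
    then show "finite_cover E' e' R'"
      using coverD[OF e(1,3)] unfolding finite_cover_def tr_nonzero by auto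
  qed
  show "cond_i E' \<RR>'"
    unfolding cond_i_def
  proof (intro ballI impI)
    fix d' e' R' assume "d' \<in> nonzero E'" "e' \<in> nonzero E'" "R' \<in> \<RR>' e'" "meet E' d' e' \<noteq> bot E'"
    then obtain d e R where d: "d \<in> nonzero E" "d' = h d" "e \<in> nonzero E" "e' = h e" "R \<in> \<RR> e" "R' = h ` R"
      "meet E d e \<noteq> bot E"
      unfolding tr_nonzero by auto
    then have "meet E d e \<in> meet E d ` R \<inter> nonzero E \<or> meet E d ` R \<inter> nonzero E \<in> \<RR> (meet E d e)"
      using cond_i unfolding cond_i_def by blast
    then show "meet E' d' e' \<in> meet E' d' ` R' \<inter> nonzero E' \<or>
        meet E' d' ` R' \<inter> nonzero E' \<in> \<RR>' (meet E' d' e')"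
      unfolding d tr_restr tr_sel by blast
  qed
  show "indep E' \<RR>'"
    unfolding indep_def
  proof (intro ballI allI impI notI)
    fix e' S' d' R' f'
    assume a: "e' \<in> nonzero E'" "cprod E' \<RR>' e' S' d'" "R' \<in> \<RR>' e'" "R' \<notin> S'" "f' \<in> R'" "sl_le E' d' f'"
    then obtain e R f where e: "e \<in> nonzero E" "e' = h e" "R \<in> \<RR> e" "R' = h ` R" "f \<in> R" "f' = h f"
      unfolding tr_nonzero by auto
    obtain S d where S: "S' = (`) h ` S" "d' = h d" "cprod E \<RR> e S d"
      using tr_cprod a(2) e(2) by blast
    show False using indepD[OF e(1) S(3) e(3) _ e(5)] a e S by auto
  qed
  show "cond_iii G E' \<RR>'"
    unfolding cond_iii_def
  proof (intro ballI)
    fix g e' assume g: "g \<in> carrier G" and "e' \<in> nonzero E'"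
    then obtain e where e: "e \<in> nonzero E" "e' = h e" unfolding tr_nonzero by auto
    have "(`) (act E g) ` \<RR> e = \<RR> (act E g e)"
      using cond_iii g e unfolding cond_iii_def by blast
    then have "(`) h ` ((`) (act E g) ` \<RR> e) = \<RR>' (act E' g e')" using e by simp
    then show "(\<lambda>R. act E' g ` R) ` \<RR>' e' = \<RR>' (act E' g e')"
      using e by (simp add: image_image)
  qed
qed

lemma carrier_free_alg_tr: "carrier (free_alg E') = frag_map h ` carrier (free_alg E)"
  by (simp add: frag_map_image tr_nonzero)

text \<open>Supports play no part in the statement: h is injective on the whole type, so
  \<open>meet\<close> and the comparison with \<open>bot\<close> are transported at all
  arguments.\<close>

lemma frag_map_free_mult: "frag_map h (free_mult E x y) = free_mult E' (frag_map h x) (frag_map h y)"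
  using subset_UNIV[of "Poly_Mapping.keys x"] subset_UNIV[of "Poly_Mapping.keys y"]
  by (induction x y rule: bilinear_induct)
    (auto simp: free_mult_of frag_map_diff free_mult_diff_left free_mult_diff_right)

lemma frag_map_free_act: "frag_map h (free_act E g x) = free_act E' g (frag_map h x)"
  by (induction x rule: frag_UNIV_induct) (auto simp: frag_map_diff free_act_diff)

lemma tr_adm: "adm E' \<RR>' e' S' \<longleftrightarrow> (\<exists>e S. e' = h e \<and> S' = (`) h ` S \<and> adm E \<RR> e S)"
proof
  assume a: "adm E' \<RR>' e' S'"
  then obtain e where e: "e \<in> nonzero E" "e' = h e" by (auto simp: adm_def tr_nonzero)
  then obtain S where "S \<subseteq> \<RR> e" "finite S" "S' = (`) h ` S"
    using finite_subset_image[of S' "(`) h" "\<RR> e"] a by (auto simp: adm_def)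
  then show "\<exists>e S. e' = h e \<and> S' = (`) h ` S \<and> adm E \<RR> e S" using e by (auto simp: adm_def)
qed (auto simp: adm_def tr_nonzero)

text \<open>Joins and products are not transported term by term; both sides have the same value at
  every point h d.\<close>

lemma tr_el:
  assumes "adm E \<RR> e S"
  shows "el E' (h e) ((`) h ` S) = frag_map h (el E e S)"
proof -
  interpret tr: covers G E' \<RR>' by (rule tr_covers)
  have a: "adm E' \<RR>' (h e) ((`) h ` S)" using assms tr_adm by blast
  show ?thesis
  proof (rule tr.free_alg_eqI)
    show "Poly_Mapping.keys (el E' (h e) ((`) h ` S)) \<subseteq> nonzero E'" by (rule tr.keys_el[OF a])
    show "Poly_Mapping.keys (frag_map h (el E e S)) \<subseteq> nonzero E'"
      unfolding tr_nonzero by (rule keys_frag_map[OF keys_el[OF assms]])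
    fix d' assume d': "d' \<in> nonzero E'"
    then obtain d where d: "d \<in> nonzero E" "d' = h d" unfolding tr_nonzero by auto
    have hd: "h d \<in> nonzero E'" using d' d by simp
    show "lin (sl_le E' d') (el E' (h e) ((`) h ` S)) = lin (sl_le E' d') (frag_map h (el E e S))"
      unfolding tr.lin_el[OF tr.is_char_le[OF hd] a] lin_frag_map' d(2) tr_le
        lin_el[OF is_char_le[OF d(1)] assms] by auto
  qed
qed

lemma tr_nonzero_next: "nonzero (next_sl E' \<RR>') = frag_map h ` nonzero N"
proof -
  interpret tr: covers G E' \<RR>' by (rule tr_covers)
  show ?thesis
  proof
    show "nonzero (next_sl E' \<RR>') \<subseteq> frag_map h ` nonzero N"
    proof
      fix x assume "x \<in> nonzero (next_sl E' \<RR>')"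
      then obtain e' S' where "adm E' \<RR>' e' S'" "S' \<noteq> {}" "x = el E' e' S'" by (auto simp: tr.nonzero_N)
      then obtain e S where eS: "adm E \<RR> e S" "S \<noteq> {}" "x = el E' (h e) ((`) h ` S)"
        using tr_adm by auto
      then have "x = frag_map h (el E e S)" using tr_el[OF eS(1)] by simp
      with eS show "x \<in> frag_map h ` nonzero N" using el_N by blast
    qed
    show "frag_map h ` nonzero N \<subseteq> nonzero (next_sl E' \<RR>')"
    proof
      fix x assume "x \<in> frag_map h ` nonzero N"
      then obtain e S where "adm E \<RR> e S" "S \<noteq> {}" "x = frag_map h (el E e S)" by (auto simp: nonzero_N)
      then show "x \<in> nonzero (next_sl E' \<RR>')"
        using tr.el_N[of "h e" "(`) h ` S"] tr_adm tr_el by auto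
    qed
  qed
qed

lemma tr_cover_span: "cover_span E' \<RR>' = frag_map h ` cover_span E \<RR>"
proof -
  have "frag_extend id (frag_map (frag_map h) z) = frag_map h (frag_extend id z)" for z
    unfolding frag_extend_frag_map frag_map_frag_extend by simp
  then show ?thesis
    unfolding cover_span_def tr_nonzero_next frag_map_image[symmetric] by (simp only: image_image)
qed

end

section \<open>One step of the resolution\<close>

context covers
begin

lemma frag_extend_id_free_mult:
  assumes "Poly_Mapping.keys x \<subseteq> nonzero N" "Poly_Mapping.keys y \<subseteq> nonzero N"
  shows "frag_extend id (free_mult N x y) = free_mult E (frag_extend id x) (frag_extend id y)"
  using assms
  by (induction x y rule: bilinear_induct)
    (auto simp: free_mult_of frag_extend_diff free_mult_diff_left free_mult_diff_right)

lemma frag_extend_id_free_act: "frag_extend id (free_act N g x) = free_act E g (frag_extend id x)"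
  by (induction x rule: frag_UNIV_induct) (auto simp: free_act_diff frag_extend_diff)

context
  fixes h :: "('a \<Rightarrow>\<^sub>0 int) \<Rightarrow> 'c"
  assumes inj_h: "inj h"
begin

interpretation nt: covers_transport G N M h
  by (intro covers_transport.intro covers_transport_axioms.intro next_covers inj_h)

text \<open>Undoing the copy along h turns the map on the transported algebra into the plain
  extension of the inclusion of the next semilattice.\<close>

lemma frag_extend_inv_frag_map: "frag_extend (inv_into UNIV h) (frag_map h z) = frag_extend id z"
  by (simp add: frag_extend_frag_map id_def)

lemma step_image:
  "frag_extend (inv_into UNIV h) ` carrier (free_alg nt.E') = cover_span E \<RR>"
  unfolding nt.carrier_free_alg_tr image_image frag_extend_inv_frag_map
  by (simp add: cover_span_def)

text \<open>The kernel is expressed through the transported pair because \<open>step_image\<close>,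
  applied to that pair, describes the image of the following map in the same form.\<close>

lemma step_kernel:
  "a_kernel (free_alg nt.E') (free_alg E) (frag_extend (inv_into UNIV h)) = cover_span nt.E' nt.\<RR>'"
proof -
  have "a_kernel (free_alg nt.E') (free_alg E) (frag_extend (inv_into UNIV h))
      = frag_map h ` {z. Poly_Mapping.keys z \<subseteq> nonzero N \<and> frag_extend id z = 0}"
    unfolding a_kernel_def' nt.carrier_free_alg_tr using frag_extend_inv_frag_map by auto
  also have "{z. Poly_Mapping.keys z \<subseteq> nonzero N \<and> frag_extend id z = 0} = cover_span N M"
    using kernel_eq_cover_span nt.keys_cover_span by blast
  finally show ?thesis unfolding nt.tr_cover_span .
qed

lemma step_equivariant:
  "equivariant_hom G (free_alg nt.E') (free_act nt.E') (free_alg E) (free_act E)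
    (frag_extend (inv_into UNIV h))"
  unfolding equivariant_hom_def alg_hom_def nt.carrier_free_alg_tr
  using keys_frag_extend_id[THEN subsetD]
  by (auto simp: frag_extend_add frag_extend_inv_frag_map frag_extend_id_free_mult
      frag_extend_id_free_act simp flip: nt.frag_map_free_mult nt.frag_map_free_act)

end

text \<open>The number of steps is added on the left instead of being subtracted from b, so that the
  bound becomes contradictory, not merely zero, once k exceeds b.\<close>

lemma next_covers_bound:
  assumes b: "\<And>e. e \<in> nonzero E \<Longrightarrow> finite (\<RR> e) \<and> card (\<RR> e) + k \<le> b" and x: "x \<in> nonzero N"
  shows "finite (M x) \<and> card (M x) + Suc k \<le> b"
proof -
  obtain e S where eS: "adm E \<RR> e S" "S \<noteq> {}" "x = el E e S" using x by (auto simp: nonzero_N)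
  have e: "finite (\<RR> e)" "card (\<RR> e) + k \<le> b" "S \<subseteq> \<RR> e" "finite S"
    using b eS by (auto simp: adm_def)
  have M: "M x = next_cover E e S ` (\<RR> e - S)" unfolding eS(3) by (rule next_covers_el[OF eS(1,2)])
  have "card (M x) \<le> card (\<RR> e - S)" unfolding M using e by (intro card_image_le) auto
  also have "\<dots> < card (\<RR> e)" using e eS(2) by (intro psubset_card_mono) auto
  finally show ?thesis using e M by auto
qed

section \<open>The quotient algebra\<close>

abbreviation "I \<equiv> cover_span E \<RR>"
abbreviation "cls x \<equiv> I +>\<^bsub>free_alg E\<^esub> x"

lemma abelian_subgroup_I: "abelian_subgroup I (free_alg E)"
  using alg_ideal_cover_span abelian_group_free_alg
  by (intro abelian_subgroupI3) (auto simp: alg_ideal_def)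

lemma cls_def: "cls x = (\<lambda>i. i + x) ` I"
  by (auto simp: a_r_coset_def')

lemma cls_eq_iff: "cls x = cls y \<longleftrightarrow> x - y \<in> I"
proof
  assume "cls x = cls y"
  moreover have "x \<in> cls x" unfolding cls_def using cover_span_zero by (force simp: image_iff)
  ultimately obtain i where "i \<in> I" "x = i + y" unfolding cls_def by auto
  then show "x - y \<in> I" by simp
next
  assume d: "x - y \<in> I"
  have "i + x \<in> cls y" if "i \<in> I" for i
    unfolding cls_def using cover_span_add[OF that d]
    by (intro image_eqI[of _ _ "i + (x - y)"]) auto
  moreover have "i + y \<in> cls x" if "i \<in> I" for i
    unfolding cls_def using cover_span_diff[OF that d]
    by (intro image_eqI[of _ _ "i - (x - y)"]) auto
  ultimately show "cls x = cls y" unfolding cls_def[of x] cls_def[of y] by blast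
qed

lemma cover_quot_sel:
  "carrier (cover_quot E \<RR>) = cls ` carrier (free_alg E)"
  "zero (cover_quot E \<RR>) = cls 0"
  by (auto simp: cover_quot_def cover_ideal_eq FactRing_def A_RCOSETS_def' cls_def)

lemma cover_quot_add:
  assumes "x \<in> carrier (free_alg E)" "y \<in> carrier (free_alg E)"
  shows "cls x \<oplus>\<^bsub>cover_quot E \<RR>\<^esub> cls y = cls (x + y)"
  using abelian_subgroup.a_rcos_sum[OF abelian_subgroup_I assms]
  by (simp add: cover_quot_def cover_ideal_eq FactRing_def)

text \<open>The product of cosets is a union over all pairs of representatives. Because I is an
  ideal, all the cosets in this union coincide, and since the cosets are non-empty the union is that
  one coset.\<close>

lemma cover_quot_mult:
  assumes x: "x \<in> carrier (free_alg E)" and y: "y \<in> carrier (free_alg E)"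
  shows "cls x \<otimes>\<^bsub>cover_quot E \<RR>\<^esub> cls y = cls (free_mult E x y)"
proof -
  have "cls (free_mult E a b) = cls (free_mult E x y)" if ab: "a \<in> cls x" "b \<in> cls y" for a b
  proof -
    obtain i j where ij: "i \<in> I" "j \<in> I" "a = i + x" "b = j + y" using ab unfolding cls_def by auto
    have ki: "Poly_Mapping.keys i \<subseteq> nonzero E" "Poly_Mapping.keys b \<subseteq> nonzero E"
      using ij(1,2) keys_cover_span y unfolding ij(4) by (simp_all add: keys_sub_diff)
    have "free_mult E a b - free_mult E x y = free_mult E i b + free_mult E x j"
      unfolding ij by (simp add: free_mult_add_left free_mult_add_right)
    also have "free_mult E i b = free_mult E b i" using free_mult_comm ki by blast
    finally have "free_mult E a b - free_mult E x y \<in> I"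
      using cover_span_add[OF cover_span_mult[OF ki(2) ij(1)] cover_span_mult[OF _ ij(2), of x]] x by simp
    then show ?thesis by (simp add: cls_eq_iff)
  qed
  then have "(\<Union>a\<in>cls x. \<Union>b\<in>cls y. cls (free_mult E a b))
      = (\<Union>a\<in>cls x. \<Union>b\<in>cls y. cls (free_mult E x y))"
    by (intro SUP_cong refl) auto
  also have "\<dots> = cls (free_mult E x y)"
    using cover_span_zero[of E \<RR>] by (auto simp: cls_def)
  finally show ?thesis
    by (simp add: cover_quot_def cover_ideal_eq FactRing_def rcoset_mult_def)
qed

lemma comm_alg_cover_quot: "comm_alg (cover_quot E \<RR>)"
proof (intro comm_alg.intro comm_alg_axioms.intro)
  let ?D = "cover_quot E \<RR>"
  show "abelian_group ?D"
  proof (rule abelian_groupI)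
    fix X assume "X \<in> carrier ?D"
    then obtain x where x: "X = cls x" "x \<in> carrier (free_alg E)" by (auto simp: cover_quot_sel)
    then have "cls (- x) \<oplus>\<^bsub>?D\<^esub> X = \<zero>\<^bsub>?D\<^esub>" "cls (- x) \<in> carrier ?D"
      using cover_quot_add[of "- x" x] by (auto simp: cover_quot_sel)
    then show "\<exists>Y\<in>carrier ?D. Y \<oplus>\<^bsub>?D\<^esub> X = \<zero>\<^bsub>?D\<^esub>" by blast
  qed (auto simp: cover_quot_sel cover_quot_add keys_sub_diff add_ac)
  fix X Y assume "X \<in> carrier ?D" "Y \<in> carrier ?D"
  then obtain x y where xy: "x \<in> carrier (free_alg E)" "X = cls x" "y \<in> carrier (free_alg E)" "Y = cls y"
    by (auto simp: cover_quot_sel)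
  then show "X \<otimes>\<^bsub>?D\<^esub> Y = Y \<otimes>\<^bsub>?D\<^esub> X"
    using free_mult_comm[of x y] by (simp add: cover_quot_mult)
qed (auto simp: cover_quot_sel cover_quot_add cover_quot_mult free_mult_closed free_mult_assoc
    keys_sub_diff free_mult_add_left)

lemma free_act_I:
  assumes "g \<in> carrier G" "x \<in> I"
  shows "free_act E g x \<in> I"
proof -
  interpret nx: gamma_semilattice G N by (rule next_gamma_semilattice)
  obtain z where "Poly_Mapping.keys z \<subseteq> nonzero N" "x = frag_extend id z"
    using assms by (auto simp: cover_span_def)
  then show ?thesis
    unfolding cover_span_def using nx.keys_free_act[OF assms(1)]
    by (intro image_eqI[of _ _ "free_act N g z"]) (auto simp: frag_extend_id_free_act)
qed

text \<open>The image of a coset is a full coset only if g maps I onto I; surjectivity comes from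
  the invariance of I under the inverse of g.\<close>

lemma cover_quot_act_cls:
  assumes g: "g \<in> carrier G"
  shows "cover_quot_act E g (cls x) = cls (free_act E g x)"
proof -
  interpret Gr: group G by (rule group_G)
  have "i \<in> free_act E g ` I" if i: "i \<in> I" for i
  proof (rule image_eqI)
    show "free_act E (inv\<^bsub>G\<^esub> g) i \<in> I" using free_act_I g i by simp
    have "free_act E (g \<otimes>\<^bsub>G\<^esub> inv\<^bsub>G\<^esub> g) i = free_act E g (free_act E (inv\<^bsub>G\<^esub> g) i)"
      using g i keys_cover_span by (intro free_act_act) auto
    then show "i = free_act E g (free_act E (inv\<^bsub>G\<^esub> g) i)"
      using g i keys_cover_span free_act_one by simp
  qed
  then have "free_act E g ` I = I" using free_act_I[OF g] by blast
  then have "(\<lambda>i. i + free_act E g x) ` free_act E g ` I = cls (free_act E g x)" by (simp add: cls_def)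
  then show ?thesis by (simp add: cover_quot_act_def cls_def image_image free_act_add)
qed

lemma gamma_alg_cover_quot: "gamma_alg G (cover_quot E \<RR>) (cover_quot_act E)"
  unfolding gamma_alg_def
proof (intro conjI ballI)
  show "comm_alg (cover_quot E \<RR>)" by (rule comm_alg_cover_quot)
  have G: "monoid G" using group_G by (simp add: group_def)
  show "group_action G (carrier (cover_quot E \<RR>))
      (\<lambda>g. restrict (cover_quot_act E g) (carrier (cover_quot E \<RR>)))"
    using keys_free_act monoid.m_closed[OF G] monoid.one_closed[OF G]
    by (intro group_actionI[OF group_G])
      (auto simp: cover_quot_sel cover_quot_act_cls free_act_one free_act_act)
  show "cover_quot_act E g \<in> alg_hom (cover_quot E \<RR>) (cover_quot E \<RR>)" if "g \<in> carrier G" for g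
    using that keys_free_act
    by (auto simp: alg_hom_def cover_quot_sel cover_quot_act_cls cover_quot_add cover_quot_mult
        keys_sub_diff free_mult_closed free_act_add free_act_free_mult)
qed

end

section \<open>The resolution\<close>

context covers
begin

interpretation base: covers_transport G E \<RR> Base
  by (intro covers_transport.intro covers_transport_axioms.intro covers_axioms inj_Base)

lemma cover_proj_frag_map: "cover_proj E \<RR> (frag_map Base x) = cls x"
  by (simp add: cover_proj_def cover_ideal_eq frag_map_inv[OF inj_Base])

lemma cover_proj_equivariant:
  "equivariant_hom G (free_alg base.E') (free_act base.E') (cover_quot E \<RR>) (cover_quot_act E)
    (cover_proj E \<RR>)"
  unfolding equivariant_hom_def alg_hom_def base.carrier_free_alg_tr
  by (auto simp: cover_quot_sel cover_proj_frag_map cover_quot_add cover_quot_mult cover_quot_act_cls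
      simp flip: base.frag_map_free_mult base.frag_map_free_act frag_map_add)

lemma cover_proj_surj: "cover_proj E \<RR> ` carrier (free_alg base.E') = carrier (cover_quot E \<RR>)"
  unfolding base.carrier_free_alg_tr cover_quot_sel image_image cover_proj_frag_map ..

lemma cover_proj_kernel:
  "a_kernel (free_alg base.E') (cover_quot E \<RR>) (cover_proj E \<RR>) = cover_span base.E' base.\<RR>'"
proof -
  have "a_kernel (free_alg base.E') (cover_quot E \<RR>) (cover_proj E \<RR>)
      = frag_map Base ` {x \<in> carrier (free_alg E). cls x = cls 0}"
    unfolding a_kernel_def' base.carrier_free_alg_tr cover_quot_sel using cover_proj_frag_map by auto
  also have "{x \<in> carrier (free_alg E). cls x = cls 0} = I"
    unfolding cls_eq_iff using keys_cover_span by auto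
  finally show ?thesis unfolding base.tr_cover_span .
qed

section \<open>The iterated pairs\<close>

abbreviation "Fk k \<equiv> iter_sl E \<RR> k"
abbreviation "Sk k \<equiv> snd (iter_pair E \<RR> k)"

lemma iter_0: "Fk 0 = base.E'" "Sk 0 = base.\<RR>'"
  by (simp_all add: iter_sl_def)

lemma iter_Suc:
  "Fk (Suc k) = transport_sl comb (next_sl (Fk k) (Sk k))"
  "Sk (Suc k) = transport_covers comb (next_covers (Fk k) (Sk k))"
  by (simp_all add: iter_sl_def case_prod_beta Let_def)

lemma iter_covers: "covers G (Fk k) (Sk k)"
proof (induction k)
  case 0
  show ?case unfolding iter_0 by (rule base.tr_covers)
next
  case (Suc k)
  then interpret k: covers G "Fk k" "Sk k" .
  interpret nt: covers_transport G k.N k.M comb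
    by (intro covers_transport.intro covers_transport_axioms.intro k.next_covers inj_comb)
  show ?case unfolding iter_Suc by (rule nt.tr_covers)
qed

lemma iter_bound:
  assumes "\<And>e. e \<in> nonzero E \<Longrightarrow> finite (\<RR> e) \<and> card (\<RR> e) \<le> b"
  shows "e \<in> nonzero (Fk k) \<Longrightarrow> finite (Sk k e) \<and> card (Sk k e) + k \<le> b"
proof (induction k arbitrary: e)
  case 0
  then obtain d where "d \<in> nonzero E" "e = Base d" unfolding iter_0 base.tr_nonzero by auto
  then show ?case
    using assms[of d] card_image_le[of "\<RR> d" "(`) Base"] unfolding iter_0 by auto
next
  case (Suc k)
  interpret k: covers G "Fk k" "Sk k" by (rule iter_covers)
  interpret nt: covers_transport G k.N k.M comb
    by (intro covers_transport.intro covers_transport_axioms.intro k.next_covers inj_comb)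
  obtain x where x: "x \<in> nonzero k.N" "e = comb x"
    using Suc.prems unfolding iter_Suc nt.tr_nonzero by auto
  have "finite (k.M x) \<and> card (k.M x) + Suc k \<le> b"
    using k.next_covers_bound[OF Suc.IH x(1)] by blast
  then show ?case
    using card_image_le[of "k.M x" "(`) comb"] x(2) unfolding iter_Suc by auto
qed

lemma resolution:
  "algebraic_independent_resolution G (cover_quot E \<RR>) (cover_quot_act E)
    (iter_sl E \<RR>) (\<lambda>k. iter_diff) (cover_proj E \<RR>)"
  unfolding algebraic_independent_resolution_def
proof (intro conjI allI)
  have im: "iter_diff ` carrier (free_alg (Fk (Suc k))) = cover_span (Fk k) (Sk k)" for k
    unfolding iter_diff_def iter_Suc by (rule covers.step_image[OF iter_covers inj_comb])
  have ker: "a_kernel (free_alg (Fk (Suc k))) (free_alg (Fk k)) iter_diff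
      = cover_span (Fk (Suc k)) (Sk (Suc k))" for k
    unfolding iter_diff_def iter_Suc by (rule covers.step_kernel[OF iter_covers inj_comb])
  show "gamma_alg G (cover_quot E \<RR>) (cover_quot_act E)" by (rule gamma_alg_cover_quot)
  show "gamma_semilattice G (Fk k)" for k using iter_covers by (simp add: covers_def)
  show "equivariant_hom G (free_alg (Fk 0)) (free_act (Fk 0)) (cover_quot E \<RR>) (cover_quot_act E)
      (cover_proj E \<RR>)"
    unfolding iter_0 by (rule cover_proj_equivariant)
  show "equivariant_hom G (free_alg (Fk (Suc k))) (free_act (Fk (Suc k))) (free_alg (Fk k))
      (free_act (Fk k)) iter_diff" for k
    unfolding iter_diff_def iter_Suc by (rule covers.step_equivariant[OF iter_covers inj_comb])
  show "cover_proj E \<RR> ` carrier (free_alg (Fk 0)) = carrier (cover_quot E \<RR>)"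
    unfolding iter_0 by (rule cover_proj_surj)
  show "iter_diff ` carrier (free_alg (Fk 1)) = a_kernel (free_alg (Fk 0)) (cover_quot E \<RR>) (cover_proj E \<RR>)"
    using im[of 0] cover_proj_kernel by (simp add: iter_0)
  show "iter_diff ` carrier (free_alg (Fk (Suc (Suc k))))
      = a_kernel (free_alg (Fk (Suc k))) (free_alg (Fk k)) iter_diff" for k
    unfolding im ker ..
qed

lemma resolution_length_bound:
  assumes "cover_bound E \<RR> < \<infinity>"
  shows "resolution_length (iter_sl E \<RR>) \<le> cover_bound E \<RR>"
proof -
  obtain b where b: "cover_bound E \<RR> = enat b" using assms by auto
  have "finite (\<RR> e) \<and> card (\<RR> e) \<le> b" if "e \<in> nonzero E" for e
  proof -
    have "ecard (\<RR> e) \<le> enat b" using that unfolding b[symmetric] cover_bound_def by (rule SUP_upper)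
    then show ?thesis by (auto simp: ecard_def split: if_splits)
  qed
  \<comment> \<open>A nonzero element at level b + 1 would give a number of covers plus b + 1 that
    is at most b. Level b + 1 being zero is exactly length at most b.\<close>
  then have "nonzero (Fk (Suc b)) = {}" using iter_bound[of b _ "Suc b"] by fastforce
  moreover have "bot (Fk (Suc b)) \<in> carrier (Fk (Suc b))"
    using covers.axioms(1)[OF iter_covers] by (rule gamma_semilattice.bot_closed)
  ultimately have c: "carrier (Fk (Suc b)) = {bot (Fk (Suc b))}" by (auto simp: nonzero_def)
  then have "(LEAST n. carrier (Fk (Suc n)) = {bot (Fk (Suc n))}) \<le> b" by (rule Least_le)
  then show ?thesis unfolding b resolution_length_def using c by auto
qed

end

theorem corollary4p12:
  fixes G :: "('g, 'm) monoid_scheme" and E :: "('g, 'a) gsl" and \<RR> :: "'a \<Rightarrow> 'a set set"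
  assumes "group G"
    and "gamma_semilattice G E"
    and "cover_collection E \<RR>"
    and "cond_i E \<RR>"
    and "cond_ii E \<RR>"
    and "cond_iii G E \<RR>"
    and "cover_bound E \<RR> < \<infinity>"
  shows "algebraic_independent_resolution G (cover_quot E \<RR>) (cover_quot_act E)
           (iter_sl E \<RR>) (\<lambda>k. iter_diff) (cover_proj E \<RR>)
         \<and> resolution_length (iter_sl E \<RR>) \<le> cover_bound E \<RR>"
proof -
  interpret covers G E \<RR>
    using assms gamma_semilattice.cond_ii_imp_indep
    by (intro covers.intro covers_axioms.intro) auto
  show ?thesis using resolution resolution_length_bound assms(7) by blast
qed

end
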